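(* Let $n\geq 3$ and let $(M,g)$ be a compact hyperbolic manifold of dimension $n$. Then for every neighborhood $\mathcal{V}$ of $g$ in the $C^3$ topology on Riemannian metrics on $M$, there exists a Riemannian metric $\tilde g\in\mathcal{V}$ of negative sectional curvature on $M$ such that, denoting by $a_1$ the best local (relative) pinching constant of $\tilde g$ and by $a_2$ the best global pinching constant of $\tilde g$, \[ 0<a_1<1,\qquad \frac{1-a_2}{1-a_1}\geq\frac32 . \] In particular, $\tilde g$ is strictly better relatively pinched than pinched, i.e. $a_2<a_1$.
   Context: A hyperbolic manifold is a Riemannian manifold with constant sectional curvature $-1$. Let $\tilde K(x,P)<0$ denote the sectional curvature of $\tilde g$ at $x\in M$ along the $2$-plane $P\subset T_xM$. The best local (relative) pinching constant $a_1$ is the largest $a\in(0,1]$ such that $\tilde K(x,P)/\tilde K(x,Q)\geq a^2$ for every $x\in M$ and all $2$-planes $P,Q\subset T_xM$. The best global pinching constant $a_2$ is the largest $a\in(0,1]$ such that, after multiplying $\tilde g$ by a suitable positive constant, its sectional curvature satisfies $-1\leq \tilde K\leq -a^2$ everywhere; equivalently, the largest $a$ such that $\tilde K(x,P)/\tilde K(y,Q)\geq a^2$ for all $x,y\in M$ and all $2$-planes $P\subset T_xM$, $Q\subset T_yM$. *)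

theory Defs
  imports "HOL-Analysis.Analysis"
begin

section \<open>Smooth functions on open subsets of Euclidean space\<close>

definition partial :: "'n \<Rightarrow> (real^'n \<Rightarrow> 'b::real_normed_vector) \<Rightarrow> real^'n \<Rightarrow> 'b" where
  "partial i f x = frechet_derivative f (at x) (axis i 1)"

fun partials :: "'n list \<Rightarrow> (real^'n \<Rightarrow> 'b::real_normed_vector) \<Rightarrow> real^'n \<Rightarrow> 'b" where
  "partials [] f = f"
| "partials (i # is) f = partial i (partials is f)"

text \<open>Only used for open \<open>S\<close>, where it is \<open>C\<^sup>\<infinity>\<close>: all iterated partial derivatives exist and are
  differentiable, hence continuous.\<close>

definition smooth_on :: "(real^'n) set \<Rightarrow> (real^'n \<Rightarrow> 'b::real_normed_vector) \<Rightarrow> bool" where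
  "smooth_on S f \<longleftrightarrow> (\<forall>is. \<forall>x\<in>S. partials is f differentiable (at x))"


section \<open>Smooth manifolds\<close>

text \<open>The manifold is the whole type \<open>'m\<close>, of dimension \<open>CARD('n)\<close>; its smooth structure is given
  by an atlas, which need not be maximal. A chart is a pair of an open set and a coordinate map
  whose values outside that set are irrelevant.\<close>

type_synonym ('m, 'n) chart = "'m set \<times> ('m \<Rightarrow> real^'n)"

definition chart_image :: "('m, 'n) chart \<Rightarrow> (real^'n) set" where
  "chart_image c = snd c ` fst c"

definition chart_inv :: "('m, 'n) chart \<Rightarrow> real^'n \<Rightarrow> 'm" where
  "chart_inv c = inv_into (fst c) (snd c)"

definition is_chart :: "('m::topological_space, 'n::finite) chart \<Rightarrow> bool" where
  "is_chart c \<longleftrightarrow> open (fst c) \<and> open (chart_image c) \<and>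
     homeomorphism (fst c) (chart_image c) (snd c) (chart_inv c)"

definition transition :: "('m, 'n) chart \<Rightarrow> ('m, 'n) chart \<Rightarrow> real^'n \<Rightarrow> real^'n" where
  "transition c d = snd d \<circ> chart_inv c"

definition overlap :: "('m, 'n) chart \<Rightarrow> ('m, 'n) chart \<Rightarrow> (real^'n) set" where
  "overlap c d = snd c ` (fst c \<inter> fst d)"

definition smooth_atlas ::
  "('m::{t2_space, second_countable_topology}, 'n::finite) chart set \<Rightarrow> bool" where
  "smooth_atlas A \<longleftrightarrow> (\<forall>c\<in>A. is_chart c) \<and> (\<Union>c\<in>A. fst c) = UNIV \<and>
     (\<forall>c\<in>A. \<forall>d\<in>A. smooth_on (overlap c d) (transition c d))"


section \<open>Riemannian metrics\<close>

text \<open>A tensor field of type \<open>(0,2)\<close> is the family of its component matrices \<open>g\<^sub>i\<^sub>j\<close> in the charts of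
  the atlas, as functions of the coordinates, related by the tensor transformation law. Setting
  the components to \<open>0\<close> where they carry no meaning makes this representation unique. Throughout,
  the tangent space at the point with coordinates \<open>x\<close> in the chart \<open>c\<close> is identified with
  \<open>real^'n\<close> by the coordinate basis.\<close>

type_synonym ('m, 'n) tensor2 = "('m, 'n) chart \<Rightarrow> real^'n \<Rightarrow> real^'n^'n"

definition riemannian_metric ::
  "('m::{t2_space, second_countable_topology}, 'n::finite) chart set \<Rightarrow> ('m, 'n) tensor2 \<Rightarrow> bool" where
  "riemannian_metric A g \<longleftrightarrow>
     (\<forall>c x. c \<notin> A \<or> x \<notin> chart_image c \<longrightarrow> g c x = 0) \<and>
     (\<forall>c\<in>A. smooth_on (chart_image c) (g c)) \<and>
     (\<forall>c\<in>A. \<forall>x\<in>chart_image c. transpose (g c x) = g c x \<and> (\<forall>v. v \<noteq> 0 \<longrightarrow> v \<bullet> (g c x *v v) > 0)) \<and>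
     (\<forall>c\<in>A. \<forall>d\<in>A. \<forall>x\<in>overlap c d.
        let J = matrix (frechet_derivative (transition c d) (at x))
        in g c x = transpose J ** g d (transition c d x) ** J)"

definition scale_metric :: "real \<Rightarrow> ('m, 'n::finite) tensor2 \<Rightarrow> ('m, 'n) tensor2" where
  "scale_metric s g = (\<lambda>c x. s *\<^sub>R g c x)"

text \<open>The (weak) \<open>C\<^sup>r\<close> topology on the set of Riemannian metrics: uniform convergence on compact
  subsets of charts of all partial derivatives of order at most \<open>r\<close>.\<close>

definition C_basic_nbhd ::
  "nat \<Rightarrow> ('m::{t2_space, second_countable_topology}, 'n::finite) chart set \<Rightarrow> ('m, 'n) tensor2 \<Rightarrow>
     ('m, 'n) chart \<Rightarrow> (real^'n) set \<Rightarrow> real \<Rightarrow> ('m, 'n) tensor2 set" where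
  "C_basic_nbhd r A g c K e = {h. riemannian_metric A h \<and>
     (\<forall>is. length is \<le> r \<longrightarrow> (\<forall>x\<in>K. dist (partials is (h c) x) (partials is (g c) x) < e))}"

definition C_topology ::
  "nat \<Rightarrow> ('m::{t2_space, second_countable_topology}, 'n::finite) chart set \<Rightarrow>
     ('m, 'n) tensor2 topology" where
  "C_topology r A = topology_generated_by
     {C_basic_nbhd r A g c K e | g c K e.
        riemannian_metric A g \<and> c \<in> A \<and> compact K \<and> K \<subseteq> chart_image c \<and> e > 0}"

definition is_neighborhood :: "'a topology \<Rightarrow> 'a \<Rightarrow> 'a set \<Rightarrow> bool" where
  "is_neighborhood T a V \<longleftrightarrow> V \<subseteq> topspace T \<and> (\<exists>W. openin T W \<and> a \<in> W \<and> W \<subseteq> V)"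


section \<open>Sectional curvature\<close>

text \<open>\<open>G\<close> is a metric in coordinates, and \<open>christoffel G k i j\<close> is \<open>\<Gamma>\<^sup>k\<^sub>i\<^sub>j\<close>.\<close>

definition christoffel ::
  "(real^'n \<Rightarrow> real^'n^'n) \<Rightarrow> 'n::finite \<Rightarrow> 'n \<Rightarrow> 'n \<Rightarrow> real^'n \<Rightarrow> real" where
  "christoffel G k i j x = 1/2 * (\<Sum>l\<in>UNIV. matrix_inv (G x) $ k $ l *
     (partial i (\<lambda>y. G y $ j $ l) x + partial j (\<lambda>y. G y $ i $ l) x - partial l (\<lambda>y. G y $ i $ j) x))"

text \<open>The \<open>l\<close>-th component of \<open>R(\<partial>\<^sub>i, \<partial>\<^sub>j) \<partial>\<^sub>k\<close>, where
  \<open>R(X, Y) Z = \<nabla>\<^sub>X \<nabla>\<^sub>Y Z - \<nabla>\<^sub>Y \<nabla>\<^sub>X Z - \<nabla>\<^bsub>[X, Y]\<^esub> Z\<close>.\<close>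

definition riemann_coeff ::
  "(real^'n \<Rightarrow> real^'n^'n) \<Rightarrow> 'n::finite \<Rightarrow> 'n \<Rightarrow> 'n \<Rightarrow> 'n \<Rightarrow> real^'n \<Rightarrow> real" where
  "riemann_coeff G l i j k x =
     partial i (christoffel G l j k) x - partial j (christoffel G l i k) x +
     (\<Sum>m\<in>UNIV. christoffel G l i m x * christoffel G m j k x
              - christoffel G l j m x * christoffel G m i k x)"

definition riemann_tensor ::
  "(real^'n \<Rightarrow> real^'n^'n) \<Rightarrow> real^'n \<Rightarrow> real^'n \<Rightarrow> real^'n \<Rightarrow> real^'n \<Rightarrow> real^'n::finite" where
  "riemann_tensor G x u v w =
     (\<chi> l. \<Sum>i\<in>UNIV. \<Sum>j\<in>UNIV. \<Sum>k\<in>UNIV. riemann_coeff G l i j k x * u $ i * v $ j * w $ k)"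

definition metric_inner ::
  "(real^'n \<Rightarrow> real^'n^'n) \<Rightarrow> real^'n \<Rightarrow> real^'n \<Rightarrow> real^'n::finite \<Rightarrow> real" where
  "metric_inner G x u v = u \<bullet> (G x *v v)"

definition two_planes :: "(real^'n::finite) set set" where
  "two_planes = {P. subspace P \<and> dim P = 2}"

text \<open>The quotient does not depend on the basis \<open>u, v\<close> of the plane.\<close>

definition local_sectional_curvature ::
  "(real^'n \<Rightarrow> real^'n^'n) \<Rightarrow> real^'n \<Rightarrow> (real^'n::finite) set \<Rightarrow> real" where
  "local_sectional_curvature G x P =
     (SOME k. \<exists>u v. span {u, v} = P \<and>
        k = metric_inner G x (riemann_tensor G x u v v) u /
            (metric_inner G x u u * metric_inner G x v v - (metric_inner G x u v)\<^sup>2))"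

definition sectional_curvature ::
  "('m, 'n::finite) tensor2 \<Rightarrow> ('m, 'n) chart \<Rightarrow> real^'n \<Rightarrow> (real^'n) set \<Rightarrow> real" where
  "sectional_curvature g c x P = local_sectional_curvature (g c) x P"

definition hyperbolic_metric ::
  "('m::{t2_space, second_countable_topology}, 'n::finite) chart set \<Rightarrow> ('m, 'n) tensor2 \<Rightarrow> bool" where
  "hyperbolic_metric A g \<longleftrightarrow> riemannian_metric A g \<and>
     (\<forall>c\<in>A. \<forall>x\<in>chart_image c. \<forall>P\<in>two_planes. sectional_curvature g c x P = -1)"

definition negatively_curved ::
  "('m::{t2_space, second_countable_topology}, 'n::finite) chart set \<Rightarrow> ('m, 'n) tensor2 \<Rightarrow> bool" where
  "negatively_curved A g \<longleftrightarrow>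
     (\<forall>c\<in>A. \<forall>x\<in>chart_image c. \<forall>P\<in>two_planes. sectional_curvature g c x P < 0)"


section \<open>Pinching constants\<close>

definition locally_pinched ::
  "('m, 'n::finite) chart set \<Rightarrow> ('m, 'n) tensor2 \<Rightarrow> real \<Rightarrow> bool" where
  "locally_pinched A g a \<longleftrightarrow> (\<forall>c\<in>A. \<forall>x\<in>chart_image c. \<forall>P\<in>two_planes. \<forall>Q\<in>two_planes.
     sectional_curvature g c x P / sectional_curvature g c x Q \<ge> a\<^sup>2)"

definition globally_pinched ::
  "('m, 'n::finite) chart set \<Rightarrow> ('m, 'n) tensor2 \<Rightarrow> real \<Rightarrow> bool" where
  "globally_pinched A g a \<longleftrightarrow> (\<exists>s>0. \<forall>c\<in>A. \<forall>x\<in>chart_image c. \<forall>P\<in>two_planes.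
     -1 \<le> sectional_curvature (scale_metric s g) c x P \<and>
     sectional_curvature (scale_metric s g) c x P \<le> -(a\<^sup>2))"

definition is_greatest :: "real set \<Rightarrow> real \<Rightarrow> bool" where
  "is_greatest S a \<longleftrightarrow> a \<in> S \<and> (\<forall>b\<in>S. b \<le> a)"

definition best_local_pinching ::
  "('m, 'n::finite) chart set \<Rightarrow> ('m, 'n) tensor2 \<Rightarrow> real \<Rightarrow> bool" where
  "best_local_pinching A g a \<longleftrightarrow> is_greatest {b \<in> {0<..1}. locally_pinched A g b} a"

definition best_global_pinching ::
  "('m, 'n::finite) chart set \<Rightarrow> ('m, 'n) tensor2 \<Rightarrow> real \<Rightarrow> bool" where
  "best_global_pinching A g a \<longleftrightarrow> is_greatest {b \<in> {0<..1}. globally_pinched A g b} a"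

end

theory Submission
  imports Defs
begin

text \<open>Deform \<open>g\<close> conformally inside one chart, \<open>g' = (1 + \<epsilon> f) g\<close>, with \<open>f = \<delta>\<^sup>2 \<psi>(r\<^sup>2/\<delta>\<^sup>2)\<close> a radial bump
  at a point \<open>x\<^sub>0\<close>. To first order in \<open>\<epsilon>\<close> the curvature on a plane \<open>P\<close> is \<open>-1 - \<epsilon>/2 tr\<^sub>P Hess f\<close>, up to terms
  of order \<open>\<epsilon> f\<close> that are harmless for small \<open>\<delta>\<close>. For small \<open>\<delta>\<close> the trace is close to its Euclidean value, which at
  \<open>q = r\<^sup>2/\<delta>\<^sup>2\<close> ranges between \<open>4\<psi>'(q)\<close> and \<open>4\<psi>'(q) + 4q\<psi>''(q)\<close> as \<open>P\<close> varies. Hence \<open>1 - a\<^sub>1\<close> is governed by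
  \<open>max \<bar>q\<psi>''(q)\<bar>\<close>, and \<open>1 - a\<^sub>2\<close> is at least governed by \<open>\<bar>\<psi>'(0)\<bar>\<close>, comparing \<open>x\<^sub>0\<close> with a point where
  \<open>f\<close> vanishes. The profile \<open>\<psi>(q) = exp(-30/(1-q))\<close> satisfies \<open>\<bar>q\<psi>''(q)\<bar> \<le> 5/9 \<bar>\<psi>'(0)\<bar>\<close>, which gives
  a ratio of at least about \<open>9/5\<close>. That \<open>a\<^sub>1 < 1\<close> uses \<open>n \<ge> 3\<close>: at \<open>q = 1/2\<close> there are a plane containing the radial
  direction and a plane orthogonal to it.\<close>

section \<open>Smooth functions\<close>

text \<open>In the variable log q, \<open>q \<psi>''(q)\<close> is the speed at which
  \<open>\<psi>'\<close> climbs from \<open>\<psi>'(0)\<close> to 0. Spread over a long logarithmic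
  scale, the climb is slow against its height; this is why the spread of curvature over the manifold
  can exceed its spread at each single point. The target 3/2 leaves this budget, in units of
  \<epsilon> times the absolute value of \<open>\<psi>'(0)\<close>. At one point the profile allows
  a spread of 4 * 5/9 / 2 = 10/9; the variation of g near the center raises the allowance to 5/4,
  and terms quadratic in \<epsilon> raise it to 13/10. The drop at the center is 2, of which 80/41
  is kept after the conformal factor is taken into account, and 80/41 exceeds 3/2 * 13/10 = 39/20.
  The conformal factor and the squared gradient of f are common to all planes at a point, so they do
  not disturb the local comparison. The radius is measured by the quadratic form of g frozen at the
  center, which keeps all derivatives of f explicit in arbitrary coordinates. Since f is fixed
  before \<epsilon>, the deformed metric tends to g as \<epsilon> tends to 0, with every derivative
  uniformly on compact sets.\<close>

lemma partial_eq:
  assumes "(f has_derivative f') (at x)"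
  shows "partial i f x = f' (axis i 1)"
  using assms by (simp add: partial_def frechet_derivative_at[symmetric])

lemma frechet_derivative_cong_open:
  assumes "open S" "x \<in> S" "\<And>y. y \<in> S \<Longrightarrow> f y = g y"
  shows "frechet_derivative f (at x) = frechet_derivative g (at x)"
proof -
  have "(f has_derivative D) (at x) \<longleftrightarrow> (g has_derivative D) (at x)" for D
    using assms by (metis has_derivative_transform_within_open)
  then show ?thesis by (simp add: frechet_derivative_def)
qed

lemma differentiable_cong_open:
  assumes "open S" "x \<in> S" "\<And>y. y \<in> S \<Longrightarrow> f y = g y" "f differentiable (at x)"
  shows "g differentiable (at x)"
  using assms unfolding differentiable_def by (metis has_derivative_transform_within_open)

lemma partial_cong_open:
  assumes "open S" "x \<in> S" "\<And>y. y \<in> S \<Longrightarrow> f y = g y"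
  shows "partial i f x = partial i g x"
  using frechet_derivative_cong_open[OF assms] by (simp add: partial_def)

lemma partials_cong_open:
  assumes "open S" "x \<in> S" "\<And>y. y \<in> S \<Longrightarrow> f y = g y"
  shows "partials is f x = partials is g x"
  using assms(2)
proof (induction "is" arbitrary: x)
  case Nil
  then show ?case using assms by simp
next
  case (Cons i "is")
  then show ?case using partial_cong_open[OF assms(1) Cons.prems Cons.IH] by simp
qed

lemma smooth_on_cong:
  assumes "open S" "\<And>y. y \<in> S \<Longrightarrow> f y = g y" "smooth_on S f"
  shows "smooth_on S g"
  unfolding smooth_on_def
proof (intro allI ballI)
  fix "is" x assume "x \<in> S"
  with assms(3) have "partials is f differentiable (at x)" by (auto simp: smooth_on_def)
  then show "partials is g differentiable (at x)"
    by (rule differentiable_cong_open[OF assms(1) \<open>x \<in> S\<close>, rotated])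
      (use partials_cong_open[OF assms(1) _ assms(2)] in auto)
qed

text \<open>\<open>partials\<close> applies the head of its list last; moving the innermost
  derivative into the function shows that smoothness is stable under \<open>partial\<close>.\<close>

lemma partials_snoc: "partials (is @ [i]) f = partials is (partial i f)"
  by (induction "is") auto

lemma smooth_on_partial: "smooth_on S f \<Longrightarrow> smooth_on S (partial i f)"
  unfolding smooth_on_def by (metis partials_snoc)

lemma smooth_on_partials: "smooth_on S f \<Longrightarrow> smooth_on S (partials is f)"
  by (induction "is") (auto intro: smooth_on_partial)

lemma smooth_on_differentiable: "smooth_on S f \<Longrightarrow> x \<in> S \<Longrightarrow> f differentiable (at x)"
  unfolding smooth_on_def by (metis partials.simps(1))

lemma smooth_on_has_derivative:
  "smooth_on S f \<Longrightarrow> x \<in> S \<Longrightarrow> (f has_derivative frechet_derivative f (at x)) (at x)"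
  using smooth_on_differentiable frechet_derivative_works by blast

lemma smooth_on_subset: "smooth_on S f \<Longrightarrow> T \<subseteq> S \<Longrightarrow> smooth_on T f"
  unfolding smooth_on_def by blast

lemma smooth_on_continuous: "smooth_on S f \<Longrightarrow> continuous_on S f"
  by (meson continuous_at_imp_continuous_on differentiable_imp_continuous_within smooth_on_differentiable)

text \<open>Induction on the derivative list does not close for products, whose partials are sums of
  products. A class of functions closed under \<open>partial\<close>, up to agreement on
  \<open>S\<close>, yields all iterated derivatives at once.\<close>

lemma smooth_on_coinduct:
  fixes f :: "real^'n \<Rightarrow> 'b::real_normed_vector"
  assumes S: "open S" and f: "X f"
    and X: "\<And>h x. X h \<Longrightarrow> x \<in> S \<Longrightarrow> h differentiable (at x)"
      "\<And>h i. X h \<Longrightarrow> \<exists>k. X k \<and> (\<forall>x\<in>S. partial i h x = k x)"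
  shows "smooth_on S f"
proof -
  have "\<exists>k. X k \<and> (\<forall>x\<in>S. partials is f x = k x)" for "is"
  proof (induction "is")
    case Nil
    then show ?case using f by auto
  next
    case (Cons i "is")
    then obtain k where k: "X k" "\<forall>x\<in>S. partials is f x = k x" by blast
    obtain l where l: "X l" "\<forall>x\<in>S. partial i k x = l x" using X(2) k(1) by blast
    have "partial i (partials is f) x = partial i k x" if "x \<in> S" for x
      using partial_cong_open[OF S that] k by blast
    then show ?case using l by auto
  qed
  then show ?thesis unfolding smooth_on_def
    by (metis S X(1) differentiable_cong_open)
qed

lemma smooth_on_local:
  assumes "\<And>x. x \<in> S \<Longrightarrow> \<exists>T. x \<in> T \<and> smooth_on T f"
  shows "smooth_on S f"
  using assms unfolding smooth_on_def by meson

lemma partials_bounded_linear: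
  assumes S: "open S" and f: "smooth_on S f" and L: "bounded_linear L" and x: "x \<in> S"
  shows "partials is (\<lambda>y. L (f y)) x = L (partials is f x)"
  using x
proof (induction "is" arbitrary: x)
  case (Cons i "is")
  have "(partials is f has_derivative frechet_derivative (partials is f) (at x)) (at x)"
    using f Cons.prems by (auto simp: smooth_on_def frechet_derivative_works)
  note DD = bounded_linear.has_derivative[OF L this]
  have "partial i (\<lambda>y. L (partials is f y)) x = L (partial i (partials is f) x)"
    unfolding partial_eq[OF DD] by (simp add: partial_def)
  with partial_cong_open[OF S Cons.prems Cons.IH] show ?case by simp
qed simp

lemma smooth_on_bounded_linear:
  assumes S: "open S" and f: "smooth_on S f" and L: "bounded_linear L"
  shows "smooth_on S (\<lambda>y. L (f y))"
  unfolding smooth_on_def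
proof (intro allI ballI)
  fix "is" x assume "x \<in> S"
  have "partials is f differentiable (at x)" using f \<open>x \<in> S\<close> by (auto simp: smooth_on_def)
  then have "(\<lambda>y. L (partials is f y)) differentiable (at x)"
    by (metis L bounded_linear.has_derivative differentiable_def)
  then show "partials is (\<lambda>y. L (f y)) differentiable (at x)"
    by (rule differentiable_cong_open[OF S \<open>x \<in> S\<close>, rotated])
      (use partials_bounded_linear[OF S f L] in auto)
qed

lemma partials_add:
  assumes S: "open S" and f: "smooth_on S f" and g: "smooth_on S g" and x: "x \<in> S"
  shows "partials is (\<lambda>y. f y + g y) x = partials is f x + partials is g x"
  using x
proof (induction "is" arbitrary: x)
  case (Cons i "is")
  have "(partials is f has_derivative frechet_derivative (partials is f) (at x)) (at x)"
       "(partials is g has_derivative frechet_derivative (partials is g) (at x)) (at x)"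
    using f g Cons.prems by (auto simp: smooth_on_def frechet_derivative_works)
  note DD = has_derivative_add[OF this]
  have "partial i (\<lambda>y. partials is f y + partials is g y) x
      = partial i (partials is f) x + partial i (partials is g) x"
    unfolding partial_eq[OF DD] by (simp add: partial_def)
  with partial_cong_open[OF S Cons.prems Cons.IH] show ?case by simp
qed simp

lemma smooth_on_add:
  assumes S: "open S" and f: "smooth_on S f" and g: "smooth_on S g"
  shows "smooth_on S (\<lambda>y. f y + g y)"
  unfolding smooth_on_def
proof (intro allI ballI)
  fix "is" x assume "x \<in> S"
  have "(\<lambda>y. partials is f y + partials is g y) differentiable (at x)"
    using f g \<open>x \<in> S\<close> by (auto simp: smooth_on_def)
  then show "partials is (\<lambda>y. f y + g y) differentiable (at x)"
    by (rule differentiable_cong_open[OF S \<open>x \<in> S\<close>, rotated])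
      (use partials_add[OF S f g] in auto)
qed

lemma smooth_on_const:
  fixes S :: "(real^'n) set"
  assumes "open S" shows "smooth_on S (\<lambda>_. c)"
proof (rule smooth_on_coinduct[OF assms, where X = "\<lambda>h. \<exists>c. h = (\<lambda>_. c)"])
  fix h :: "real^'n \<Rightarrow> 'a" and i assume "\<exists>c. h = (\<lambda>_. c)"
  then have "partial i h x = 0" for x
    using partial_eq[OF has_derivative_const] by blast
  then show "\<exists>k. (\<exists>c. k = (\<lambda>_. c)) \<and> (\<forall>x\<in>S. partial i h x = k x)" by blast
next
  show "\<exists>c'. (\<lambda>_::real^'n. c) = (\<lambda>_. c')" by blast
  show "h differentiable at x" if "\<exists>c. h = (\<lambda>_. c)" for h :: "real^'n \<Rightarrow> 'a" and x
    using that differentiable_const by blast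
qed

lemma smooth_on_sum:
  assumes "open S" "\<And>i. i \<in> I \<Longrightarrow> smooth_on S (f i)"
  shows "smooth_on S (\<lambda>y. \<Sum>i\<in>I. f i y)"
  using assms(2)
  by (induction I rule: infinite_finite_induct) (auto intro!: smooth_on_add smooth_on_const assms(1))

lemma smooth_on_componentwise:
  fixes f :: "real^'n \<Rightarrow> 'b::euclidean_space"
  assumes S: "open S" and f: "\<And>b. b \<in> Basis \<Longrightarrow> smooth_on S (\<lambda>y. f y \<bullet> b)"
  shows "smooth_on S f"
proof -
  have "smooth_on S (\<lambda>y. \<Sum>b\<in>Basis. (f y \<bullet> b) *\<^sub>R b)"
    by (intro smooth_on_sum S smooth_on_bounded_linear[OF S f] bounded_linear_scaleR_left)
  then show ?thesis by (simp add: euclidean_representation)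
qed

lemma smooth_on_inner_const:
  "open S \<Longrightarrow> smooth_on S f \<Longrightarrow> smooth_on S (\<lambda>y. f y \<bullet> b)"
  by (rule smooth_on_bounded_linear) (auto intro: bounded_linear_inner_left)

lemma smooth_on_nth: "open S \<Longrightarrow> smooth_on S f \<Longrightarrow> smooth_on S (\<lambda>y. f y $ i)"
  by (rule smooth_on_bounded_linear) (auto intro: bounded_linear_vec_nth)

text \<open>By the sum and product rules, this class is closed under \<open>partial\<close> as soon
  as the partials of the generators lie in it, which is what \<open>smooth_on_coinduct\<close> asks
  for. Constants are not built in; they have to come from \<open>B\<close>.\<close>

inductive alg_closure :: "((real^'n \<Rightarrow> real) \<Rightarrow> bool) \<Rightarrow> (real^'n \<Rightarrow> real) \<Rightarrow> bool"
  for B where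
  base: "B f \<Longrightarrow> alg_closure B f"
| add: "alg_closure B f \<Longrightarrow> alg_closure B g \<Longrightarrow> alg_closure B (\<lambda>x. f x + g x)"
| mult: "alg_closure B f \<Longrightarrow> alg_closure B g \<Longrightarrow> alg_closure B (\<lambda>x. f x * g x)"

lemma alg_closure_differentiable:
  assumes "alg_closure B f" "\<And>h. B h \<Longrightarrow> h differentiable (at x)"
  shows "f differentiable (at x)"
  using assms by induction auto

lemma smooth_on_alg_closure:
  fixes f :: "real^'n \<Rightarrow> real"
  assumes S: "open S" and f: "alg_closure B f"
    and B: "\<And>h x. B h \<Longrightarrow> x \<in> S \<Longrightarrow> h differentiable (at x)"
      "\<And>h i. B h \<Longrightarrow> \<exists>k. alg_closure B k \<and> (\<forall>x\<in>S. partial i h x = k x)"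
  shows "smooth_on S f"
proof (rule smooth_on_coinduct[OF S, where X = "alg_closure B", OF f])
  show "h differentiable (at x)" if "alg_closure B h" "x \<in> S" for h x
    using alg_closure_differentiable[OF that(1)] B(1) that(2) by blast
next
  fix h :: "real^'n \<Rightarrow> real" and i assume "alg_closure B h"
  then show "\<exists>k. alg_closure B k \<and> (\<forall>x\<in>S. partial i h x = k x)"
  proof induction
    case (base f)
    then show ?case using B by blast
  next
    case (add f g)
    then obtain k l where *: "alg_closure B k" "\<forall>x\<in>S. partial i f x = k x"
      "alg_closure B l" "\<forall>x\<in>S. partial i g x = l x" by blast
    have "partial i (\<lambda>x. f x + g x) x = k x + l x" if x: "x \<in> S" for x
    proof -
      have "(f has_derivative frechet_derivative f (at x)) (at x)"
        "(g has_derivative frechet_derivative g (at x)) (at x)"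
        using alg_closure_differentiable B(1) x add.hyps by (metis frechet_derivative_works)+
      from partial_eq[OF has_derivative_add[OF this]] show ?thesis using * x by (simp add: partial_def)
    qed
    then show ?case using alg_closure.add[OF *(1,3)] by auto
  next
    case (mult f g)
    then obtain k l where *: "alg_closure B k" "\<forall>x\<in>S. partial i f x = k x"
      "alg_closure B l" "\<forall>x\<in>S. partial i g x = l x" by blast
    have "partial i (\<lambda>x. f x * g x) x = f x * l x + k x * g x" if x: "x \<in> S" for x
    proof -
      have "(f has_derivative frechet_derivative f (at x)) (at x)"
        "(g has_derivative frechet_derivative g (at x)) (at x)"
        using alg_closure_differentiable B(1) x mult.hyps by (metis frechet_derivative_works)+
      from partial_eq[OF has_derivative_mult[OF this]] show ?thesis using * x by (simp add: partial_def)
    qed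
    then show ?case
      using alg_closure.add[OF alg_closure.mult[OF mult.hyps(1) *(3)] alg_closure.mult[OF *(1) mult.hyps(2)]]
      by auto
  qed
qed

lemma smooth_on_mult:
  fixes f g :: "real^'n \<Rightarrow> real"
  assumes S: "open S" and "smooth_on S f" "smooth_on S g"
  shows "smooth_on S (\<lambda>x. f x * g x)"
proof (rule smooth_on_alg_closure[OF S, of "smooth_on S"])
  show "alg_closure (smooth_on S) (\<lambda>x. f x * g x)"
    using assms(2,3) by (intro alg_closure.mult alg_closure.base)
next
  fix h :: "real^'n \<Rightarrow> real" and i assume "smooth_on S h"
  then show "\<exists>k. alg_closure (smooth_on S) k \<and> (\<forall>x\<in>S. partial i h x = k x)"
    using alg_closure.base[of "smooth_on S", OF smooth_on_partial] by blast
qed (rule smooth_on_differentiable)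

lemma smooth_on_scaleR:
  fixes f :: "real^'n \<Rightarrow> real" and g :: "real^'n \<Rightarrow> 'b::euclidean_space"
  assumes S: "open S" and "smooth_on S f" "smooth_on S g"
  shows "smooth_on S (\<lambda>x. f x *\<^sub>R g x)"
proof (rule smooth_on_componentwise[OF S])
  fix b :: 'b
  show "smooth_on S (\<lambda>x. (f x *\<^sub>R g x) \<bullet> b)"
    using smooth_on_mult[OF S assms(2) smooth_on_inner_const[OF S assms(3)]] by simp
qed

text \<open>The empty sum is excluded because the closure need not contain 0.\<close>

lemma alg_closure_sum:
  assumes "finite I" "I \<noteq> {}" "\<And>i. i \<in> I \<Longrightarrow> alg_closure B (f i)"
  shows "alg_closure B (\<lambda>x. \<Sum>i\<in>I. f i x)"
  using assms
proof (induction rule: finite_ne_induct)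
  case (insert i I)
  then show ?case using alg_closure.add[of B "f i" "\<lambda>x. \<Sum>i\<in>I. f i x"] by simp
qed simp

lemma frechet_derivative_eq_sum_partial:
  assumes "f differentiable (at x)"
  shows "frechet_derivative f (at x) v = (\<Sum>i\<in>UNIV. v $ i *\<^sub>R partial i f x)"
proof -
  interpret linear "frechet_derivative f (at x)"
    using assms by (simp add: linear_frechet_derivative)
  have "frechet_derivative f (at x) v = frechet_derivative f (at x) (\<Sum>i\<in>UNIV. v $ i *\<^sub>R axis i 1)"
    by (simp add: basis_expansion flip: scalar_mult_eq_scaleR)
  then show ?thesis by (simp add: sum scale partial_def)
qed

text \<open>The chain rule turns a partial of the composition into a sum of products of partials of
  \<open>p\<close> and partials of \<open>f\<close> composed with \<open>p\<close>. Functions of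
  both kinds therefore serve as generators.\<close>

lemma smooth_on_compose_real:
  fixes f :: "real^'m \<Rightarrow> real" and p :: "real^'n \<Rightarrow> real^'m"
  assumes S: "open S" and p: "smooth_on S p" and f: "smooth_on T f" and pS: "p ` S \<subseteq> T"
  shows "smooth_on S (\<lambda>x. f (p x))"
proof -
  define B where "B = (\<lambda>h. smooth_on S h \<or> (\<exists>k::real^'m \<Rightarrow> real. smooth_on T k \<and> h = (\<lambda>x. k (p x))))"
  have der: "((\<lambda>x. k (p x)) has_derivative
      (\<lambda>v. frechet_derivative k (at (p x)) (frechet_derivative p (at x) v))) (at x)"
    if "smooth_on T k" "x \<in> S" for k :: "real^'m \<Rightarrow> real" and x
    by (rule has_derivative_compose[OF smooth_on_has_derivative[OF p that(2)]
        smooth_on_has_derivative[OF that(1)]]) (use that pS in blast)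
  show ?thesis
  proof (rule smooth_on_alg_closure[OF S, of B])
    show "alg_closure B (\<lambda>x. f (p x))" using f alg_closure.base[of B] unfolding B_def by blast
  next
    fix h x assume "B h" "x \<in> S"
    then show "h differentiable (at x)"
      unfolding B_def using der smooth_on_differentiable differentiableI by metis
  next
    fix h :: "real^'n \<Rightarrow> real" and i :: 'n assume "B h"
    then consider (1) "smooth_on S h" | (2) k where "smooth_on T k" "h = (\<lambda>x. k (p x))"
      unfolding B_def by blast
    then show "\<exists>k. alg_closure B k \<and> (\<forall>x\<in>S. partial i h x = k x)"
    proof cases
      case 1
      then show ?thesis using alg_closure.base[of B "partial i h"] smooth_on_partial B_def by blast
    next
      case 2
      have "partial i h x = (\<Sum>a\<in>UNIV. partial i p x $ a * partial a k (p x))" if "x \<in> S" for x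
      proof -
        have "k differentiable (at (p x))" using 2 that pS smooth_on_differentiable by blast
        then show ?thesis
          using partial_eq[OF der[OF 2(1) that]] 2(2) by (simp add: frechet_derivative_eq_sum_partial partial_def)
      qed
      moreover have "alg_closure B (\<lambda>x. \<Sum>a\<in>UNIV. partial i p x $ a * partial a k (p x))"
        using 2(1) S p by (intro alg_closure_sum alg_closure.mult alg_closure.base)
          (auto simp: B_def intro!: smooth_on_nth smooth_on_partial)
      ultimately show ?thesis by blast
    qed
  qed
qed

text \<open>The assumption on \<open>D\<close> copies the derivatives of exp(-30/(1-t)) / (1-t)^k,
  each a combination of two consecutive members of the family. A first derivative for each member
  then suffices for smoothness of every order.\<close>

lemma smooth_on_compose_deriv_family:
  fixes D :: "nat \<Rightarrow> real \<Rightarrow> real" and p :: "real^'n \<Rightarrow> real"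
  assumes S: "open S" and p: "smooth_on S p"
    and D: "\<And>n. \<exists>m a b. \<forall>t. (D n has_real_derivative a * D m t + b * D (Suc m) t) (at t)"
  shows "smooth_on S (\<lambda>x. D n (p x))"
proof -
  define B where "B = (\<lambda>h. smooth_on S h \<or> (\<exists>n. h = (\<lambda>x. D n (p x))))"
  have der: "\<exists>m a b. \<forall>x\<in>S. ((\<lambda>x. D n (p x)) has_derivative
      (\<lambda>v. (a * D m (p x) + b * D (Suc m) (p x)) * (frechet_derivative p (at x) v))) (at x)" for n
  proof -
    obtain m a b where "\<forall>t. (D n has_real_derivative a * D m t + b * D (Suc m) t) (at t)"
      using D by blast
    then have "((\<lambda>x. D n (p x)) has_derivative
      (\<lambda>v. (a * D m (p x) + b * D (Suc m) (p x)) * (frechet_derivative p (at x) v))) (at x)" if "x \<in> S" for x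
      using has_derivative_compose[OF smooth_on_has_derivative[OF p that],
          where g = "D n"] by (simp add: has_field_derivative_def)
    then show ?thesis by blast
  qed
  show ?thesis
  proof (rule smooth_on_alg_closure[OF S, of B])
    show "alg_closure B (\<lambda>x. D n (p x))" using alg_closure.base[of B] unfolding B_def by blast
  next
    fix h x assume "B h" "x \<in> S"
    then show "h differentiable (at x)"
      unfolding B_def using der smooth_on_differentiable differentiableI by metis
  next
    fix h :: "real^'n \<Rightarrow> real" and i :: 'n assume "B h"
    then consider "smooth_on S h" | n where "h = (\<lambda>x. D n (p x))"
      unfolding B_def by blast
    then show "\<exists>k. alg_closure B k \<and> (\<forall>x\<in>S. partial i h x = k x)"
    proof cases
      case 1
      then show ?thesis using alg_closure.base[of B "partial i h"] smooth_on_partial B_def by blast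
    next
      case 2
      obtain m a b where *: "\<forall>x\<in>S. ((\<lambda>x. D n (p x)) has_derivative
        (\<lambda>v. (a * D m (p x) + b * D (Suc m) (p x)) * (frechet_derivative p (at x) v))) (at x)"
        using der by blast
      have "partial i h x = (a * D m (p x) + b * D (Suc m) (p x)) * partial i p x" if "x \<in> S" for x
        using partial_eq[OF *[rule_format, OF that]] 2 by (simp add: partial_def)
      moreover have "alg_closure B (\<lambda>x. (a * D m (p x) + b * D (Suc m) (p x)) * partial i p x)"
        using S p by (intro alg_closure.mult alg_closure.add alg_closure.base)
          (auto simp: B_def intro!: smooth_on_const smooth_on_partial)
      ultimately show ?thesis by blast
    qed
  qed
qed

lemma smooth_on_id:
  fixes S :: "(real^'n) set"
  shows "open S \<Longrightarrow> smooth_on S (\<lambda>x. x)"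
proof (rule smooth_on_coinduct[where X = "\<lambda>h. (\<exists>c. h = (\<lambda>_. c)) \<or> h = (\<lambda>x. x)"])
  fix h :: "real^'n \<Rightarrow> real^'n" and i :: 'n assume "(\<exists>c. h = (\<lambda>_. c)) \<or> h = (\<lambda>x. x)"
  then show "\<exists>k. ((\<exists>c. k = (\<lambda>_. c)) \<or> k = (\<lambda>x. x)) \<and> (\<forall>x\<in>S. partial i h x = k x)"
    using partial_eq[OF has_derivative_const] partial_eq[OF has_derivative_ident] by blast
next
  fix h :: "real^'n \<Rightarrow> real^'n" and x assume "(\<exists>c. h = (\<lambda>_. c)) \<or> h = (\<lambda>x. x)"
  then show "h differentiable at x" using differentiable_const differentiable_ident by blast
qed (assumption | blast)+

section \<open>Symmetry of second derivatives\<close>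

text \<open>Derivatives along arbitrary constant vectors let the geometric computations run without
  index sums.\<close>

definition dir_deriv :: "(real^'n \<Rightarrow> 'b::real_normed_vector) \<Rightarrow> real^'n \<Rightarrow> real^'n \<Rightarrow> 'b" where
  "dir_deriv f a y = frechet_derivative f (at y) a"

lemma dir_deriv_eq:
  assumes "(f has_derivative f') (at x)"
  shows "dir_deriv f a x = f' a"
  using assms by (simp add: dir_deriv_def frechet_derivative_at[symmetric])

lemma dir_deriv_sum_partial:
  "f differentiable (at x) \<Longrightarrow> dir_deriv f a x = (\<Sum>i\<in>UNIV. a $ i *\<^sub>R partial i f x)"
  by (simp add: dir_deriv_def frechet_derivative_eq_sum_partial)

lemma dir_deriv_linear:
  "f differentiable (at x) \<Longrightarrow> linear (\<lambda>a. dir_deriv f a x)"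
  by (simp add: dir_deriv_def linear_frechet_derivative)

lemma smooth_on_dir_deriv:
  assumes "open S" "smooth_on S f"
  shows "smooth_on S (dir_deriv f a)"
proof -
  have "smooth_on S (\<lambda>x. a $ i *\<^sub>R partial i f x)" for i
    by (rule smooth_on_bounded_linear[OF assms(1) smooth_on_partial[OF assms(2)] bounded_linear_scaleR_right])
  then have "smooth_on S (\<lambda>x. \<Sum>i\<in>UNIV. a $ i *\<^sub>R partial i f x)"
    by (rule smooth_on_sum[OF assms(1)])
  then show ?thesis
    by (rule smooth_on_cong[OF assms(1), rotated])
      (simp add: dir_deriv_sum_partial smooth_on_differentiable[OF assms(2)])
qed

text \<open>The mean value theorem is applied twice to the second difference over a parallelogram,
  first in direction \<open>a\<close>, then in direction \<open>b\<close>.\<close>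

lemma second_difference:
  fixes f :: "real^'n \<Rightarrow> real"
  assumes S: "open S" and f: "smooth_on S f" and h: "h > 0"
    and seg: "\<And>s t. 0 \<le> s \<Longrightarrow> s \<le> h \<Longrightarrow> 0 \<le> t \<Longrightarrow> t \<le> h \<Longrightarrow> x + s *\<^sub>R a + t *\<^sub>R b \<in> S"
  obtains s t where "0 \<le> s" "s \<le> h" "0 \<le> t" "t \<le> h"
    "f (x + h *\<^sub>R a + h *\<^sub>R b) - f (x + h *\<^sub>R a) - f (x + h *\<^sub>R b) + f x
      = h\<^sup>2 * dir_deriv (dir_deriv f a) b (x + s *\<^sub>R a + t *\<^sub>R b)"
proof -
  have D: "((\<lambda>s. g (z + s *\<^sub>R v)) has_real_derivative dir_deriv g v (z + s *\<^sub>R v)) (at s)"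
    if "smooth_on S g" "z + s *\<^sub>R v \<in> S" for g :: "real^'n \<Rightarrow> real" and z s v
  proof -
    have lin: "linear (frechet_derivative g (at (z + s *\<^sub>R v)))"
      using smooth_on_differentiable[OF that] by (rule linear_frechet_derivative)
    have "((\<lambda>s. z + s *\<^sub>R v) has_derivative (\<lambda>k. k *\<^sub>R v)) (at s)"
      by (auto intro!: derivative_eq_intros)
    from has_derivative_compose[OF this smooth_on_has_derivative[OF that]]
    have "((\<lambda>s. g (z + s *\<^sub>R v)) has_derivative (\<lambda>k. k * dir_deriv g v (z + s *\<^sub>R v))) (at s)"
      by (simp add: linear_scale[OF lin] dir_deriv_def)
    moreover have "(\<lambda>k. k * c) = (*) c" for c :: real by (rule ext) (rule mult.commute)
    ultimately show ?thesis unfolding has_field_derivative_def by simp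
  qed
  have c: "x + h *\<^sub>R b + s *\<^sub>R a = x + s *\<^sub>R a + h *\<^sub>R b" for s
    by (simp only: ac_simps)
  define p where "p s = f ((x + h *\<^sub>R b) + s *\<^sub>R a) - f (x + s *\<^sub>R a)" for s
  have "\<exists>s>0. s < h \<and> p h - p 0 = (h - 0) * (dir_deriv f a ((x + h *\<^sub>R b) + s *\<^sub>R a) - dir_deriv f a (x + s *\<^sub>R a))"
  proof (rule MVT2[OF h])
    fix s assume s: "0 \<le> s" "s \<le> h"
    show "(p has_real_derivative dir_deriv f a ((x + h *\<^sub>R b) + s *\<^sub>R a) - dir_deriv f a (x + s *\<^sub>R a)) (at s)"
      unfolding p_def
    proof (intro DERIV_diff D[OF f])
      show "x + h *\<^sub>R b + s *\<^sub>R a \<in> S" using seg[of s h] s h by (simp add: c)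
      show "x + s *\<^sub>R a \<in> S" using seg[of s 0] s h by simp
    qed
  qed
  then obtain s where s: "0 < s" "s < h"
    "p h - p 0 = h * (dir_deriv f a ((x + h *\<^sub>R b) + s *\<^sub>R a) - dir_deriv f a (x + s *\<^sub>R a))" by auto
  define q where "q t = dir_deriv f a ((x + s *\<^sub>R a) + t *\<^sub>R b)" for t
  have "\<exists>t>0. t < h \<and> q h - q 0 = (h - 0) * dir_deriv (dir_deriv f a) b ((x + s *\<^sub>R a) + t *\<^sub>R b)"
  proof (rule MVT2[OF h])
    fix t assume t: "0 \<le> t" "t \<le> h"
    show "(q has_real_derivative dir_deriv (dir_deriv f a) b ((x + s *\<^sub>R a) + t *\<^sub>R b)) (at t)"
      unfolding q_def
      by (rule D[OF smooth_on_dir_deriv[OF S f]]) (use seg[of s t] s t in simp)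
  qed
  then obtain t where t: "0 < t" "t < h"
    "q h - q 0 = h * dir_deriv (dir_deriv f a) b ((x + s *\<^sub>R a) + t *\<^sub>R b)" by auto
  have "p h - p 0 = h * (q h - q 0)"
    unfolding s(3) q_def by (simp add: c)
  then have "f (x + h *\<^sub>R a + h *\<^sub>R b) - f (x + h *\<^sub>R a) - f (x + h *\<^sub>R b) + f x
      = h\<^sup>2 * dir_deriv (dir_deriv f a) b (x + s *\<^sub>R a + t *\<^sub>R b)"
    unfolding t(3) p_def by (simp add: c power2_eq_square)
  then show thesis using that[of s t] s t by simp
qed

text \<open>Schwarz's theorem: the second difference is symmetric in \<open>a\<close> and
  \<open>b\<close>, so the two mixed derivatives take a common value at points arbitrarily close to
  \<open>x\<close>, and both are continuous.\<close>

lemma dir_deriv_commute_real: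
  fixes f :: "real^'n \<Rightarrow> real"
  assumes S: "open S" and f: "smooth_on S f" and x: "x \<in> S"
  shows "dir_deriv (dir_deriv f a) b x = dir_deriv (dir_deriv f b) a x"
proof (rule ccontr)
  define A where "A = dir_deriv (dir_deriv f a) b"
  define B where "B = dir_deriv (dir_deriv f b) a"
  assume "\<not> ?thesis"
  then have ne: "A x \<noteq> B x" by (simp add: A_def B_def)
  define e where "e = \<bar>A x - B x\<bar> / 2"
  have e: "e > 0" using ne by (simp add: e_def)
  have cA: "continuous (at x) A" "continuous (at x) B"
    unfolding A_def B_def by (intro differentiable_imp_continuous_within
        smooth_on_differentiable[OF smooth_on_dir_deriv[OF S smooth_on_dir_deriv[OF S f]] x])+
  obtain d1 where d1: "d1 > 0" "\<And>y. dist y x < d1 \<Longrightarrow> dist (A y) (A x) < e"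
    using cA(1) e unfolding continuous_at_eps_delta dist_norm by blast
  obtain d2 where d2: "d2 > 0" "\<And>y. dist y x < d2 \<Longrightarrow> dist (B y) (B x) < e"
    using cA(2) e unfolding continuous_at_eps_delta dist_norm by blast
  obtain d3 where d3: "d3 > 0" "\<And>y. dist y x < d3 \<Longrightarrow> y \<in> S"
    using S x by (auto simp: open_dist)
  define d where "d = min d1 (min d2 d3)"
  \<comment> \<open>Scaled so that the whole parallelogram lies within distance \<open>d\<close> of
    \<open>x\<close>; the summand 1 keeps the denominator positive when \<open>a\<close> and
    \<open>b\<close> vanish.\<close>
  define h where "h = d / (2 * (norm a + norm b + 1))"
  have pos: "norm a + norm b + 1 > 0" by (smt (verit) norm_ge_zero)
  have d: "d > 0" using d1 d2 d3 by (simp add: d_def)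
  have h: "h > 0" using d pos by (simp add: h_def)
  have near: "dist (x + s *\<^sub>R v + t *\<^sub>R w) x < d"
    if "0 \<le> s" "s \<le> h" "0 \<le> t" "t \<le> h" "{v, w} = {a, b}" for s t v w
  proof -
    have "norm (s *\<^sub>R v + t *\<^sub>R w) \<le> s * norm v + t * norm w"
      using norm_triangle_ineq[of "s *\<^sub>R v" "t *\<^sub>R w"] that by simp
    also have "\<dots> \<le> h * norm v + h * norm w"
      using that by (intro add_mono mult_right_mono) auto
    also have "\<dots> = h * (norm a + norm b)"
      using that(5) by (auto simp: doubleton_eq_iff algebra_simps)
    also have "\<dots> < h * (2 * (norm a + norm b + 1))"
      using h pos by (intro mult_strict_left_mono[OF _ h]) (smt (verit))
    also have "\<dots> = d" using pos by (simp add: h_def)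
    finally show ?thesis by (simp add: dist_norm add.assoc)
  qed
  obtain s t where st: "0 \<le> s" "s \<le> h" "0 \<le> t" "t \<le> h"
    "f (x + h *\<^sub>R a + h *\<^sub>R b) - f (x + h *\<^sub>R a) - f (x + h *\<^sub>R b) + f x
      = h\<^sup>2 * A (x + s *\<^sub>R a + t *\<^sub>R b)"
    unfolding A_def
    by (rule second_difference[OF S f h, of x a b]) (use near d3(2) in \<open>auto simp: d_def\<close>)
  obtain s' t' where st': "0 \<le> s'" "s' \<le> h" "0 \<le> t'" "t' \<le> h"
    "f (x + h *\<^sub>R b + h *\<^sub>R a) - f (x + h *\<^sub>R b) - f (x + h *\<^sub>R a) + f x
      = h\<^sup>2 * B (x + s' *\<^sub>R b + t' *\<^sub>R a)"
    unfolding B_def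
    by (rule second_difference[OF S f h, of x b a])
      (use near[of _ _ b a] d3(2) in \<open>auto simp: d_def insert_commute\<close>)
  have "x + h *\<^sub>R b + h *\<^sub>R a = x + h *\<^sub>R a + h *\<^sub>R b" by (simp only: ac_simps)
  then have "h\<^sup>2 * A (x + s *\<^sub>R a + t *\<^sub>R b) = h\<^sup>2 * B (x + s' *\<^sub>R b + t' *\<^sub>R a)"
    using st(5) st'(5) by (simp add: algebra_simps)
  then have "A (x + s *\<^sub>R a + t *\<^sub>R b) = B (x + s' *\<^sub>R b + t' *\<^sub>R a)" using h by simp
  moreover have "dist (A (x + s *\<^sub>R a + t *\<^sub>R b)) (A x) < e"
    using near[OF st(1-4)] d1(2) by (auto simp: d_def)
  moreover have "dist (B (x + s' *\<^sub>R b + t' *\<^sub>R a)) (B x) < e"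
    using near[OF st'(1-4), of b a] d2(2) by (auto simp: d_def insert_commute)
  ultimately show False unfolding e_def dist_real_def by (smt (verit) field_sum_of_halves)
qed

lemma dir_deriv_bounded_linear:
  assumes "bounded_linear L" "f differentiable (at x)"
  shows "dir_deriv (\<lambda>y. L (f y)) a x = L (dir_deriv f a x)"
  using dir_deriv_eq[OF bounded_linear.has_derivative[OF assms(1) frechet_derivative_works[THEN iffD1, OF assms(2)]]]
  by (simp only: dir_deriv_def)

lemma dir_deriv_cong_open:
  assumes "open S" "x \<in> S" "\<And>y. y \<in> S \<Longrightarrow> f y = g y"
  shows "dir_deriv f a x = dir_deriv g a x"
  using frechet_derivative_cong_open[OF assms] by (simp add: dir_deriv_def)

lemma dir_deriv_commute:
  fixes f :: "real^'n \<Rightarrow> 'b::euclidean_space"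
  assumes S: "open S" and f: "smooth_on S f" and x: "x \<in> S"
  shows "dir_deriv (dir_deriv f a) b x = dir_deriv (dir_deriv f b) a x"
proof (rule euclidean_eqI)
  fix c :: 'b assume "c \<in> Basis"
  have *: "dir_deriv (dir_deriv (\<lambda>y. f y \<bullet> c) a) b x = dir_deriv (dir_deriv f a) b x \<bullet> c" for a b
  proof -
    have "dir_deriv (dir_deriv (\<lambda>y. f y \<bullet> c) a) b x = dir_deriv (\<lambda>y. dir_deriv f a y \<bullet> c) b x"
      using dir_deriv_bounded_linear[OF bounded_linear_inner_left smooth_on_differentiable[OF f]]
      by (intro dir_deriv_cong_open[OF S x])
    then show ?thesis
      using dir_deriv_bounded_linear[OF bounded_linear_inner_left
          smooth_on_differentiable[OF smooth_on_dir_deriv[OF S f] x]] by simp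
  qed
  show "dir_deriv (dir_deriv f a) b x \<bullet> c = dir_deriv (dir_deriv f b) a x \<bullet> c"
    using dir_deriv_commute_real[OF S smooth_on_inner_const[OF S f] x, of c a b] unfolding * .
qed

lemma dir_deriv_const [simp]: "dir_deriv (\<lambda>_. c) a x = 0"
  by (rule dir_deriv_eq) simp

lemma dir_deriv_add:
  assumes "f differentiable (at x)" "g differentiable (at x)"
  shows "dir_deriv (\<lambda>y. f y + g y) a x = dir_deriv f a x + dir_deriv g a x"
  using dir_deriv_eq[OF has_derivative_add[OF assms[unfolded frechet_derivative_works]]]
  by (simp only: dir_deriv_def)

lemma dir_deriv_diff:
  assumes "f differentiable (at x)" "g differentiable (at x)"
  shows "dir_deriv (\<lambda>y. f y - g y) a x = dir_deriv f a x - dir_deriv g a x"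
  using dir_deriv_eq[OF has_derivative_diff[OF assms[unfolded frechet_derivative_works]]]
  by (simp only: dir_deriv_def)

lemma dir_deriv_scaleR:
  fixes f :: "real^'n \<Rightarrow> real"
  assumes "f differentiable (at x)" "g differentiable (at x)"
  shows "dir_deriv (\<lambda>y. f y *\<^sub>R g y) a x = f x *\<^sub>R dir_deriv g a x + dir_deriv f a x *\<^sub>R g x"
  using dir_deriv_eq[OF has_derivative_scaleR[OF assms[unfolded frechet_derivative_works]]]
  by (simp only: dir_deriv_def)

lemma dir_deriv_mult:
  fixes f g :: "real^'n \<Rightarrow> real"
  assumes "f differentiable (at x)" "g differentiable (at x)"
  shows "dir_deriv (\<lambda>y. f y * g y) a x = f x * dir_deriv g a x + dir_deriv f a x * g x"
  using dir_deriv_scaleR[OF assms] by simp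

lemma dir_deriv_sum:
  assumes "\<And>i. i \<in> I \<Longrightarrow> f i differentiable (at x)"
  shows "dir_deriv (\<lambda>y. \<Sum>i\<in>I. f i y) a x = (\<Sum>i\<in>I. dir_deriv (f i) a x)"
proof -
  have "((\<lambda>y. \<Sum>i\<in>I. f i y) has_derivative (\<lambda>v. \<Sum>i\<in>I. frechet_derivative (f i) (at x) v)) (at x)"
    using assms by (intro has_derivative_sum) (simp add: frechet_derivative_works[symmetric])
  from dir_deriv_eq[OF this] show ?thesis by (simp add: dir_deriv_def)
qed

section \<open>Local Riemannian geometry\<close>

lemma linear_expand:
  fixes f :: "real^'n \<Rightarrow> 'b::real_vector"
  assumes "linear f"
  shows "f v = (\<Sum>i\<in>UNIV. v $ i *\<^sub>R f (axis i 1))"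
proof -
  interpret linear f by fact
  have "f v = f (\<Sum>i\<in>UNIV. v $ i *\<^sub>R axis i 1)"
    by (simp add: basis_expansion flip: scalar_mult_eq_scaleR)
  then show ?thesis by (simp add: sum scale)
qed

lemma differentiable_prod:
  fixes f :: "'i \<Rightarrow> 'a::real_normed_vector \<Rightarrow> real"
  assumes "\<And>i. i \<in> I \<Longrightarrow> f i differentiable (at x)"
  shows "(\<lambda>y. \<Prod>i\<in>I. f i y) differentiable (at x)"
  using assms
proof (induction I rule: infinite_finite_induct)
  case (insert i I)
  then have "(\<lambda>y. f i y * (\<Prod>i\<in>I. f i y)) differentiable (at x)"
    by (intro differentiable_mult) simp_all
  then show ?case using insert by simp
qed simp_all

lemma differentiable_det:
  fixes M :: "'a::real_normed_vector \<Rightarrow> real^'n^'n"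
  assumes "\<And>i j. (\<lambda>y. M y $ i $ j) differentiable (at x)"
  shows "(\<lambda>y. det (M y)) differentiable (at x)"
  unfolding det_def
proof (intro differentiable_sum ballI)
  fix p
  show "(\<lambda>y. of_int (sign p) * (\<Prod>i\<in>UNIV. M y $ i $ p i)) differentiable (at x)"
    by (intro differentiable_mult differentiable_const differentiable_prod assms)
qed (rule finite_permutations, rule finite)

lemma matrix_inv_right:
  fixes M :: "real^'n^'n"
  assumes "invertible M"
  shows "M ** matrix_inv M = mat 1"
  using someI_ex[OF assms[unfolded invertible_def]] by (simp add: matrix_inv_def)

text \<open>Cramer's rule exhibits the entries of the inverse as quotients of determinants, from
  which their differentiability can be read off.\<close>

lemma matrix_inv_cramer:
  fixes M :: "real^'n^'n"
  assumes "det M \<noteq> 0"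
  shows "matrix_inv M $ k $ l = det (\<chi> i j. if j = k then axis l 1 $ i else M $ i $ j) / det M"
proof -
  have "M ** matrix_inv M = mat 1"
    using assms by (simp add: invertible_det_nz matrix_inv_right)
  then have "M *v (matrix_inv M *v axis l 1) = axis l 1"
    by (simp add: matrix_vector_mul_assoc)
  then have "matrix_inv M *v axis l 1 = (\<chi> k. det (\<chi> i j. if j = k then axis l 1 $ i else M $ i $ j) / det M)"
    using cramer[OF assms] by blast
  then have "(matrix_inv M *v axis l 1) $ k = det (\<chi> i j. if j = k then axis l 1 $ i else M $ i $ j) / det M"
    by simp
  then show ?thesis by (simp add: matrix_vector_mul_component inner_axis)
qed

lemma bounded_linear_matrix_form: "bounded_linear (\<lambda>A::real^'n^'m. v \<bullet> (A *v w))"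
  by (rule linear_conv_bounded_linear[THEN iffD1], rule linearI)
    (simp_all add: matrix_vector_mult_add_rdistrib inner_add_right scaleR_matrix_vector_assoc[symmetric])

lemma bounded_bilinear_matrix_vector: "bounded_bilinear (\<lambda>(A::real^'n^'m) v. A *v v)"
  unfolding bilinear_conv_bounded_bilinear[symmetric] bilinear_def
  by (auto intro!: linearI simp: matrix_vector_mult_add_rdistrib matrix_vector_right_distrib
      scaleR_matrix_vector_assoc[symmetric] matrix_vector_mult_scaleR)

lemma dir_deriv_matrix_form:
  fixes M :: "real^'k \<Rightarrow> real^'n^'m"
  assumes M: "M differentiable (at x)" and V: "V differentiable (at x)" and W: "W differentiable (at x)"
  shows "dir_deriv (\<lambda>y. V y \<bullet> (M y *v W y)) a x
    = V x \<bullet> (dir_deriv M a x *v W x) + dir_deriv V a x \<bullet> (M x *v W x) + V x \<bullet> (M x *v dir_deriv W a x)"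
proof -
  note d = M[unfolded frechet_derivative_works] V[unfolded frechet_derivative_works] W[unfolded frechet_derivative_works]
  have "((\<lambda>y. V y \<bullet> (M y *v W y)) has_derivative
    (\<lambda>h. V x \<bullet> (M x *v frechet_derivative W (at x) h + frechet_derivative M (at x) h *v W x)
       + frechet_derivative V (at x) h \<bullet> (M x *v W x))) (at x)"
    by (rule has_derivative_inner[OF d(2) bounded_bilinear.FDERIV[OF bounded_bilinear_matrix_vector d(1,3)]])
  from dir_deriv_eq[OF this] show ?thesis
    by (simp add: dir_deriv_def inner_add_right)
qed

text \<open>The vector-valued Christoffel symbol, that is, the covariant derivative along
  \<open>v\<close> of the constant coordinate field \<open>w\<close>.\<close>

definition chr :: "(real^'n \<Rightarrow> real^'n^'n) \<Rightarrow> real^'n \<Rightarrow> real^'n \<Rightarrow> real^'n \<Rightarrow> real^'n::finite" where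
  "chr G y v w = (\<chi> k. \<Sum>i\<in>UNIV. \<Sum>j\<in>UNIV. christoffel G k i j y * v $ i * w $ j)"

lemma linear_chr: "linear (chr G y v)" "linear (\<lambda>v. chr G y v w)"
  by (auto intro!: linearI simp: chr_def vec_eq_iff algebra_simps sum.distrib sum_distrib_left)

lemma linear_riemann_tensor:
  "linear (\<lambda>u. riemann_tensor G x u v w)" "linear (\<lambda>v. riemann_tensor G x u v w)"
  "linear (\<lambda>w. riemann_tensor G x u v w)"
  by (auto intro!: linearI simp: riemann_tensor_def vec_eq_iff algebra_simps sum.distrib sum_distrib_left)

lemma riemann_tensor_swap: "riemann_tensor G x v u w = - riemann_tensor G x u v w"
proof -
  have anti: "riemann_coeff G l j i k x = - riemann_coeff G l i j k x" for l i j k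
    unfolding riemann_coeff_def by (simp add: sum_subtractf)
  have "(\<Sum>i\<in>UNIV. \<Sum>j\<in>UNIV. \<Sum>k\<in>UNIV. riemann_coeff G l i j k x * v $ i * u $ j * w $ k)
    = - (\<Sum>i\<in>UNIV. \<Sum>j\<in>UNIV. \<Sum>k\<in>UNIV. riemann_coeff G l i j k x * u $ i * v $ j * w $ k)" for l
  proof -
    have "(\<Sum>i\<in>UNIV. \<Sum>j\<in>UNIV. \<Sum>k\<in>UNIV. riemann_coeff G l i j k x * v $ i * u $ j * w $ k)
      = (\<Sum>j\<in>UNIV. \<Sum>i\<in>UNIV. \<Sum>k\<in>UNIV. riemann_coeff G l i j k x * v $ i * u $ j * w $ k)"
      by (rule sum.swap)
    also have "\<dots> = (\<Sum>j\<in>UNIV. \<Sum>i\<in>UNIV. \<Sum>k\<in>UNIV. - (riemann_coeff G l j i k x * u $ j * v $ i * w $ k))"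
    proof (intro sum.cong refl)
      fix i j k
      show "riemann_coeff G l i j k x * v $ i * u $ j * w $ k = - (riemann_coeff G l j i k x * u $ j * v $ i * w $ k)"
        unfolding anti[of l j i k] by simp
    qed
    finally show ?thesis by (simp only: sum_negf)
  qed
  then show ?thesis by (simp add: riemann_tensor_def vec_eq_iff)
qed

text \<open>For constant fields the bracket vanishes, and the curvature is the commutator of two
  covariant derivatives. The proof is a reordering of index sums.\<close>

lemma riemann_tensor_chr:
  assumes diff: "\<And>k i j. christoffel G k i j differentiable (at x)"
  shows "riemann_tensor G x u v w = dir_deriv (\<lambda>y. chr G y v w) u x - dir_deriv (\<lambda>y. chr G y u w) v x
    + chr G x u (chr G x v w) - chr G x v (chr G x u w)"
proof -
  have chr_diff: "(\<lambda>y. chr G y v w) differentiable (at x)" for v w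
    unfolding chr_def by (intro differentiable_componentwise_within[THEN iffD2])
      (auto simp: Basis_vec_def inner_axis intro!: diff differentiable_sum differentiable_mult)
  have D: "dir_deriv (\<lambda>y. chr G y v w) u x $ l
      = (\<Sum>i\<in>UNIV. \<Sum>j\<in>UNIV. \<Sum>k\<in>UNIV. partial i (christoffel G l j k) x * u $ i * v $ j * w $ k)" for u v w l
  proof -
    have "dir_deriv (\<lambda>y. chr G y v w) u x $ l = dir_deriv (\<lambda>y. chr G y v w $ l) u x"
      by (rule dir_deriv_bounded_linear[symmetric, OF bounded_linear_vec_nth chr_diff])
    also have "\<dots> = (\<Sum>j\<in>UNIV. \<Sum>k\<in>UNIV. dir_deriv (christoffel G l j k) u x * v $ j * w $ k)"
      unfolding chr_def
      by (simp add: dir_deriv_sum dir_deriv_mult diff differentiable_mult)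
    also have "\<dots> = (\<Sum>j\<in>UNIV. \<Sum>k\<in>UNIV. \<Sum>i\<in>UNIV. partial i (christoffel G l j k) x * u $ i * v $ j * w $ k)"
      by (simp add: dir_deriv_sum_partial diff sum_distrib_right sum_distrib_left mult.assoc mult.left_commute)
    also have "\<dots> = (\<Sum>j\<in>UNIV. \<Sum>i\<in>UNIV. \<Sum>k\<in>UNIV. partial i (christoffel G l j k) x * u $ i * v $ j * w $ k)"
      by (rule sum.cong[OF refl], rule sum.swap)
    also have "\<dots> = (\<Sum>i\<in>UNIV. \<Sum>j\<in>UNIV. \<Sum>k\<in>UNIV. partial i (christoffel G l j k) x * u $ i * v $ j * w $ k)"
      by (rule sum.swap)
    finally show ?thesis .
  qed
  have C: "chr G x u (chr G x v w) $ l = (\<Sum>i\<in>UNIV. \<Sum>j\<in>UNIV. \<Sum>k\<in>UNIV.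
      (\<Sum>m\<in>UNIV. christoffel G l i m x * christoffel G m j k x) * u $ i * v $ j * w $ k)" for u v w l
  proof -
    have "chr G x u (chr G x v w) $ l = (\<Sum>i\<in>UNIV. \<Sum>m\<in>UNIV. \<Sum>j\<in>UNIV. \<Sum>k\<in>UNIV.
      christoffel G l i m x * christoffel G m j k x * u $ i * v $ j * w $ k)"
      by (simp add: chr_def sum_distrib_left mult.assoc mult.left_commute)
    also have "\<dots> = (\<Sum>i\<in>UNIV. \<Sum>j\<in>UNIV. \<Sum>m\<in>UNIV. \<Sum>k\<in>UNIV.
      christoffel G l i m x * christoffel G m j k x * u $ i * v $ j * w $ k)"
      by (rule sum.cong[OF refl], rule sum.swap)
    also have "\<dots> = (\<Sum>i\<in>UNIV. \<Sum>j\<in>UNIV. \<Sum>k\<in>UNIV. \<Sum>m\<in>UNIV.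
      christoffel G l i m x * christoffel G m j k x * u $ i * v $ j * w $ k)"
      by (rule sum.cong[OF refl], rule sum.cong[OF refl], rule sum.swap)
    finally show ?thesis by (simp add: sum_distrib_right)
  qed
  \<comment> \<open>Renames indices so that the terms with \<open>u\<close> and \<open>v\<close>
    exchanged carry the same monomials as the others.\<close>
  have sw: "(\<Sum>i\<in>UNIV. \<Sum>j\<in>UNIV. \<Sum>k\<in>UNIV. f i j k * v $ i * u $ j * w $ k)
      = (\<Sum>i\<in>UNIV. \<Sum>j\<in>UNIV. \<Sum>k\<in>UNIV. f j i k * u $ i * v $ j * w $ k)" for f
    by (subst sum.swap) (simp add: mult.assoc mult.left_commute)
  have "riemann_tensor G x u v w $ l = (dir_deriv (\<lambda>y. chr G y v w) u x - dir_deriv (\<lambda>y. chr G y u w) v x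
    + chr G x u (chr G x v w) - chr G x v (chr G x u w)) $ l" for l
    unfolding vector_add_component vector_minus_component D C riemann_tensor_def vec_lambda_beta riemann_coeff_def
      sw[of "\<lambda>i j k. partial i (christoffel G l j k) x"]
      sw[of "\<lambda>i j k. \<Sum>m\<in>UNIV. christoffel G l i m x * christoffel G m j k x"]
    unfolding sum.distrib[symmetric] sum_subtractf[symmetric]
    by (simp add: algebra_simps sum_subtractf)
  then show ?thesis by (simp add: vec_eq_iff)
qed

section \<open>Levi-Civita connection and curvature symmetries of a metric in coordinates\<close>

locale local_metric =
  fixes S :: "(real^'n::finite) set" and G :: "real^'n \<Rightarrow> real^'n^'n"
  assumes open_S: "open S" and smooth_G: "smooth_on S G"
    and sym_G: "x \<in> S \<Longrightarrow> transpose (G x) = G x"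
    and pos_G: "x \<in> S \<Longrightarrow> v \<noteq> 0 \<Longrightarrow> v \<bullet> (G x *v v) > 0"
begin

abbreviation "mi \<equiv> metric_inner G"
abbreviation "dG \<equiv> \<lambda>x a. dir_deriv G a x"

lemma G_diff: "x \<in> S \<Longrightarrow> G differentiable (at x)"
  using smooth_on_differentiable[OF smooth_G] .

lemma mi_commute: "x \<in> S \<Longrightarrow> mi x v w = mi x w v"
  unfolding metric_inner_def
  by (metis sym_G dot_lmul_matrix inner_commute vector_transpose_matrix)

lemma mi_pos: "x \<in> S \<Longrightarrow> v \<noteq> 0 \<Longrightarrow> mi x v v > 0"
  unfolding metric_inner_def by (rule pos_G)

lemma det_nz: "x \<in> S \<Longrightarrow> det (G x) \<noteq> 0"
proof -
  assume x: "x \<in> S"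
  have "v = 0" if "G x *v v = 0" for v
    using pos_G[OF x, of v] that by auto
  then have "inj ((*v) (G x))"
    by (intro linear_injective_0[THEN iffD2]) auto
  then have "\<exists>B. B ** G x = mat 1" using matrix_left_invertible_injective by blast
  then have "invertible (G x)" by (simp add: invertible_left_inverse)
  then show ?thesis by (simp add: invertible_det_nz)
qed

lemma inv_G: "x \<in> S \<Longrightarrow> G x *v (matrix_inv (G x) *v v) = v"
  using det_nz by (simp add: matrix_vector_mul_assoc invertible_det_nz matrix_inv_right)

lemma mi_eqI: "x \<in> S \<Longrightarrow> (\<And>z. mi x v z = mi x w z) \<Longrightarrow> v = w"
proof -
  assume x: "x \<in> S" and eq: "\<And>z. mi x v z = mi x w z"
  have "mi x (v - w) (v - w) = 0" using eq[of "v - w"] by (simp add: metric_inner_def inner_diff_left)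
  then show "v = w" using mi_pos[OF x, of "v - w"] by force
qed

lemma nth_diff: "x \<in> S \<Longrightarrow> (\<lambda>y. G y $ i $ j) differentiable (at x)"
  using smooth_on_differentiable[OF smooth_on_nth[OF open_S smooth_on_nth[OF open_S smooth_G]]] .

lemma matrix_inv_diff: assumes x: "x \<in> S"
  shows "(\<lambda>y. matrix_inv (G y) $ k $ l) differentiable (at x)"
proof (rule differentiable_cong_open[OF open_S x])
  show "det (\<chi> i j. if j = k then axis l 1 $ i else G y $ i $ j) / det (G y) = matrix_inv (G y) $ k $ l"
    if "y \<in> S" for y using matrix_inv_cramer[OF det_nz[OF that]] by simp
  have "(\<lambda>y. (\<chi> i j. if j = k then axis l 1 $ i else G y $ i $ j) $ i $ j) differentiable (at x)" for i j
    using nth_diff[OF x, of i j] by (cases "j = k") simp_all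
  then show "(\<lambda>y. det (\<chi> i j. if j = k then axis l 1 $ i else G y $ i $ j) / det (G y)) differentiable (at x)"
    by (intro differentiable_divide differentiable_det nth_diff x det_nz)
qed

lemma partial_nth: "x \<in> S \<Longrightarrow> partial i (\<lambda>y. G y $ j $ l) x = dG x (axis i 1) $ j $ l"
proof -
  assume x: "x \<in> S"
  have "dir_deriv (\<lambda>y. G y $ j $ l) (axis i 1) x = dG x (axis i 1) $ j $ l"
    by (rule dir_deriv_bounded_linear[OF bounded_linear_compose[OF bounded_linear_vec_nth bounded_linear_vec_nth] G_diff[OF x]])
  then show ?thesis by (simp add: partial_def dir_deriv_def)
qed

lemma christoffel_diff: assumes x: "x \<in> S" shows "christoffel G k i j differentiable (at x)"
proof -
  have *: "partial i (\<lambda>y. G y $ j $ l) differentiable (at x)" for i j l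
    by (rule smooth_on_differentiable[OF smooth_on_partial[OF smooth_on_nth[OF open_S smooth_on_nth[OF open_S smooth_G]]] x])
  show ?thesis unfolding christoffel_def[abs_def]
    by (intro differentiable_mult differentiable_const differentiable_sum ballI finite
        differentiable_add differentiable_diff * matrix_inv_diff x)
qed

lemma chr_diff: "x \<in> S \<Longrightarrow> (\<lambda>y. chr G y v w) differentiable (at x)"
  unfolding chr_def by (intro differentiable_componentwise_within[THEN iffD2])
    (auto simp: Basis_vec_def inner_axis intro!: christoffel_diff differentiable_sum differentiable_mult)

lemma dG_form: "x \<in> S \<Longrightarrow> dir_deriv (\<lambda>y. mi y v w) a x = v \<bullet> (dG x a *v w)"
  unfolding metric_inner_def by (rule dir_deriv_bounded_linear[OF bounded_linear_matrix_form G_diff])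

lemma smooth_mi: "smooth_on S (\<lambda>y. mi y v w)"
  unfolding metric_inner_def by (rule smooth_on_bounded_linear[OF open_S smooth_G bounded_linear_matrix_form])

lemma dG_commute: "x \<in> S \<Longrightarrow> v \<bullet> (dG x a *v w) = w \<bullet> (dG x a *v v)"
  using dir_deriv_cong_open[OF open_S, of x "\<lambda>y. mi y v w" "\<lambda>y. mi y w v"] mi_commute dG_form by metis

text \<open>\<open>christoffel\<close> is half the inverse metric applied to the right-hand side at
  basis vectors, and the right-hand side is trilinear. Testing \<open>chr\<close> against an
  arbitrary \<open>z\<close> keeps the inverse matrix out of the later computations.\<close>

lemma koszul:
  assumes x: "x \<in> S"
  shows "2 * mi x (chr G x v w) z = w \<bullet> (dG x v *v z) + v \<bullet> (dG x w *v z) - v \<bullet> (dG x z *v w)"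
proof -
  define K where "K v w z = w \<bullet> (dG x v *v z) + v \<bullet> (dG x w *v z) - v \<bullet> (dG x z *v w)" for v w z
  have lin: "linear (dG x)" by (rule dir_deriv_linear[OF G_diff[OF x]])
  have K1: "linear (\<lambda>v. K v w z)" "linear (\<lambda>w. K v w z)" "linear (\<lambda>z. K v w z)" for v w z
    by (auto intro!: linearI simp: K_def linear_add[OF lin] linear_scale[OF lin]
        matrix_vector_mult_add_rdistrib matrix_vector_right_distrib inner_add_right inner_add_left
        scaleR_matrix_vector_assoc[symmetric] matrix_vector_mult_scaleR algebra_simps)
  have e1: "K v w z = (\<Sum>i\<in>UNIV. v $ i * K (axis i 1) w z)" for v w z
    using linear_expand[OF K1(1), of v w z] by simp
  have e2: "K v w z = (\<Sum>j\<in>UNIV. w $ j * K v (axis j 1) z)" for v w z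
    using linear_expand[OF K1(2), of v w z] by simp
  have nth: "axis i 1 \<bullet> (M *v axis j 1) = M $ i $ j" for M :: "real^'n^'n" and i j
    by (simp add: inner_axis' matrix_vector_mul_component inner_axis)
  have Kb: "christoffel G k i j x = 1/2 * (\<Sum>l\<in>UNIV. matrix_inv (G x) $ k $ l * K (axis i 1) (axis j 1) (axis l 1))" for k i j
    unfolding christoffel_def K_def nth partial_nth[OF x] ..
  have "chr G x v w $ k = ((1/2) *\<^sub>R (matrix_inv (G x) *v (\<chi> l. K v w (axis l 1)))) $ k" for k
  proof -
    have "chr G x v w $ k = (\<Sum>i\<in>UNIV. \<Sum>j\<in>UNIV. \<Sum>l\<in>UNIV.
       1/2 * matrix_inv (G x) $ k $ l * (v $ i * (w $ j * K (axis i 1) (axis j 1) (axis l 1))))"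
      by (simp add: chr_def Kb sum_distrib_left sum_distrib_right mult_ac)
    also have "\<dots> = (\<Sum>i\<in>UNIV. \<Sum>l\<in>UNIV. \<Sum>j\<in>UNIV.
       1/2 * matrix_inv (G x) $ k $ l * (v $ i * (w $ j * K (axis i 1) (axis j 1) (axis l 1))))"
      by (rule sum.cong[OF refl], rule sum.swap)
    also have "\<dots> = (\<Sum>l\<in>UNIV. \<Sum>i\<in>UNIV. \<Sum>j\<in>UNIV.
       1/2 * matrix_inv (G x) $ k $ l * (v $ i * (w $ j * K (axis i 1) (axis j 1) (axis l 1))))"
      by (rule sum.swap)
    also have "\<dots> = (\<Sum>l\<in>UNIV. 1/2 * matrix_inv (G x) $ k $ l * (\<Sum>i\<in>UNIV. v $ i * (\<Sum>j\<in>UNIV. w $ j * K (axis i 1) (axis j 1) (axis l 1))))"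
      by (simp only: sum_distrib_left)
    also have "\<dots> = (\<Sum>l\<in>UNIV. 1/2 * matrix_inv (G x) $ k $ l * K v w (axis l 1))"
      using e1[of v w] e2[of _ w] by simp
    finally show ?thesis by (simp add: matrix_vector_mult_def sum_distrib_left mult.assoc)
  qed
  then have c: "chr G x v w = (1/2) *\<^sub>R (matrix_inv (G x) *v (\<chi> l. K v w (axis l 1)))"
    by (simp add: vec_eq_iff)
  have "2 * mi x (chr G x v w) z = 2 * mi x z (chr G x v w)" using mi_commute[OF x] by simp
  also have "\<dots> = z \<bullet> (\<chi> l. K v w (axis l 1))"
    by (simp add: metric_inner_def c matrix_vector_mult_scaleR inv_G[OF x])
  also have "\<dots> = K v w z"
    using linear_expand[OF K1(3), of v w z] by (simp add: inner_vec_def)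
  finally show ?thesis by (simp add: K_def)
qed

lemma chr_commute:
  assumes x: "x \<in> S"
  shows "chr G x v w = chr G x w v"
proof (rule mi_eqI[OF x])
  show "mi x (chr G x v w) z = mi x (chr G x w v) z" for z
    using koszul[OF x, of v w z] koszul[OF x, of w v z] dG_commute[OF x, of v z w] by simp
qed

text \<open>Add the Koszul identities for \<open>z\<close> and \<open>w\<close> in both orders: the
  terms antisymmetric in \<open>w\<close> and \<open>z\<close> cancel.\<close>

lemma metric_compat: "x \<in> S \<Longrightarrow> w \<bullet> (dG x a *v z) = mi x (chr G x a w) z + mi x w (chr G x a z)"
  using koszul[of x a w z] koszul[of x a z w] dG_commute[of x] mi_commute[of x w]
  by (smt (verit, ccfv_threshold))

lemma dir_deriv_mi:
  assumes x: "x \<in> S" and "V differentiable (at x)" "W differentiable (at x)"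
  shows "dir_deriv (\<lambda>y. mi y (V y) (W y)) a x
    = V x \<bullet> (dG x a *v W x) + mi x (dir_deriv V a x) (W x) + mi x (V x) (dir_deriv W a x)"
  unfolding metric_inner_def by (rule dir_deriv_matrix_form[OF G_diff[OF x] assms(2,3)])

text \<open>Differentiate the squared length of the constant field \<open>c\<close> along
  \<open>b\<close> and then along \<open>a\<close>. The result is symmetric in \<open>a\<close> and
  \<open>b\<close>, and so is its part made of products of first covariant derivatives; what remains
  of the difference is twice the curvature term.\<close>

lemma riemann_skew:
  assumes x: "x \<in> S"
  shows "mi x (riemann_tensor G x a b c) c = 0"
proof -
  define f where "f y = mi y c c" for y
  have f: "smooth_on S f" unfolding f_def by (rule smooth_mi)
  have half: "2 * mi y (chr G y b c) c = dir_deriv f b y" if "y \<in> S" for b y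
    using koszul[OF that, of b c c] dG_form[OF that, of c c b] dG_commute[OF that] by (simp add: f_def[abs_def])
  have D: "dir_deriv (dir_deriv f b) a x
     = 2 * (mi x (chr G x a (chr G x b c)) c + mi x (chr G x b c) (chr G x a c) + mi x (dir_deriv (\<lambda>y. chr G y b c) a x) c)" for a b
  proof -
    have "dir_deriv (dir_deriv f b) a x = dir_deriv (\<lambda>y. 2 * mi y (chr G y b c) c) a x"
      by (rule dir_deriv_cong_open[OF open_S x]) (simp add: half)
    also have "\<dots> = 2 * dir_deriv (\<lambda>y. mi y (chr G y b c) c) a x"
    proof (rule dir_deriv_bounded_linear[OF bounded_linear_mult_right])
      show "(\<lambda>y. mi y (chr G y b c) c) differentiable (at x)"
        by (rule differentiable_cong_open[OF open_S x, of "\<lambda>y. 1/2 * dir_deriv f b y"])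
         (use half smooth_on_differentiable[OF smooth_on_dir_deriv[OF open_S f] x] in \<open>auto simp: field_simps\<close>)
    qed
    also have "\<dots> = 2 * (chr G x b c \<bullet> (dG x a *v c) + mi x (dir_deriv (\<lambda>y. chr G y b c) a x) c)"
      using dir_deriv_mi[OF x chr_diff[OF x] differentiable_const, of b c c a] by (simp add: metric_inner_def)
    finally show ?thesis by (simp add: metric_compat[OF x])
  qed
  have "dir_deriv (dir_deriv f b) a x = dir_deriv (dir_deriv f a) b x"
    by (rule dir_deriv_commute[OF open_S f x])
  then show ?thesis
    unfolding riemann_tensor_chr[OF christoffel_diff[OF x]] D
    using mi_commute[OF x, of "chr G x b c" "chr G x a c"]
    by (simp add: metric_inner_def inner_add_left inner_diff_left)
qed

end

section \<open>Planes and the independence of the sectional curvature from the basis\<close>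

text \<open>Independence of the pair rather than of the set \<open>{a, b}\<close>, which would
  collapse to a single vector for \<open>a = b\<close>.\<close>

definition indep2 :: "real^'n \<Rightarrow> real^'n \<Rightarrow> bool" where
  "indep2 a b \<longleftrightarrow> (\<forall>s t. s *\<^sub>R a + t *\<^sub>R b = 0 \<longrightarrow> s = 0 \<and> t = 0)"

lemma indep2_iff: "indep2 a b \<longleftrightarrow> independent {a, b} \<and> a \<noteq> b"
proof
  assume *: "indep2 a b"
  have "a \<noteq> b" using *[unfolded indep2_def, rule_format, of 1 "-1"] by auto
  moreover have "a \<notin> span {b}"
  proof
    assume "a \<in> span {b}"
    then obtain k where "a = k *\<^sub>R b" by (auto simp: span_singleton)
    then have "1 *\<^sub>R a + (- k) *\<^sub>R b = 0" by simp
    then show False using * unfolding indep2_def by fastforce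
  qed
  moreover have "b \<noteq> 0" using *[unfolded indep2_def, rule_format, of 0 1] by auto
  ultimately show "independent {a, b} \<and> a \<noteq> b" by (simp add: independent_insert)
next
  assume *: "independent {a, b} \<and> a \<noteq> b"
  then have b: "b \<noteq> 0" and a: "a \<notin> span {b}"
    by (auto simp: independent_insert split: if_splits)
  show "indep2 a b" unfolding indep2_def
  proof (intro allI impI)
    fix s t assume st: "s *\<^sub>R a + t *\<^sub>R b = 0"
    have "s = 0"
    proof (rule ccontr)
      assume "s \<noteq> 0"
      have "s *\<^sub>R a = - (t *\<^sub>R b)" using st by (simp add: eq_neg_iff_add_eq_0)
      then have "(1/s) *\<^sub>R (s *\<^sub>R a) = (- t/s) *\<^sub>R b" by simp
      then have "a = (- t / s) *\<^sub>R b" using \<open>s \<noteq> 0\<close> by simp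
      then show False using a by (metis span_base span_scale singletonI)
    qed
    then show "s = 0 \<and> t = 0" using st b by simp
  qed
qed

lemma two_planes_span:
  assumes "P \<in> two_planes"
  obtains a b where "indep2 a b" "P = span {a, b}"
proof -
  have P: "subspace P" "dim P = 2" using assms by (auto simp: two_planes_def)
  obtain B where B: "B \<subseteq> P" "independent B" "P \<subseteq> span B" "card B = dim P" by (rule basis_exists)
  obtain a b where ab: "B = {a, b}" "a \<noteq> b" using B(4) P(2) card_2_iff by metis
  have "P = span {a, b}" using B(1,3) ab span_minimal[OF B(1) P(1)] by blast
  with that show thesis using B(2) ab indep2_iff by metis
qed

lemma indep2_two_planes: "indep2 a b \<Longrightarrow> span {a, b} \<in> two_planes"
  unfolding indep2_iff two_planes_def by (auto simp: dim_eq_card_independent)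

lemma two_planes_indep2:
  assumes "span {a, b} \<in> two_planes" shows "indep2 a b"
proof -
  have d: "dim (span {a, b}) = 2" using assms by (simp add: two_planes_def)
  then have "card {a, b} \<ge> 2" using dim_le_card'[of "{a, b}"] by simp
  then have ne: "a \<noteq> b" by (auto simp: card_insert_if split: if_splits)
  have "independent {a, b}"
    by (rule card_le_dim_spanning[of _ "span {a, b}"]) (use d ne in \<open>auto intro: span_base\<close>)
  with ne show ?thesis by (simp add: indep2_iff)
qed

lemma span2_D: "u \<in> span {a, b} \<Longrightarrow> \<exists>s t. u = s *\<^sub>R a + t *\<^sub>R b"
  by (auto simp: span_insert span_singleton) (metis add_diff_cancel_left' diff_add_cancel)

text \<open>The squared area of the parallelogram on \<open>a\<close> and \<open>b\<close>, for an
  inner product \<open>\<beta>\<close>.\<close>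

definition gram :: "('a \<Rightarrow> 'a \<Rightarrow> real) \<Rightarrow> 'a \<Rightarrow> 'a \<Rightarrow> real" where
  "gram \<beta> a b = \<beta> a a * \<beta> b b - (\<beta> a b)\<^sup>2"

text \<open>For a \<open>\<beta>\<close>-orthonormal basis \<open>a, b\<close> of a plane this is the \<open>\<beta>\<close>-trace of \<open>\<eta>\<close> on the plane;
  for a general basis the trace is the quotient by \<open>gram\<close>.\<close>

definition mix :: "('a \<Rightarrow> 'a \<Rightarrow> real) \<Rightarrow> ('a \<Rightarrow> 'a \<Rightarrow> real) \<Rightarrow> 'a \<Rightarrow> 'a \<Rightarrow> real" where
  "mix \<beta> \<eta> a b = \<beta> a a * \<eta> b b - 2 * \<beta> a b * \<eta> a b + \<beta> b b * \<eta> a a"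

abbreviation trace_on :: "('a \<Rightarrow> 'a \<Rightarrow> real) \<Rightarrow> ('a \<Rightarrow> 'a \<Rightarrow> real) \<Rightarrow> 'a \<Rightarrow> 'a \<Rightarrow> real" where
  "trace_on \<beta> \<eta> a b \<equiv> mix \<beta> \<eta> a b / gram \<beta> a b"

definition sec :: "(real^'n \<Rightarrow> real^'n^'n) \<Rightarrow> real^'n \<Rightarrow> real^'n \<Rightarrow> real^'n::finite \<Rightarrow> real" where
  "sec G x a b = metric_inner G x (riemann_tensor G x a b b) a / gram (metric_inner G x) a b"

lemma bilinear_metric_inner: "bilinear (metric_inner G x)"
  unfolding bilinear_def metric_inner_def
  by (auto intro!: linearI simp: inner_add_left inner_add_right matrix_vector_right_distrib matrix_vector_mult_scaleR)

lemmas metric_inner_linear =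
  bilinear_ladd[OF bilinear_metric_inner] bilinear_radd[OF bilinear_metric_inner]
  bilinear_lmul[OF bilinear_metric_inner] bilinear_rmul[OF bilinear_metric_inner]

text \<open>\<open>mix\<close> is the polarization of the Gram determinant, so it too scales by the
  square of the determinant of the base change. The quotient \<open>trace_on\<close> therefore
  depends only on the plane.\<close>

lemma mix_change_basis:
  assumes "bilinear \<beta>" "bilinear \<eta>" "\<And>v w. \<beta> v w = \<beta> w v" "\<And>v w. \<eta> v w = \<eta> w v"
  shows "mix \<beta> \<eta> (p *\<^sub>R a + q *\<^sub>R b) (r *\<^sub>R a + s *\<^sub>R b) = (p * s - q * r)\<^sup>2 * mix \<beta> \<eta> a b"
proof -
  note b = bilinear_ladd[OF assms(1)] bilinear_radd[OF assms(1)] bilinear_lmul[OF assms(1)] bilinear_rmul[OF assms(1)]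
    bilinear_ladd[OF assms(2)] bilinear_radd[OF assms(2)] bilinear_lmul[OF assms(2)] bilinear_rmul[OF assms(2)]
  show ?thesis
    unfolding mix_def b assms(3)[of b a] assms(4)[of b a] real_scaleR_def by algebra
qed

lemma gram_mix: "gram \<beta> a b = mix \<beta> \<beta> a b / 2"
  by (simp add: gram_def mix_def power2_eq_square)

lemma gram_change_basis:
  assumes "bilinear \<beta>" "\<And>v w. \<beta> v w = \<beta> w v"
  shows "gram \<beta> (p *\<^sub>R a + q *\<^sub>R b) (r *\<^sub>R a + s *\<^sub>R b) = (p * s - q * r)\<^sup>2 * gram \<beta> a b"
  unfolding gram_mix mix_change_basis[OF assms(1,1,2,2)] by simp

lemma gram_pos:
  assumes "bilinear \<beta>" "\<And>v w. \<beta> v w = \<beta> w v" "\<And>v. v \<noteq> 0 \<Longrightarrow> \<beta> v v > 0" "indep2 a b"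
  shows "gram \<beta> a b > 0"
proof -
  note b = bilinear_ladd[OF assms(1)] bilinear_radd[OF assms(1)] bilinear_lmul[OF assms(1)] bilinear_rmul[OF assms(1)]
  have a: "a \<noteq> 0" using assms(4)[unfolded indep2_def, rule_format, of 1 0] by auto
  \<comment> \<open>An unnormalized Gram-Schmidt step: \<open>w\<close> is orthogonal to
    \<open>a\<close>, and its squared length is \<open>\<beta> a a\<close> times the Gram
    determinant.\<close>
  define w where "w = (- \<beta> a b) *\<^sub>R a + \<beta> a a *\<^sub>R b"
  have "w \<noteq> 0" using assms(4)[unfolded indep2_def, rule_format, of "- \<beta> a b" "\<beta> a a"] assms(3)[OF a]
    unfolding w_def by force
  then have "\<beta> w w > 0" by (rule assms(3))
  moreover have "\<beta> w w = \<beta> a a * gram \<beta> a b"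
    unfolding w_def b gram_def assms(2)[of b a] real_scaleR_def by algebra
  ultimately show ?thesis using assms(3)[OF a] by (simp add: zero_less_mult_iff)
qed

context local_metric
begin

lemma gram_mi_pos: "x \<in> S \<Longrightarrow> indep2 a b \<Longrightarrow> gram (mi x) a b > 0"
  by (rule gram_pos[OF bilinear_metric_inner mi_commute mi_pos])

text \<open>Antisymmetry in the first two arguments pulls out one determinant; the skewness of
  \<open>riemann_skew\<close> pulls out the other.\<close>

lemma riemann_change_basis:
  assumes x: "x \<in> S"
  defines "R \<equiv> \<lambda>a b. mi x (riemann_tensor G x a b b) a"
  shows "R (p *\<^sub>R a + q *\<^sub>R b) (r *\<^sub>R a + s *\<^sub>R b) = (p * s - q * r)\<^sup>2 * R a b"
proof -
  let ?R = "riemann_tensor G x"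
  note l = linear_add[OF linear_riemann_tensor(1)] linear_add[OF linear_riemann_tensor(2)] linear_add[OF linear_riemann_tensor(3)]
    linear_scale[OF linear_riemann_tensor(1)] linear_scale[OF linear_riemann_tensor(2)] linear_scale[OF linear_riemann_tensor(3)]
  note b = metric_inner_linear
  have R0: "?R c c d = 0" for c d using riemann_tensor_swap[of G x c c d]
    by (simp only: vec_eq_iff vector_uminus_component equal_neg_zero zero_index) simp
  have 0: "mi x (?R c d e) e = 0" for c d e by (rule riemann_skew[OF x])
  \<comment> \<open>Polarization of \<open>riemann_skew\<close>, which only speaks of equal
    arguments.\<close>
  have "mi x (?R c d (e + f)) (e + f) = mi x (?R c d e) e + mi x (?R c d f) f + mi x (?R c d e) f + mi x (?R c d f) e" for c d e f
    unfolding l b by simp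
  then have sk: "mi x (?R c d f) e = - mi x (?R c d e) f" for c d e f
    using 0 by (smt (verit))
  let ?u = "p *\<^sub>R a + q *\<^sub>R b" and ?v = "r *\<^sub>R a + s *\<^sub>R b"
  have Rl: "?R ?u ?v c = (p * s - q * r) *\<^sub>R ?R a b c" for c
    unfolding l R0 riemann_tensor_swap[of G x b a] by (simp add: algebra_simps)
  have "R ?u ?v = (p * s - q * r) * mi x (?R a b ?v) ?u"
    unfolding R_def Rl by (simp add: bilinear_lmul[OF bilinear_metric_inner])
  also have "mi x (?R a b ?v) ?u = (p * s - q * r) * R a b"
    unfolding l b 0 R_def sk[of a b a b] real_scaleR_def by algebra
  finally show ?thesis by (simp add: power2_eq_square)
qed

text \<open>The choice operator returns the value at an unknown basis of the same plane; passing to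
  \<open>a, b\<close> multiplies numerator and denominator by the same squared determinant.\<close>

lemma local_sectional_curvature_eq_sec:
  assumes x: "x \<in> S" and ab: "indep2 a b"
  shows "local_sectional_curvature G x (span {a, b}) = sec G x a b"
proof -
  have "\<exists>k u v. span {u, v} = span {a, b} \<and> k = sec G x u v" by blast
  from someI_ex[OF this] obtain u v where uv: "span {u, v} = span {a, b}"
    and k: "local_sectional_curvature G x (span {a, b}) = sec G x u v"
    unfolding local_sectional_curvature_def sec_def gram_def by blast
  \<comment> \<open>The chosen pair is only known to span; independence follows from the dimension
    of its span.\<close>
  have ind: "indep2 u v" using two_planes_indep2 indep2_two_planes[OF ab] uv by metis
  have "u \<in> span {a, b}" "v \<in> span {a, b}" using uv by (metis insertCI span_base)+
  then obtain p q r s where u: "u = p *\<^sub>R a + q *\<^sub>R b" and v: "v = r *\<^sub>R a + s *\<^sub>R b" using span2_D by metis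
  have g: "gram (mi x) u v = (p * s - q * r)\<^sup>2 * gram (mi x) a b"
    unfolding u v by (rule gram_change_basis[OF bilinear_metric_inner mi_commute[OF x]])
  moreover have "gram (mi x) u v > 0" by (rule gram_mi_pos[OF x ind])
  ultimately have "(p * s - q * r)\<^sup>2 \<noteq> 0" by auto
  then show ?thesis unfolding k sec_def g unfolding u v riemann_change_basis[OF x] by simp
qed

end

section \<open>Conformal change of the metric\<close>

definition hess :: "(real^'n \<Rightarrow> real^'n^'n) \<Rightarrow> (real^'n \<Rightarrow> real) \<Rightarrow> real^'n \<Rightarrow> real^'n \<Rightarrow> real^'n::finite \<Rightarrow> real" where
  "hess G f x v w = dir_deriv (dir_deriv f v) w x - dir_deriv f (chr G x v w) x"

lemma linear_dir_deriv2:
  assumes "open S" "smooth_on S f" "x \<in> S"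
  shows "linear (\<lambda>v. dir_deriv (dir_deriv f v) w x)" "linear (\<lambda>w. dir_deriv (dir_deriv f v) w x)"
proof -
  show 2: "linear (\<lambda>w. dir_deriv (dir_deriv f v) w x)" for v
    by (rule dir_deriv_linear[OF smooth_on_differentiable[OF smooth_on_dir_deriv[OF assms(1,2)] assms(3)]])
  note l = dir_deriv_linear[OF smooth_on_differentiable[OF assms(2)]]
  note d = smooth_on_differentiable[OF smooth_on_dir_deriv[OF assms(1,2)] assms(3)]
  show "linear (\<lambda>v. dir_deriv (dir_deriv f v) w x)"
  proof (rule linearI)
    fix u v
    have "dir_deriv (dir_deriv f (u + v)) w x = dir_deriv (\<lambda>y. dir_deriv f u y + dir_deriv f v y) w x"
      by (rule dir_deriv_cong_open[OF assms(1,3)]) (simp add: linear_add[OF l])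
    then show "dir_deriv (dir_deriv f (u + v)) w x = dir_deriv (dir_deriv f u) w x + dir_deriv (dir_deriv f v) w x"
      by (simp add: dir_deriv_add[OF d d])
  next
    fix r v
    have "dir_deriv (dir_deriv f (r *\<^sub>R v)) w x = dir_deriv (\<lambda>y. r *\<^sub>R dir_deriv f v y) w x"
      by (rule dir_deriv_cong_open[OF assms(1,3)]) (simp add: linear_scale[OF l])
    then show "dir_deriv (dir_deriv f (r *\<^sub>R v)) w x = r *\<^sub>R dir_deriv (dir_deriv f v) w x"
      by (simp add: dir_deriv_bounded_linear[OF bounded_linear_scaleR_right d])
  qed
qed

context local_metric
begin

lemma hess_commute:
  assumes "smooth_on S f" "x \<in> S" shows "hess G f x v w = hess G f x w v"
  unfolding hess_def using dir_deriv_commute[OF open_S assms] chr_commute[OF assms(2)] by metis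

lemma bilinear_hess:
  assumes f: "smooth_on S f" and x: "x \<in> S"
  shows "bilinear (hess G f x)"
proof -
  note l = dir_deriv_linear[OF smooth_on_differentiable[OF f x]]
  note c = linear_add[OF linear_chr(1)] linear_add[OF linear_chr(2)] linear_scale[OF linear_chr(1)] linear_scale[OF linear_chr(2)]
  note d = linear_dir_deriv2[OF open_S f x]
  show ?thesis unfolding bilinear_def hess_def
    by (intro conjI allI linearI)
      (simp_all add: c linear_add[OF l] linear_scale[OF l] linear_add[OF d(1)] linear_add[OF d(2)]
        linear_scale[OF d(1)] linear_scale[OF d(2)] algebra_simps)
qed

lemma gradient_exists:
  assumes f: "f differentiable (at x)" and x: "x \<in> S"
  obtains X where "\<And>v. mi x X v = dir_deriv f v x"
proof
  fix v
  note l = dir_deriv_linear[OF f]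
  have "mi x (matrix_inv (G x) *v (\<chi> l. dir_deriv f (axis l 1) x)) v
      = v \<bullet> (\<chi> l. dir_deriv f (axis l 1) x)"
    using mi_commute[OF x] by (metis metric_inner_def inv_G[OF x])
  also have "\<dots> = dir_deriv f v x"
    using linear_expand[OF l, of v] by (simp add: inner_vec_def)
  finally show "mi x (matrix_inv (G x) *v (\<chi> l. dir_deriv f (axis l 1) x)) v = dir_deriv f v x" .
qed

end

locale conformal_change = local_metric S G for S :: "(real^'n::finite) set" and G +
  fixes \<rho> :: "real^'n \<Rightarrow> real"
  assumes smooth_\<rho>: "smooth_on S \<rho>" and \<rho>_pos: "x \<in> S \<Longrightarrow> \<rho> x > 0"
begin

definition "G' y = \<rho> y *\<^sub>R G y"

lemma mi': "metric_inner G' y v w = \<rho> y * mi y v w"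
  by (simp add: metric_inner_def G'_def scaleR_matrix_vector_assoc[symmetric])

sublocale M': local_metric S G'
proof
  show "open S" by (rule open_S)
  show "smooth_on S G'" unfolding G'_def[abs_def] by (rule smooth_on_scaleR[OF open_S smooth_\<rho> smooth_G])
  show "transpose (G' x) = G' x" if "x \<in> S" for x
    using sym_G[OF that] by (simp add: G'_def transpose_scalar)
  show "v \<bullet> (G' x *v v) > 0" if "x \<in> S" "v \<noteq> 0" for x v
    using pos_G[OF that] \<rho>_pos[OF that(1)] by (simp add: G'_def scaleR_matrix_vector_assoc[symmetric])
qed

lemma \<rho>_diff: "x \<in> S \<Longrightarrow> \<rho> differentiable (at x)"
  by (rule smooth_on_differentiable[OF smooth_\<rho>])

abbreviation "\<omega> \<equiv> \<lambda>x v. dir_deriv \<rho> v x"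

lemma dG'_form: "x \<in> S \<Longrightarrow> v \<bullet> (dir_deriv G' a x *v w) = \<rho> x * (v \<bullet> (dG x a *v w)) + \<omega> x a * mi x v w"
proof -
  assume x: "x \<in> S"
  have "dir_deriv G' a x = \<rho> x *\<^sub>R dG x a + \<omega> x a *\<^sub>R G x"
    unfolding G'_def[abs_def] by (rule dir_deriv_scaleR[OF \<rho>_diff G_diff]) fact+
  then show ?thesis
    by (simp add: matrix_vector_mult_add_rdistrib inner_add_right scaleR_matrix_vector_assoc[symmetric] metric_inner_def)
qed

text \<open>Differentiating the identity \<open>mi_Z\<close> gives the derivative of \<open>Z\<close> without an explicit formula for
  the gradient of \<open>\<rho>\<close> or its derivative.\<close>

definition Z :: "real^'n \<Rightarrow> real^'n \<Rightarrow> real^'n \<Rightarrow> real^'n" where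
  "Z y v w = chr G' y v w - chr G y v w"

text \<open>The difference of two Levi-Civita connections is a tensor: subtracting the two Koszul
  identities removes the derivatives of \<open>G\<close> and leaves those of
  \<open>\<rho>\<close>.\<close>

lemma mi_Z:
  assumes x: "x \<in> S"
  shows "2 * \<rho> x * mi x (Z x v w) z = \<omega> x w * mi x v z + \<omega> x v * mi x w z - mi x v w * \<omega> x z"
proof -
  have "2 * (\<rho> x * mi x (chr G' x v w) z) = \<rho> x * (2 * mi x (chr G x v w) z)
      + \<omega> x w * mi x v z + \<omega> x v * mi x w z - mi x v w * \<omega> x z"
    using M'.koszul[OF x, of v w z]
    unfolding mi' koszul[OF x] dG'_form[OF x] by (simp add: algebra_simps)
  moreover have "mi x (Z x v w) z = mi x (chr G' x v w) z - mi x (chr G x v w) z"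
    by (simp add: Z_def metric_inner_def inner_diff_left)
  ultimately show ?thesis by algebra
qed

lemma Z_diff: "x \<in> S \<Longrightarrow> (\<lambda>y. Z y v w) differentiable (at x)"
  unfolding Z_def by (intro differentiable_diff chr_diff M'.chr_diff)

lemma mi_DZ:
  assumes x: "x \<in> S"
  shows "2 * \<omega> x a * mi x (Z x v w) z
    + 2 * \<rho> x * (Z x v w \<bullet> (dG x a *v z) + mi x (dir_deriv (\<lambda>y. Z y v w) a x) z)
    = dir_deriv (dir_deriv \<rho> w) a x * mi x v z + \<omega> x w * (v \<bullet> (dG x a *v z))
    + dir_deriv (dir_deriv \<rho> v) a x * mi x w z + \<omega> x v * (w \<bullet> (dG x a *v z))
    - (v \<bullet> (dG x a *v w)) * \<omega> x z - mi x v w * dir_deriv (dir_deriv \<rho> z) a x"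
proof -
  have d\<omega>: "dir_deriv \<rho> v differentiable (at x)" for v
    by (rule smooth_on_differentiable[OF smooth_on_dir_deriv[OF open_S smooth_\<rho>] x])
  have dmi: "(\<lambda>y. mi y v w) differentiable (at x)" for v w
    by (rule smooth_on_differentiable[OF smooth_mi x])
  have "(\<lambda>y. mi y (Z y v w) z) differentiable (at x)"
    unfolding metric_inner_def
    using has_derivative_inner[OF Z_diff[OF x, unfolded frechet_derivative_works]
        bounded_bilinear.FDERIV[OF bounded_bilinear_matrix_vector G_diff[OF x, unfolded frechet_derivative_works] has_derivative_const]]
    by (rule differentiableI)
  then have "dir_deriv (\<lambda>y. \<rho> y * mi y (Z y v w) z) a x
      = \<omega> x a * mi x (Z x v w) z + \<rho> x * (Z x v w \<bullet> (dG x a *v z) + mi x (dir_deriv (\<lambda>y. Z y v w) a x) z)"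
    by (simp add: dir_deriv_mult \<rho>_diff[OF x] dir_deriv_mi[OF x Z_diff[OF x]])
      (simp add: metric_inner_def)
  then have L: "dir_deriv (\<lambda>y. 2 * (\<rho> y * mi y (Z y v w) z)) a x
      = 2 * (\<omega> x a * mi x (Z x v w) z + \<rho> x * (Z x v w \<bullet> (dG x a *v z) + mi x (dir_deriv (\<lambda>y. Z y v w) a x) z))"
    using \<open>(\<lambda>y. mi y (Z y v w) z) differentiable (at x)\<close>
    by (subst dir_deriv_bounded_linear[OF bounded_linear_mult_right])
      (auto intro!: differentiable_mult \<rho>_diff[OF x])
  have "dir_deriv (\<lambda>y. 2 * (\<rho> y * mi y (Z y v w) z)) a x
      = dir_deriv (\<lambda>y. dir_deriv \<rho> w y * mi y v z + dir_deriv \<rho> v y * mi y w z - mi y v w * dir_deriv \<rho> z y) a x"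
    by (rule dir_deriv_cong_open[OF open_S x]) (use mi_Z in \<open>simp add: mult.assoc\<close>)
  also have "\<dots> = dir_deriv (dir_deriv \<rho> w) a x * mi x v z + \<omega> x w * (v \<bullet> (dG x a *v z))
    + dir_deriv (dir_deriv \<rho> v) a x * mi x w z + \<omega> x v * (w \<bullet> (dG x a *v z))
    - (v \<bullet> (dG x a *v w)) * \<omega> x z - mi x v w * dir_deriv (dir_deriv \<rho> z) a x"
    by (simp add: dir_deriv_diff dir_deriv_add dir_deriv_mult d\<omega> dmi dG_form[OF x] differentiable_mult differentiable_add)
  finally show ?thesis unfolding L by (simp add: algebra_simps)
qed

text \<open>This is the usual conformal transformation law for a factor exp(2 u) with u = (log
  \<rho>) / 2. Then Hess u - du du equals Hess \<rho> / (2 \<rho>) - 3/4 d\<rho> d\<rho> / \<rho>^2,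
  which explains the coefficient 3/4. Stating it for \<rho> itself keeps it linear in the Hessian of
  the deformation.\<close>

lemma conformal_numerator:
  assumes x: "x \<in> S" and X: "\<And>v. mi x X v = \<omega> x v"
  shows "mi x (riemann_tensor G' x a b b) a = mi x (riemann_tensor G x a b b) a
    - mix (mi x) (hess G \<rho> x) a b / (2 * \<rho> x)
    + 3 / (4 * (\<rho> x)\<^sup>2) * mix (mi x) (\<lambda>v w. \<omega> x v * \<omega> x w) a b
    - mi x X X / (4 * (\<rho> x)\<^sup>2) * gram (mi x) a b"
proof -
  \<comment> \<open>The factor on the left of \<open>mi_Z\<close>; multiplied by \<open>s\<close> or
    its square, every term becomes polynomial in inner products and derivatives of
    \<open>\<rho>\<close>.\<close>
  define s where "s = 2 * \<rho> x"
  have s: "s > 0" using \<rho>_pos[OF x] by (simp add: s_def)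
  have chr': "chr G' y v w = chr G y v w + Z y v w" for y v w by (simp add: Z_def)
  have chr'_abs: "(\<lambda>y. chr G' y v w) = (\<lambda>y. chr G y v w + Z y v w)" for v w by (simp add: Z_def)
  note lin = linear_add[OF linear_chr(1)]
  have zlin: "Z x v (w + w') = Z x v w + Z x v w'" for v w w'
    by (simp add: Z_def linear_add[OF linear_chr(1)])
  note b = bilinear_ladd[OF bilinear_metric_inner] bilinear_radd[OF bilinear_metric_inner]
    bilinear_lsub[OF bilinear_metric_inner]
  note cm = mi_commute[OF x]
  have mZ: "s * mi x (Z x v w) z = \<omega> x w * mi x v z + \<omega> x v * mi x w z - mi x v w * \<omega> x z" for v w z
    using mi_Z[OF x] by (simp add: s_def)
  let ?g = "chr G x"
  define E where "E v w c = mi x (dir_deriv (\<lambda>y. Z y v w) c x) a + mi x (?g c (Z x v w)) a" for v w c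
  \<comment> \<open>The curvature expression for the connection \<open>chr G + Z\<close>, minus the
    one for \<open>chr G\<close>: derivative terms and mixed terms are linear in \<open>Z\<close>,
    the rest is quadratic.\<close>
  have split: "mi x (riemann_tensor G' x a b b) a - mi x (riemann_tensor G x a b b) a
     = E b b a - E a b b + mi x (Z x a (?g b b)) a + mi x (Z x a (Z x b b)) a
     - mi x (Z x b (?g a b)) a - mi x (Z x b (Z x a b)) a"
    unfolding riemann_tensor_chr[OF christoffel_diff[OF x]] riemann_tensor_chr[OF M'.christoffel_diff[OF x]]
      chr'_abs dir_deriv_add[OF chr_diff[OF x] Z_diff[OF x]] E_def
    unfolding chr' lin zlin b by (simp add: algebra_simps)
  let ?D = "\<lambda>v w. dir_deriv (dir_deriv \<rho> v) w x"
  have Dsym: "?D b a = ?D a b" by (rule dir_deriv_commute[OF open_S smooth_\<rho> x])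
  have gsym: "?g b a = ?g a b" by (rule chr_commute[OF x])
  have E: "s * E v w c = ?D w c * mi x v a + \<omega> x w * (mi x (?g c v) a + mi x v (?g c a))
    + ?D v c * mi x w a + \<omega> x v * (mi x (?g c w) a + mi x w (?g c a))
    - (mi x (?g c v) w + mi x v (?g c w)) * \<omega> x a - mi x v w * ?D a c
    - 2 * \<omega> x c * mi x (Z x v w) a - s * mi x (Z x v w) (?g c a)" for v w c
    using mi_DZ[OF x, of c v w a] unfolding metric_compat[OF x] E_def s_def by (simp add: algebra_simps)
  define A B C p q N where "A = mi x a a" "B = mi x a b" "C = mi x b b" "p = \<omega> x a" "q = \<omega> x b" "N = mi x X X"
  note defs = A_B_C_p_q_N_def
  have BA: "mi x b a = B" using cm by (simp add: defs)
  \<comment> \<open>Testing \<open>Z\<close> against the gradient \<open>X\<close> evaluates the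
    differential of \<open>\<rho>\<close> on \<open>Z\<close>, as required by the terms quadratic in
    \<open>Z\<close>.\<close>
  have XZ: "s * \<omega> x (Z x v w) = 2 * \<omega> x v * \<omega> x w - mi x v w * N" for v w
    using mZ[of v w X] cm[of _ X] X by (simp add: defs algebra_simps)
  note f = defs[symmetric] BA
  have Zbba: "s * mi x (Z x b b) a = 2 * q * B - C * p" using mZ[of b b a] by (simp add: f algebra_simps)
  have Zabb: "s * mi x (Z x a b) b = p * C" using mZ[of a b b] by (simp add: f algebra_simps)
  have Zaba: "s * mi x (Z x a b) a = q * A" using mZ[of a b a] by (simp add: f algebra_simps)
  have Zb: "s\<^sup>2 * mi x (Z x b (Z x a b)) a = (2 * p * q - B * N) * B + q * (q * A) - p * (p * C)"
  proof -
    have "s\<^sup>2 * mi x (Z x b (Z x a b)) a = (s * \<omega> x (Z x a b)) * B + q * (s * mi x (Z x a b) a) - (s * mi x (Z x a b) b) * p"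
      using mZ[of b "Z x a b" a] cm[of b "Z x a b"] unfolding f by algebra
    then show ?thesis unfolding XZ Zabb Zaba by (simp add: f algebra_simps)
  qed
  have Za: "s\<^sup>2 * mi x (Z x a (Z x b b)) a = (2 * q\<^sup>2 - C * N) * A"
  proof -
    have "s\<^sup>2 * mi x (Z x a (Z x b b)) a = (s * \<omega> x (Z x b b)) * A"
      using mZ[of a "Z x b b" a] cm[of a "Z x b b"] by (simp add: f power2_eq_square algebra_simps)
    then show ?thesis unfolding XZ by (simp add: f power2_eq_square algebra_simps)
  qed
  have c1: "mi x b (?g v w) = mi x (?g v w) b" "mi x a (?g v w) = mi x (?g v w) a" for v w
    using cm by blast+
  have E1: "s\<^sup>2 * E b b a = s * (2 * ?D a b * B + 2 * q * (mi x (?g a b) a + mi x (?g a a) b)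
      - 2 * mi x (?g a b) b * p - C * ?D a a) - 2 * p * (2 * q * B - C * p) - s * (2 * q * mi x (?g a a) b - C * \<omega> x (?g a a))"
    using E[of b b a] Zbba mZ[of b b "?g a a"] unfolding f c1 Dsym gsym by algebra
  have E2: "s\<^sup>2 * E a b b = s * (?D b b * A + 2 * q * mi x (?g a b) a
      + ?D a b * B + p * (mi x (?g b b) a + mi x (?g a b) b)
      - (mi x (?g a b) b + mi x (?g b b) a) * p - B * ?D a b) - 2 * q * (q * A)
      - s * (q * mi x (?g a b) a + p * mi x (?g a b) b - B * \<omega> x (?g a b))"
    using E[of a b b] Zaba mZ[of a b "?g a b"] unfolding f c1 Dsym gsym by algebra
  have E3: "s\<^sup>2 * mi x (Z x a (?g b b)) a = s * (\<omega> x (?g b b) * A)"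
    using mZ[of a "?g b b" a, THEN arg_cong[where f = "\<lambda>t. s * t"]] unfolding f c1 by (simp add: power2_eq_square algebra_simps)
  have E4: "s\<^sup>2 * mi x (Z x b (?g a b)) a = s * (\<omega> x (?g a b) * B + q * mi x (?g a b) a - mi x (?g a b) b * p)"
    using mZ[of b "?g a b" a, THEN arg_cong[where f = "\<lambda>t. s * t"]] unfolding f c1 by (simp add: power2_eq_square algebra_simps)
  have "s\<^sup>2 * (mi x (riemann_tensor G' x a b b) a - mi x (riemann_tensor G x a b b) a)
     = - s * mix (mi x) (hess G \<rho> x) a b + 3 * mix (mi x) (\<lambda>v w. \<omega> x v * \<omega> x w) a b - N * gram (mi x) a b"
    unfolding split distrib_left right_diff_distrib E1 E2 E3 E4 Za Zb mix_def gram_def hess_def f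
    by (simp add: power2_eq_square algebra_simps)
  then have "mi x (riemann_tensor G' x a b b) a - mi x (riemann_tensor G x a b b) a
     = (- s * mix (mi x) (hess G \<rho> x) a b + 3 * mix (mi x) (\<lambda>v w. \<omega> x v * \<omega> x w) a b - N * gram (mi x) a b) / s\<^sup>2"
    using s by (simp add: field_simps)
  also have "\<dots> = - mix (mi x) (hess G \<rho> x) a b / (2 * \<rho> x)
    + 3 / (4 * (\<rho> x)\<^sup>2) * mix (mi x) (\<lambda>v w. \<omega> x v * \<omega> x w) a b
    - mi x X X / (4 * (\<rho> x)\<^sup>2) * gram (mi x) a b"
    using \<rho>_pos[OF x] unfolding s_def f by (simp add: field_simps power2_eq_square)
  finally show ?thesis by simp
qed

lemma conformal_sec:
  assumes x: "x \<in> S" and X: "\<And>v. mi x X v = \<omega> x v" and ab: "indep2 a b"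
  shows "sec G' x a b = (1 / \<rho> x) * (sec G x a b
    - trace_on (mi x) (hess G \<rho> x) a b / (2 * \<rho> x)
    + 3 / (4 * (\<rho> x)\<^sup>2) * (trace_on (mi x) (\<lambda>v w. \<omega> x v * \<omega> x w) a b)
    - mi x X X / (4 * (\<rho> x)\<^sup>2))"
proof -
  have g: "gram (mi x) a b > 0" by (rule gram_mi_pos[OF x ab])
  have g': "gram (metric_inner G' x) a b = (\<rho> x)\<^sup>2 * gram (mi x) a b"
    unfolding gram_def mi' by (simp add: power2_eq_square algebra_simps)
  show ?thesis unfolding sec_def g' mi' conformal_numerator[OF x X]
    using g \<rho>_pos[OF x] by (simp add: field_simps power2_eq_square)
qed

end

text \<open>The conformal formula for a constant factor, with zero gradient and zero
  Hessian.\<close>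

lemma (in local_metric) sec_scale:
  assumes x: "x \<in> S" and s: "s > 0" and ab: "indep2 a b"
  shows "local_metric S (\<lambda>y. s *\<^sub>R G y)" "sec (\<lambda>y. s *\<^sub>R G y) x a b = sec G x a b / s"
proof -
  interpret c: conformal_change S G "\<lambda>_. s"
    by unfold_locales (auto intro: smooth_on_const open_S s)
  have eq: "c.G' = (\<lambda>y. s *\<^sub>R G y)" by (rule ext) (simp add: c.G'_def)
  show "local_metric S (\<lambda>y. s *\<^sub>R G y)" using c.M'.local_metric_axioms unfolding eq .
  have z: "dir_deriv (\<lambda>_. s) v = (\<lambda>_. 0)" for v by (rule ext) simp
  have "mi x 0 v = dir_deriv (\<lambda>_. s) v x" for v by (simp add: metric_inner_def)
  from c.conformal_sec[OF x this ab] show "sec (\<lambda>y. s *\<^sub>R G y) x a b = sec G x a b / s"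
    unfolding eq by (simp add: hess_def mix_def z metric_inner_def)
qed

section \<open>Transformation of the Hessian under coordinate changes\<close>

lemma dir_deriv_compose:
  assumes "\<phi> differentiable (at x)" "u differentiable (at (\<phi> x))"
  shows "dir_deriv (\<lambda>y. u (\<phi> y)) a x = dir_deriv u (dir_deriv \<phi> a x) (\<phi> x)"
  using dir_deriv_eq[OF has_derivative_compose[OF assms[unfolded frechet_derivative_works]]]
  by (simp only: dir_deriv_def)

lemma differentiable_compose_at:
  assumes "\<phi> differentiable (at x)" "u differentiable (at (\<phi> x))"
  shows "(\<lambda>y. u (\<phi> y)) differentiable (at x)"
  by (rule differentiableI[OF has_derivative_compose[OF assms[unfolded frechet_derivative_works]]])

text \<open>A local isometry carries the connection, hence the covariant Hessian, along. Estimates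
  proved in one chart thereby reach every overlapping chart.\<close>

lemma hess_pullback:
  fixes G K :: "real^'n \<Rightarrow> real^'n^'n::finite" and \<phi> :: "real^'n \<Rightarrow> real^'n" and u :: "real^'n \<Rightarrow> real"
  assumes M: "local_metric U G" and N: "local_metric T K"
    and \<phi>: "smooth_on U \<phi>" "\<phi> ` U \<subseteq> T"
    and GK: "\<And>y. y \<in> U \<Longrightarrow> G y = transpose (matrix (frechet_derivative \<phi> (at y))) ** K (\<phi> y)
      ** matrix (frechet_derivative \<phi> (at y))"
    and u: "smooth_on T u" and x: "x \<in> U"
  defines "J \<equiv> \<lambda>v. dir_deriv \<phi> v x"
  shows "linear J" "\<And>v. J v = 0 \<Longrightarrow> v = 0"
    "\<And>v w. metric_inner G x v w = metric_inner K (\<phi> x) (J v) (J w)"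
    "\<And>v. dir_deriv (\<lambda>y. u (\<phi> y)) v x = dir_deriv u (J v) (\<phi> x)"
    "\<And>v w. hess G (\<lambda>y. u (\<phi> y)) x v w = hess K u (\<phi> x) (J v) (J w)"
proof -
  interpret M: local_metric U G by (rule M)
  interpret N: local_metric T K by (rule N)
  have \<phi>x: "\<phi> x \<in> T" using \<phi>(2) x by blast
  have d\<phi>: "\<phi> differentiable (at y)" if "y \<in> U" for y by (rule smooth_on_differentiable[OF \<phi>(1) that])
  have du: "u differentiable (at (\<phi> y))" if "y \<in> U" for y
    using smooth_on_differentiable[OF u] \<phi>(2) that by blast
  have mul: "matrix (frechet_derivative \<phi> (at y)) *v v = dir_deriv \<phi> v y" if "y \<in> U" for v y
    unfolding dir_deriv_def by (rule fun_cong[OF matrix_vector_mul(2)[OF linear_frechet_derivative[OF d\<phi>[OF that]]]])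
  have mi: "metric_inner G y v w = dir_deriv \<phi> v y \<bullet> (K (\<phi> y) *v dir_deriv \<phi> w y)" if "y \<in> U" for v w y
  proof -
    let ?A = "matrix (frechet_derivative \<phi> (at y))"
    have "metric_inner G y v w = v \<bullet> (transpose ?A *v (K (\<phi> y) *v (?A *v w)))"
      unfolding metric_inner_def GK[OF that] by (simp only: matrix_vector_mul_assoc matrix_mul_assoc)
    also have "\<dots> = (?A *v v) \<bullet> (K (\<phi> y) *v (?A *v w))"
      by (metis dot_lmul_matrix vector_transpose_matrix transpose_transpose)
    finally show ?thesis unfolding mul[OF that] .
  qed
  show miJ: "metric_inner G x v w = metric_inner K (\<phi> x) (J v) (J w)" for v w
    using mi[OF x] unfolding metric_inner_def J_def .
  show linJ: "linear J" unfolding J_def by (rule dir_deriv_linear[OF d\<phi>[OF x]])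
  show injJ: "v = 0" if "J v = 0" for v
    using M.mi_pos[OF x, of v] miJ[of v v] that by (force simp: metric_inner_def)
  have "surj J"
    using linear_injective_imp_surjective[OF linJ] injJ linear_injective_0[OF linJ] by blast
  show d1: "dir_deriv (\<lambda>y. u (\<phi> y)) v x = dir_deriv u (J v) (\<phi> x)" for v
    unfolding J_def by (rule dir_deriv_compose[OF d\<phi>[OF x] du[OF x]])
  define E where "E v a = dir_deriv (dir_deriv \<phi> v) a x" for v a
  have Esym: "E v a = E a v" for v a
    unfolding E_def by (rule dir_deriv_commute[OF M.open_S \<phi>(1) x])
  have dd\<phi>: "dir_deriv \<phi> v differentiable (at x)" for v
    by (rule smooth_on_differentiable[OF smooth_on_dir_deriv[OF M.open_S \<phi>(1)] x])
  have dKd: "(\<lambda>y. K (\<phi> y)) differentiable (at x)"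
    using differentiable_compose_at[OF d\<phi>[OF x] N.G_diff[OF \<phi>x]] .
  have dK: "dir_deriv (\<lambda>y. K (\<phi> y)) a x = dir_deriv K (J a) (\<phi> x)" for a
    unfolding J_def by (rule dir_deriv_compose[OF d\<phi>[OF x] N.G_diff[OF \<phi>x]])
  have dG: "v \<bullet> (dir_deriv G a x *v w) = J v \<bullet> (dir_deriv K (J a) (\<phi> x) *v J w)
      + metric_inner K (\<phi> x) (E v a) (J w) + metric_inner K (\<phi> x) (J v) (E w a)" for a v w
  proof -
    have "v \<bullet> (dir_deriv G a x *v w) = dir_deriv (\<lambda>y. metric_inner G y v w) a x"
      using M.dG_form[OF x] by simp
    also have "\<dots> = dir_deriv (\<lambda>y. dir_deriv \<phi> v y \<bullet> (K (\<phi> y) *v dir_deriv \<phi> w y)) a x"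
      by (rule dir_deriv_cong_open[OF M.open_S x mi])
    finally show ?thesis
      unfolding dir_deriv_matrix_form[OF dKd dd\<phi> dd\<phi>] dK by (simp add: E_def J_def metric_inner_def)
  qed
  note b = bilinear_ladd[OF bilinear_metric_inner]
  \<comment> \<open>The inhomogeneous transformation law of Christoffel symbols, with
    \<open>E\<close> the second derivative of the coordinate change. It follows from the two Koszul
    identities, tested against all vectors because \<open>J\<close> is onto. The term
    \<open>E\<close> cancels the one in the chain rule for second derivatives.\<close>
  have JG: "J (chr G x v w) = chr K (\<phi> x) (J v) (J w) + E v w" for v w
  proof (rule N.mi_eqI[OF \<phi>x])
    fix z
    obtain z' where z: "z = J z'" using \<open>surj J\<close> by blast
    have "2 * metric_inner K (\<phi> x) (J (chr G x v w)) z = 2 * metric_inner G x (chr G x v w) z'"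
      by (simp add: z miJ)
    also have "\<dots> = 2 * metric_inner K (\<phi> x) (chr K (\<phi> x) (J v) (J w) + E v w) z"
      unfolding M.koszul[OF x] dG b distrib_left N.koszul[OF \<phi>x] z
      using Esym N.mi_commute[OF \<phi>x] by (smt (verit))
    finally show "metric_inner K (\<phi> x) (J (chr G x v w)) z
      = metric_inner K (\<phi> x) (chr K (\<phi> x) (J v) (J w) + E v w) z" by simp
  qed
  show "hess G (\<lambda>y. u (\<phi> y)) x v w = hess K u (\<phi> x) (J v) (J w)" for v w
  proof -
    have "dir_deriv (dir_deriv (\<lambda>y. u (\<phi> y)) v) w x = dir_deriv (\<lambda>y. dir_deriv u (dir_deriv \<phi> v y) (\<phi> y)) w x"
      by (rule dir_deriv_cong_open[OF M.open_S x]) (rule dir_deriv_compose[OF d\<phi> du])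
    also have "\<dots> = dir_deriv (\<lambda>y. \<Sum>i\<in>UNIV. dir_deriv \<phi> v y $ i * partial i u (\<phi> y)) w x"
      by (rule dir_deriv_cong_open[OF M.open_S x]) (simp add: dir_deriv_sum_partial[OF du])
    also have "\<dots> = (\<Sum>i\<in>UNIV. J v $ i * dir_deriv (partial i u) (J w) (\<phi> x) + E v w $ i * partial i u (\<phi> x))"
    proof -
      have pd: "partial i u differentiable (at (\<phi> x))" for i
        by (rule smooth_on_differentiable[OF smooth_on_partial[OF u] \<phi>x])
      have pd': "(\<lambda>y. partial i u (\<phi> y)) differentiable (at x)" for i
        by (rule differentiable_compose_at[OF d\<phi>[OF x] pd])
      have nd: "(\<lambda>y. dir_deriv \<phi> v y $ i) differentiable (at x)" for i
        by (rule smooth_on_differentiable[OF smooth_on_nth[OF M.open_S smooth_on_dir_deriv[OF M.open_S \<phi>(1)]] x])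
      have n: "dir_deriv (\<lambda>y. dir_deriv \<phi> v y $ i) w x = E v w $ i" for i
        unfolding E_def by (rule dir_deriv_bounded_linear[OF bounded_linear_vec_nth dd\<phi>])
      show ?thesis
        by (simp add: dir_deriv_sum differentiable_mult nd pd' dir_deriv_mult n dir_deriv_compose[OF d\<phi>[OF x] pd] J_def)
    qed
    also have "\<dots> = dir_deriv (dir_deriv u (J v)) (J w) (\<phi> x) + dir_deriv u (E v w) (\<phi> x)"
    proof -
      have pd: "partial i u differentiable (at (\<phi> x))" for i
        by (rule smooth_on_differentiable[OF smooth_on_partial[OF u] \<phi>x])
      have "dir_deriv (dir_deriv u (J v)) (J w) (\<phi> x) = dir_deriv (\<lambda>z. \<Sum>i\<in>UNIV. J v $ i * partial i u z) (J w) (\<phi> x)"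
        by (rule dir_deriv_cong_open[OF N.open_S \<phi>x])
          (simp add: dir_deriv_sum_partial[OF smooth_on_differentiable[OF u]])
      also have "\<dots> = (\<Sum>i\<in>UNIV. J v $ i * dir_deriv (partial i u) (J w) (\<phi> x))"
        by (simp add: dir_deriv_sum differentiable_mult pd dir_deriv_mult)
      finally show ?thesis by (simp add: sum.distrib dir_deriv_sum_partial[OF du[OF x]])
    qed
    finally show ?thesis
      unfolding hess_def d1 JG linear_add[OF dir_deriv_linear[OF du[OF x]]] by simp
  qed
qed

section \<open>Traces on planes\<close>

text \<open>In a \<open>\<beta>\<close>-orthogonal basis the cross term disappears and the two other
  terms are bounded by assumption; both sides scale alike when the basis changes.\<close>

lemma mix_abs_le:
  assumes \<beta>: "bilinear \<beta>" "\<And>v w. \<beta> v w = \<beta> w v" "\<And>v. v \<noteq> 0 \<Longrightarrow> \<beta> v v > 0"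
    and \<eta>: "bilinear \<eta>" "\<And>v w. \<eta> v w = \<eta> w v" "\<And>v. \<bar>\<eta> v v\<bar> \<le> e * \<beta> v v"
    and ab: "indep2 a b"
  shows "\<bar>mix \<beta> \<eta> a b\<bar> \<le> 2 * e * gram \<beta> a b"
proof -
  have a: "a \<noteq> 0" using ab[unfolded indep2_def, rule_format, of 1 0] by auto
  then have pos: "\<beta> a a > 0" by (rule \<beta>(3))
  define b' where "b' = (- \<beta> a b) *\<^sub>R a + \<beta> a a *\<^sub>R b"
  have o: "\<beta> a b' = 0"
    unfolding b'_def by (simp add: bilinear_radd[OF \<beta>(1)] bilinear_rmul[OF \<beta>(1)] bilinear_lmul[OF \<beta>(1)] bilinear_rsub[OF \<beta>(1)] bilinear_rneg[OF \<beta>(1)])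
  have m: "mix \<beta> \<eta> a b' = (\<beta> a a)\<^sup>2 * mix \<beta> \<eta> a b"
    using mix_change_basis[OF \<beta>(1) \<eta>(1) \<beta>(2) \<eta>(2), of 1 a 0 b "- \<beta> a b" "\<beta> a a"] by (simp add: b'_def)
  have g: "gram \<beta> a b' = (\<beta> a a)\<^sup>2 * gram \<beta> a b"
    using gram_change_basis[OF \<beta>(1,2), of 1 a 0 b "- \<beta> a b" "\<beta> a a"] by (simp add: b'_def)
  have nn: "\<beta> b' b' \<ge> 0"
  proof (cases "b' = 0")
    case True
    then show ?thesis using bilinear_lzero[OF \<beta>(1)] by simp
  next
    case False
    then show ?thesis using \<beta>(3)[of b'] by simp
  qed
  have "\<bar>mix \<beta> \<eta> a b'\<bar> \<le> \<beta> a a * \<bar>\<eta> b' b'\<bar> + \<beta> b' b' * \<bar>\<eta> a a\<bar>"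
    unfolding mix_def o using pos nn abs_triangle_ineq[of "\<beta> a a * \<eta> b' b'" "\<beta> b' b' * \<eta> a a"] by (simp add: abs_mult)
  also have "\<dots> \<le> \<beta> a a * (e * \<beta> b' b') + \<beta> b' b' * (e * \<beta> a a)"
    using pos nn by (intro add_mono mult_left_mono \<eta>(3)) auto
  also have "\<dots> = 2 * e * gram \<beta> a b'" unfolding gram_def o by simp
  finally have "(\<beta> a a)\<^sup>2 * \<bar>mix \<beta> \<eta> a b\<bar> \<le> (\<beta> a a)\<^sup>2 * (2 * e * gram \<beta> a b)"
    unfolding m g by (simp add: abs_mult mult_ac)
  then show ?thesis using pos by (simp add: mult_le_cancel_left_pos)
qed

text \<open>The trace of the square of a linear form on a plane is the squared length of the form
  restricted to the plane. Lower bound: the mixed form is the squared length of \<open>l b\<close>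
  times \<open>a\<close> minus \<open>l a\<close> times \<open>b\<close>.\<close>

lemma mix_square_bounds:
  assumes \<beta>: "bilinear \<beta>" "\<And>v w. \<beta> v w = \<beta> w v" "\<And>v. v \<noteq> 0 \<Longrightarrow> \<beta> v v > 0"
    and l: "linear l" "\<And>v. (l v)\<^sup>2 \<le> c * \<beta> v v"
    and ab: "indep2 a b"
  shows "0 \<le> mix \<beta> (\<lambda>v w. l v * l w) a b" "mix \<beta> (\<lambda>v w. l v * l w) a b \<le> c * gram \<beta> a b"
proof -
  note bb = bilinear_ladd[OF \<beta>(1)] bilinear_radd[OF \<beta>(1)] bilinear_lmul[OF \<beta>(1)] bilinear_rmul[OF \<beta>(1)]
  define M where "M = mix \<beta> (\<lambda>v w. l v * l w) a b"
  have nn: "\<beta> v v \<ge> 0" for v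
    using \<beta>(3)[of v] bilinear_lzero[OF \<beta>(1), of v] by (cases "v = 0") auto
  have "\<beta> (l b *\<^sub>R a + (- l a) *\<^sub>R b) (l b *\<^sub>R a + (- l a) *\<^sub>R b) = M"
    unfolding bb M_def mix_def \<beta>(2)[of b a] real_scaleR_def by algebra
  then show M0: "0 \<le> mix \<beta> (\<lambda>v w. l v * l w) a b" using nn unfolding M_def by metis
  \<comment> \<open>\<open>gram \<beta> a b\<close> times the vector of the plane that represents
    \<open>l\<close>; there the assumed bound on \<open>l\<close> gives the upper estimate, after
    cancelling \<open>M\<close>.\<close>
  define z where "z = (\<beta> b b * l a - \<beta> a b * l b) *\<^sub>R a + (\<beta> a a * l b - \<beta> a b * l a) *\<^sub>R b"
  have lz: "l z = M"
    unfolding z_def linear_add[OF l(1)] linear_scale[OF l(1)] M_def mix_def real_scaleR_def by algebra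
  have "\<beta> z z = gram \<beta> a b * M"
    unfolding z_def bb M_def mix_def gram_def \<beta>(2)[of b a] real_scaleR_def by algebra
  then have *: "M * M \<le> M * (c * gram \<beta> a b)"
    using l(2)[of z] unfolding lz by (simp add: power2_eq_square mult_ac)
  show "mix \<beta> (\<lambda>v w. l v * l w) a b \<le> c * gram \<beta> a b"
  proof (cases "M = 0")
    \<comment> \<open>With \<open>M = 0\<close> nothing can be cancelled; the claim reduces to
      \<open>c\<close> being nonnegative.\<close>
    case True
    have "a \<noteq> 0" using ab[unfolded indep2_def, rule_format, of 1 0] by auto
    then have "0 \<le> c * \<beta> a a" "\<beta> a a > 0" using l(2)[of a] \<beta>(3) by (auto intro: order_trans[of 0 "(l a)\<^sup>2"])
    then have "c \<ge> 0" by (simp add: zero_le_mult_iff)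
    then show ?thesis using True gram_pos[OF \<beta> ab] by (simp add: M_def)
  next
    case False
    then have "M > 0" using M0 by (simp add: M_def)
    then show ?thesis using * by (simp add: M_def)
  qed
qed

section \<open>The bump profile\<close>

text \<open>The ratio of \<open>max \<bar>q \<psi>''(q)\<bar>\<close> to \<open>\<bar>\<psi>'(0)\<bar>\<close> for \<open>\<psi>(q) = exp(-c/(1-q))\<close> tends to \<open>1/e\<close> as \<open>c\<close> grows;
  \<open>c = 30\<close> makes it small enough.\<close>

definition bump :: "nat \<Rightarrow> real \<Rightarrow> real" where
  "bump k t = (if t < 1 then exp (- 30 / (1 - t)) / (1 - t) ^ k else 0)"

text \<open>Quadratic vanishing at 1 makes the difference quotient at the gluing point tend to
  0.\<close>

lemma bump_le: "\<bar>bump k t\<bar> \<le> (real (k + 2)) ^ (k + 2) * (t - 1)\<^sup>2"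
proof (cases "t < 1")
  case True
  define s where "s = 1 / (1 - t)"
  have s: "s > 0" "1 - t = 1 / s" using True by (auto simp: s_def)
  \<comment> \<open>The exponent \<open>k + 2\<close> supplies \<open>k\<close> powers of
    \<open>s\<close> against the pole and two more for the factor \<open>(t - 1)\<close>
    squared.\<close>
  have "(1 + (30 * s) / real (k + 2)) ^ (k + 2) \<le> exp (30 * s)"
    by (rule exp_ge_one_plus_x_over_n_power_n) (use s in auto)
  moreover have "(s / real (k + 2)) ^ (k + 2) \<le> (1 + (30 * s) / real (k + 2)) ^ (k + 2)"
  proof (rule power_mono)
    have "s / real (k + 2) \<le> (30 * s) / real (k + 2)" using s by (intro divide_right_mono) auto
    then show "s / real (k + 2) \<le> 1 + 30 * s / real (k + 2)" by simp
  qed (use s in simp)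
  ultimately have "(s / real (k + 2)) ^ (k + 2) \<le> exp (30 * s)" by simp
  then have "s ^ (k + 2) \<le> real (k + 2) ^ (k + 2) * exp (30 * s)"
    by (simp add: power_divide divide_le_eq mult.commute)
  then have "s ^ k * exp (- (30 * s)) * s\<^sup>2 \<le> real (k + 2) ^ (k + 2)"
    by (simp add: exp_minus divide_simps power_add power2_eq_square mult_ac)
  then have "s ^ k * exp (- (30 * s)) \<le> real (k + 2) ^ (k + 2) / s\<^sup>2"
    using s by (simp add: pos_le_divide_eq)
  moreover have "bump k t = s ^ k * exp (- (30 * s))"
    using True unfolding bump_def s(2) by (simp add: power_divide)
  moreover have "(t - 1)\<^sup>2 = 1 / s\<^sup>2" using s(2) by (metis power2_commute power_one_over)
  ultimately show ?thesis using s by (simp add: abs_mult)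
qed (simp add: bump_def)

text \<open>Differentiation stays inside the family, which is the closure property used by
  \<open>smooth_on_compose_deriv_family\<close>. At \<open>t = 1\<close> all members vanish and
  \<open>bump_le\<close> gives derivative 0.\<close>

lemma bump_deriv: "(bump k has_real_derivative real k * bump (Suc k) t + (- 30) * bump (Suc (Suc k)) t) (at t)"
proof -
  consider "t < 1" | "t > 1" | "t = 1" by linarith
  then show ?thesis
  proof cases
    case 1
    have "((\<lambda>t. exp (- 30 / (1 - t)) / (1 - t) ^ k) has_real_derivative
        real k * bump (Suc k) t + (- 30) * bump (Suc (Suc k)) t) (at t)"
      using 1 by (auto intro!: derivative_eq_intros simp: bump_def)
        (cases k; simp add: divide_simps power2_eq_square; simp add: algebra_simps)
    then show ?thesis
      by (rule has_field_derivative_transform_within_open[of _ _ _ "{..<1}"]) (use 1 in \<open>auto simp: bump_def\<close>)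
  next
    case 2
    have "((\<lambda>_. 0) has_real_derivative real k * bump (Suc k) t + (- 30) * bump (Suc (Suc k)) t) (at t)"
      using 2 by (simp add: bump_def)
    then show ?thesis
      by (rule has_field_derivative_transform_within_open[of _ _ _ "{1<..}"]) (use 2 in \<open>auto simp: bump_def\<close>)
  next
    case 3
    have "((\<lambda>y. (bump k y - bump k 1) / (y - 1)) \<longlongrightarrow> 0) (at 1)"
    proof (rule Lim_null_comparison)
      show "\<forall>\<^sub>F y in at 1. norm ((bump k y - bump k 1) / (y - 1)) \<le> (real (k + 2)) ^ (k + 2) * \<bar>y - 1\<bar>"
      proof (rule eventually_at_filter[THEN iffD2], rule always_eventually, safe)
        fix y :: real assume "y \<noteq> 1"
        then show "norm ((bump k y - bump k 1) / (y - 1)) \<le> (real (k + 2)) ^ (k + 2) * \<bar>y - 1\<bar>"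
          using bump_le[of k y] by (simp add: bump_def[of k 1] divide_le_eq power2_eq_square abs_mult mult.assoc)
      qed
      show "((\<lambda>y. (real (k + 2)) ^ (k + 2) * \<bar>y - 1\<bar>) \<longlongrightarrow> 0) (at 1)"
        by (auto intro!: tendsto_eq_intros)
    qed
    then show ?thesis using 3 by (simp add: has_field_derivative_iff bump_def)
  qed
qed

section \<open>The local estimate\<close>

text \<open>The absolute value of \<open>bump' 0\<close>, the unit in which Hessians and curvature
  differences are measured below.\<close>

abbreviation "bump_mass \<equiv> 30 * exp (- 30 :: real)"

definition bump' :: "real \<Rightarrow> real" where "bump' t = - 30 * bump 2 t"
definition bump'' :: "real \<Rightarrow> real" where "bump'' t = 900 * bump 4 t - 60 * bump 3 t"

lemma bump_0_deriv: "(bump 0 has_real_derivative bump' t) (at t)"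
  using bump_deriv[of 0 t] by (simp add: bump'_def numeral_2_eq_2)

lemma bump'_deriv: "(bump' has_real_derivative bump'' t) (at t)"
proof -
  have "((\<lambda>t. - 30 * bump 2 t) has_real_derivative - 30 * (real 2 * bump (Suc 2) t + - 30 * bump (Suc (Suc 2)) t)) (at t)"
    by (rule DERIV_cmult[OF bump_deriv])
  then show ?thesis by (simp add: bump'_def[abs_def] bump''_def numeral_eq_Suc algebra_simps)
qed

lemma bump_ge_1: "t \<ge> 1 \<Longrightarrow> bump k t = 0" "t \<ge> 1 \<Longrightarrow> bump' t = 0" "t \<ge> 1 \<Longrightarrow> bump'' t = 0"
  by (simp_all add: bump_def bump'_def bump''_def)

lemma bump_eq: "t < 1 \<Longrightarrow> bump k t = (1 / (1 - t)) ^ k * exp (- (30 * (1 / (1 - t))))"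
  by (simp add: bump_def power_divide)

lemma bump_0_bounds: "0 \<le> bump 0 t" "bump 0 t \<le> 1"
  by (auto simp: bump_def)

lemma le_exp_minus_1: "(s::real) \<le> exp (s - 1)"
  using exp_ge_add_one_self[of "s - 1"] by simp

lemma bump'_0: "bump' 0 = - bump_mass"
  by (simp add: bump'_def bump_def)

lemma bump''_half: "bump'' (1/2) = 13920 * exp (- 60)"
  by (simp add: bump''_def bump_def power_divide)

lemma bump'_bound: assumes "t \<ge> 0" shows "\<bar>bump' t\<bar> \<le> bump_mass"
proof (cases "t < 1")
  case True
  define s where "s = 1 / (1 - t)"
  have s: "s \<ge> 1" using True assms by (simp add: s_def)
  have "s\<^sup>2 \<le> (exp (s - 1))\<^sup>2" using le_exp_minus_1[of s] s by (intro power_mono) auto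
  then have "s\<^sup>2 * exp (- (30 * s)) \<le> exp (2 * (s - 1)) * exp (- (30 * s))"
    by (intro mult_right_mono) (simp_all only: exp_double exp_ge_zero)
  \<comment> \<open>With \<open>s = 1 / (1 - t)\<close> at least 1, the elementary bound
    \<open>le_exp_minus_1\<close> trades the two powers of \<open>s\<close> for part of the
    exponential decay, so the maximum sits at \<open>s = 1\<close>, that is, at
    \<open>t = 0\<close>.\<close>
  also have "\<dots> = exp (2 * (s - 1) - 30 * s)" by (simp flip: exp_add)
  also have "\<dots> \<le> exp (- 30)" using s by simp
  finally show ?thesis using True by (simp add: bump'_def bump_eq s_def abs_mult)
qed (simp add: bump_ge_1)

text \<open>After the substitution \<open>s = 1 / (1 - t)\<close>, dropping the negative term and
  using \<open>le_exp_minus_1\<close> leaves 900 exp(-30) (s - 1) exp(-27 (s - 1)). This is at most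
  900/27 * 1/2 exp(-30) = 50/3 exp(-30), which is 5/9 of \<open>bump_mass\<close>.\<close>

lemma bump''_bound: assumes "t \<ge> 0" shows "\<bar>t * bump'' t\<bar> \<le> 5/9 * bump_mass"
proof (cases "t < 1")
  case True
  define s where "s = 1 / (1 - t)"
  have s: "s \<ge> 1" "t = 1 - 1 / s" using True assms by (simp_all add: s_def)
  have ts: "t * s = s - 1" using s by (simp add: field_simps)
  \<comment> \<open>27 = 30 - 3: three units of the decay rate are spent on the factor
    \<open>s ^ 3\<close>.\<close>
  define y where "y = 27 * (s - 1)"
  have y: "y \<ge> 0" using s by (simp add: y_def)
  \<comment> \<open>The sharp bound for y exp(-y) is 1/e; the quadratic Taylor bound yields 1/2,
    which is enough.\<close>
  have "2 * y \<le> 1 + y + y\<^sup>2 / 2" using sum_squares_ge_zero[of "y - 1" 1] zero_le_power2[of "y - 1"] by (simp add: power2_eq_square algebra_simps)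
  also have "\<dots> \<le> exp y" by (rule exp_lower_Taylor_quadratic[OF y])
  finally have ye: "y * exp (- y) \<le> 1/2" by (simp add: exp_minus field_simps)
  have "\<bar>t * bump'' t\<bar> = (s - 1) * (900 * s ^ 3 - 60 * s\<^sup>2) * exp (- (30 * s))"
  proof -
    have be: "bump'' t = (900 * s ^ 4 - 60 * s ^ 3) * exp (- (30 * s))"
      using True by (simp add: bump''_def bump_eq s_def algebra_simps)
    have "t * bump'' t = (t * s) * (900 * s ^ 3 - 60 * s\<^sup>2) * exp (- (30 * s))"
      unfolding be by (simp add: algebra_simps power3_eq_cube power4_eq_xxxx power2_eq_square)
    then have "t * bump'' t = (s - 1) * (900 * s ^ 3 - 60 * s\<^sup>2) * exp (- (30 * s))"
      unfolding ts .
    moreover have "0 \<le> 900 * s ^ 3 - 60 * s\<^sup>2"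
    proof -
      have "900 * s ^ 3 - 60 * s\<^sup>2 = s\<^sup>2 * (900 * s - 60)" by (simp add: power3_eq_cube power2_eq_square algebra_simps)
      then show ?thesis using s by simp
    qed
    ultimately show ?thesis using s by simp
  qed
  also have "\<dots> \<le> (s - 1) * (900 * s ^ 3) * exp (- (30 * s))"
    using s by (intro mult_right_mono mult_left_mono) auto
  also have "\<dots> \<le> (s - 1) * (900 * exp (s - 1) ^ 3) * exp (- (30 * s))"
    using s le_exp_minus_1[of s] by (intro mult_right_mono mult_left_mono power_mono) auto
  also have "\<dots> = 100/3 * (y * (exp (s - 1) ^ 3 * exp (- (30 * s))))" by (simp add: y_def)
  also have "exp (s - 1) ^ 3 * exp (- (30 * s)) = exp (- 30) * exp (- y)"
  proof -
    have "exp (s - 1) ^ 3 * exp (- (30 * s)) = exp (real 3 * (s - 1) + - (30 * s))"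
      unfolding exp_of_nat_mult[symmetric] mult_exp_exp ..
    also have "real 3 * (s - 1) + - (30 * s) = - 30 + - y" by (simp add: y_def)
    finally show ?thesis by (simp only: mult_exp_exp)
  qed
  also have "100/3 * (y * (exp (- 30) * exp (- y))) = 100/3 * exp (- 30) * (y * exp (- y))" by simp
  also have "\<dots> \<le> 100/3 * exp (- 30) * (1/2)" by (intro mult_left_mono ye) auto
  finally show ?thesis by simp
qed (simp add: bump_ge_1)

text \<open>One constant for the Hessian and the squared differential, both relative to the metric
  and hence independent of coordinates.\<close>

definition bounded_form :: "('v \<Rightarrow> 'v \<Rightarrow> real) \<Rightarrow> ('v \<Rightarrow> 'v \<Rightarrow> real) \<Rightarrow> ('v \<Rightarrow> real) \<Rightarrow> real \<Rightarrow> bool" where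
  "bounded_form \<beta> H \<omega> C \<longleftrightarrow> (\<forall>v. \<bar>H v v\<bar> \<le> C * \<beta> v v) \<and> (\<forall>v. (\<omega> v)\<^sup>2 \<le> C * \<beta> v v)"

text \<open>The oscillation of the Hessian trace over the planes at one point, the first-order
  quantity behind the local pinching constant.\<close>

definition trace_osc_le :: "(real^'n \<Rightarrow> real^'n \<Rightarrow> real) \<Rightarrow> (real^'n \<Rightarrow> real^'n \<Rightarrow> real) \<Rightarrow> real \<Rightarrow> bool" where
  "trace_osc_le \<beta> H L \<longleftrightarrow> (\<forall>a b a' b'. indep2 a b \<longrightarrow> indep2 a' b' \<longrightarrow>
     trace_on \<beta> H a b - trace_on \<beta> H a' b' \<le> L)"

section \<open>Comparison of a metric with its value at a point\<close>

context local_metric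
begin

lemma mi_nonneg: "x \<in> S \<Longrightarrow> mi x v v \<ge> 0"
  using mi_pos[of x v] by (cases "v = 0") (auto simp: metric_inner_def)

lemma mi_cauchy_schwarz: assumes x: "x \<in> S" shows "(mi x u v)\<^sup>2 \<le> mi x u u * mi x v v"
proof (cases "u = 0")
  case False
  note b = metric_inner_linear
  let ?w = "mi x u u *\<^sub>R v + (- mi x u v) *\<^sub>R u"
  have "mi x ?w ?w = mi x u u * (mi x u u * mi x v v - (mi x u v)\<^sup>2)"
    unfolding b mi_commute[OF x, of v u] real_scaleR_def by algebra
  then have "0 \<le> mi x u u * (mi x u u * mi x v v - (mi x u v)\<^sup>2)" using mi_nonneg[OF x] by metis
  then show ?thesis using mi_pos[OF x False] by (simp add: zero_le_mult_iff)
qed (simp add: metric_inner_def)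

text \<open>The minimum over the compact unit sphere; it converts norm estimates into estimates
  relative to \<open>mi x0\<close>.\<close>

lemma mi_coercive:
  assumes x: "x \<in> S"
  obtains l where "l > 0" "\<And>v. l * (norm v)\<^sup>2 \<le> mi x v v"
proof -
  have "continuous_on (sphere 0 1) (\<lambda>v. mi x v v)"
    unfolding metric_inner_def
    by (intro continuous_on_inner continuous_on_id linear_continuous_on[OF matrix_vector_mul_bounded_linear])
  moreover have "axis undefined 1 \<in> sphere (0::real^'n) 1" by simp
  then have "sphere (0::real^'n) 1 \<noteq> {}" by blast
  ultimately have "\<exists>w\<in>sphere 0 1. \<forall>v\<in>sphere 0 1. mi x w w \<le> mi x v v"
    by (intro continuous_attains_inf[OF compact_sphere])
  then obtain w where w: "w \<in> sphere 0 1" "\<And>v. v \<in> sphere 0 1 \<Longrightarrow> mi x w w \<le> mi x v v" by blast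
  show thesis
  proof
    have "w \<noteq> 0" using w(1) by auto
    then show "mi x w w > 0" by (rule mi_pos[OF x])
    show "mi x w w * (norm v)\<^sup>2 \<le> mi x v v" for v
    proof (cases "v = 0")
      case False
      define u where "u = (1 / norm v) *\<^sub>R v"
      have "mi x w w \<le> mi x u u" by (rule w(2)) (use False in \<open>simp add: u_def\<close>)
      moreover have vu: "v = norm v *\<^sub>R u" using False by (simp add: u_def)
      have "mi x (c *\<^sub>R u) (c *\<^sub>R u) = c\<^sup>2 * mi x u u" for c
        by (simp add: metric_inner_linear power2_eq_square)
      then have "mi x v v = (norm v)\<^sup>2 * mi x u u" by (subst (1 2) vu)
      ultimately show ?thesis using mult_right_mono[of "mi x w w" "mi x u u" "(norm v)\<^sup>2"] by (simp add: mult.commute)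
    qed (simp add: metric_inner_def)
  qed
qed

lemma mi_near:
  assumes x0: "x0 \<in> S" and e: "e > 0"
  shows "\<forall>\<^sub>F x in nhds x0. x \<in> S \<and> (\<forall>v. \<bar>mi x v v - mi x0 v v\<bar> \<le> e * mi x0 v v)"
proof -
  obtain l where l: "l > 0" "\<And>v. l * (norm v)\<^sup>2 \<le> mi x0 v v" using mi_coercive[OF x0] by blast
  obtain K where K: "K > 0" "\<And>(A::real^'n^'n) v. norm (A *v v) \<le> norm A * norm v * K"
    using bounded_bilinear.pos_bounded[OF bounded_bilinear_matrix_vector] by blast
  have "isCont G x0" using differentiable_imp_continuous_within[OF G_diff[OF x0]] .
  then have "(G \<longlongrightarrow> G x0) (nhds x0)" by (simp add: isCont_def tendsto_at_iff_tendsto_nhds)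
  then have "\<forall>\<^sub>F x in nhds x0. dist (G x) (G x0) < e * l / K"
    using e l K by (intro tendstoD) auto
  moreover have "\<forall>\<^sub>F x in nhds x0. x \<in> S" using open_S x0 by (rule eventually_nhds_in_open)
  ultimately show ?thesis
  proof eventually_elim
    case (elim x)
    have "\<bar>mi x v v - mi x0 v v\<bar> \<le> e * mi x0 v v" for v
    proof -
      have "mi x v v - mi x0 v v = v \<bullet> ((G x - G x0) *v v)"
        by (simp add: metric_inner_def matrix_vector_mult_diff_rdistrib inner_diff_right)
      then have "\<bar>mi x v v - mi x0 v v\<bar> \<le> norm v * norm ((G x - G x0) *v v)"
        by (simp add: Cauchy_Schwarz_ineq2)
      also have "\<dots> \<le> norm v * (norm (G x - G x0) * norm v * K)"
        by (intro mult_left_mono K(2)) auto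
      also have "\<dots> = norm (G x - G x0) * ((norm v)\<^sup>2 * K)" by (simp add: power2_eq_square)
      also have "\<dots> \<le> e * l / K * ((norm v)\<^sup>2 * K)"
        using elim K by (intro mult_right_mono) (auto simp: dist_norm)
      also have "\<dots> = e * (l * (norm v)\<^sup>2)" using K by simp
      also have "\<dots> \<le> e * mi x0 v v" using e l by (intro mult_left_mono) auto
      finally show ?thesis .
    qed
    then show ?case using elim by blast
  qed
qed

text \<open>The factor \<open>x - x0\<close> tends to 0 while the Christoffel symbols stay bounded,
  so this contribution to the Hessian of the bump is small in arbitrary coordinates.\<close>

lemma chr_near:
  assumes x0: "x0 \<in> S" and e: "e > 0"
  shows "\<forall>\<^sub>F x in nhds x0. \<forall>v. \<bar>mi x0 (x - x0) (chr G x v v)\<bar> \<le> e * mi x0 v v"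
proof -
  obtain l where l: "l > 0" "\<And>v. l * (norm v)\<^sup>2 \<le> mi x0 v v" using mi_coercive[OF x0] by blast
  obtain K where K: "K > 0" "\<And>(A::real^'n^'n) v. norm (A *v v) \<le> norm A * norm v * K"
    using bounded_bilinear.pos_bounded[OF bounded_bilinear_matrix_vector] by blast
  define c where "c x = (\<Sum>k\<in>UNIV. \<Sum>i\<in>UNIV. \<Sum>j\<in>UNIV. \<bar>christoffel G k i j x\<bar>)" for x
  have cont: "isCont (christoffel G k i j) x0" for k i j
    using differentiable_imp_continuous_within[OF christoffel_diff[OF x0]] .
  define f where "f x = norm (x - x0) * (norm (G x0) * c x * K)" for x
  have "isCont f x0"
    unfolding f_def c_def by (intro continuous_intros cont)
  then have "(f \<longlongrightarrow> f x0) (nhds x0)"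
    unfolding isCont_def by (rule tendsto_at_iff_tendsto_nhds[THEN iffD1])
  then have "((\<lambda>x. norm (x - x0) * (norm (G x0) * c x * K)) \<longlongrightarrow> 0) (nhds x0)"
    unfolding f_def by simp
  then have "\<forall>\<^sub>F x in nhds x0. dist (norm (x - x0) * (norm (G x0) * c x * K)) 0 < e * l"
    using e l by (intro tendstoD) auto
  then show ?thesis
  proof eventually_elim
    case (elim x)
    show ?case
    proof
      fix v :: "real^'n"
      have nc: "norm (chr G x v v) \<le> c x * (norm v)\<^sup>2"
      proof -
        have "norm (chr G x v v) \<le> (\<Sum>k\<in>UNIV. \<bar>chr G x v v $ k\<bar>)" by (rule norm_le_l1_cart)
        also have "\<dots> \<le> (\<Sum>k\<in>UNIV. \<Sum>i\<in>UNIV. \<Sum>j\<in>UNIV. \<bar>christoffel G k i j x\<bar> * (norm v)\<^sup>2)"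
        proof (rule sum_mono)
          fix k :: 'n
          have "\<bar>chr G x v v $ k\<bar> \<le> (\<Sum>i\<in>UNIV. \<Sum>j\<in>UNIV. \<bar>christoffel G k i j x * v $ i * v $ j\<bar>)"
            unfolding chr_def vec_lambda_beta by (intro order.trans[OF sum_abs] sum_mono sum_abs)
          also have "\<dots> \<le> (\<Sum>i\<in>UNIV. \<Sum>j\<in>UNIV. \<bar>christoffel G k i j x\<bar> * (norm v)\<^sup>2)"
          proof (intro sum_mono)
            fix i j
            have "\<bar>v $ i\<bar> * \<bar>v $ j\<bar> \<le> norm v * norm v" by (intro mult_mono component_le_norm_cart) auto
            then have "\<bar>christoffel G k i j x\<bar> * (\<bar>v $ i\<bar> * \<bar>v $ j\<bar>) \<le> \<bar>christoffel G k i j x\<bar> * (norm v * norm v)"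
              by (intro mult_left_mono) auto
            then show "\<bar>christoffel G k i j x * v $ i * v $ j\<bar> \<le> \<bar>christoffel G k i j x\<bar> * (norm v)\<^sup>2"
              by (simp add: abs_mult power2_eq_square mult.assoc)
          qed
          finally show "\<bar>chr G x v v $ k\<bar> \<le> (\<Sum>i\<in>UNIV. \<Sum>j\<in>UNIV. \<bar>christoffel G k i j x\<bar> * (norm v)\<^sup>2)" .
        qed
        also have "\<dots> = c x * (norm v)\<^sup>2" by (simp add: c_def sum_distrib_right)
        finally show ?thesis .
      qed
      have "\<bar>mi x0 (x - x0) (chr G x v v)\<bar> \<le> norm (x - x0) * norm (G x0 *v chr G x v v)"
        unfolding metric_inner_def by (rule Cauchy_Schwarz_ineq2)
      also have "\<dots> \<le> norm (x - x0) * (norm (G x0) * norm (chr G x v v) * K)"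
        by (intro mult_left_mono K(2)) auto
      also have "\<dots> \<le> norm (x - x0) * (norm (G x0) * (c x * (norm v)\<^sup>2) * K)"
        using K by (intro mult_left_mono mult_right_mono nc) auto
      also have "\<dots> = norm (x - x0) * (norm (G x0) * c x * K) * (norm v)\<^sup>2" by simp
      also have "\<dots> \<le> e * l * (norm v)\<^sup>2"
        using elim by (intro mult_right_mono) (auto simp: dist_norm)
      also have "\<dots> = e * (l * (norm v)\<^sup>2)" by simp
      also have "\<dots> \<le> e * mi x0 v v" using e l by (intro mult_left_mono) auto
      finally show "\<bar>mi x0 (x - x0) (chr G x v v)\<bar> \<le> e * mi x0 v v" .
    qed
  qed
qed

end

section \<open>The radial bump and its covariant Hessian\<close>

locale bump_function = local_metric S G for S :: "(real^'n::finite) set" and G +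
  fixes x0 :: "real^'n" and \<delta> :: real
  assumes x0: "x0 \<in> S" and \<delta>: "\<delta> > 0"
begin

abbreviation "B \<equiv> metric_inner G x0"
text \<open>The metric frozen at \<open>x0\<close> stands in for the squared distance, so that
  second derivatives of \<open>q\<close> are constant.\<close>

definition "q y = B (y - x0) (y - x0) / \<delta>\<^sup>2"
text \<open>The prefactor cancels the denominator that two derivatives of \<open>q\<close> produce:
  the size of the Hessian does not depend on \<open>\<delta>\<close>.\<close>

definition "F y = \<delta>\<^sup>2 * bump 0 (q y)"

lemma q_nonneg: "q y \<ge> 0"
  unfolding q_def using mi_nonneg[OF x0] by simp

lemma q_deriv: "(q has_derivative (\<lambda>h. 2 * B (y - x0) h / \<delta>\<^sup>2)) (at y)"
proof -
  have d: "((\<lambda>y. y - x0) has_derivative (\<lambda>h. h)) (at y)"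
    by (auto intro!: derivative_eq_intros)
  have d2: "((\<lambda>y. G x0 *v (y - x0)) has_derivative (\<lambda>h. G x0 *v h)) (at y)"
    by (rule bounded_linear.has_derivative[OF matrix_vector_mul_bounded_linear d])
  have "((\<lambda>y. (y - x0) \<bullet> (G x0 *v (y - x0))) has_derivative
      (\<lambda>h. (y - x0) \<bullet> (G x0 *v h) + h \<bullet> (G x0 *v (y - x0)))) (at y)"
    by (rule has_derivative_inner[OF d d2])
  moreover have "(y - x0) \<bullet> (G x0 *v h) + h \<bullet> (G x0 *v (y - x0)) = 2 * B (y - x0) h" for h
    using mi_commute[OF x0, of h "y - x0"] by (simp add: metric_inner_def)
  ultimately have "((\<lambda>y. B (y - x0) (y - x0)) has_derivative (\<lambda>h. 2 * B (y - x0) h)) (at y)"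
    by (simp add: metric_inner_def)
  from has_derivative_mult_right[OF this, of "1 / \<delta>\<^sup>2"]
  show ?thesis unfolding q_def[abs_def] by simp
qed

lemma smooth_q: "smooth_on UNIV q"
proof -
  have c: "smooth_on UNIV (\<lambda>y. y $ i + - x0 $ i)" for i
    by (rule smooth_on_add[OF open_UNIV smooth_on_nth[OF open_UNIV smooth_on_id[OF open_UNIV]] smooth_on_const[OF open_UNIV]])
  have t: "smooth_on UNIV (\<lambda>y. (y $ i + - x0 $ i) * ((G x0 $ i $ j / \<delta>\<^sup>2) * (y $ j + - x0 $ j)))" for i j
    by (rule smooth_on_mult[OF open_UNIV c smooth_on_mult[OF open_UNIV smooth_on_const[OF open_UNIV] c]])
  have "smooth_on UNIV (\<lambda>y. \<Sum>i\<in>UNIV. \<Sum>j\<in>UNIV. (y $ i + - x0 $ i) * ((G x0 $ i $ j / \<delta>\<^sup>2) * (y $ j + - x0 $ j)))"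
    by (rule smooth_on_sum[OF open_UNIV smooth_on_sum[OF open_UNIV t]])
  moreover have "q = (\<lambda>y. \<Sum>i\<in>UNIV. \<Sum>j\<in>UNIV. (y $ i + - x0 $ i) * ((G x0 $ i $ j / \<delta>\<^sup>2) * (y $ j + - x0 $ j)))"
    by (rule ext) (simp add: q_def metric_inner_def inner_vec_def matrix_vector_mult_def sum_distrib_left sum_divide_distrib)
  ultimately show ?thesis by simp
qed

lemma smooth_F: "smooth_on T F"
proof -
  have "smooth_on UNIV (\<lambda>y. bump 0 (q y))"
    by (rule smooth_on_compose_deriv_family[OF open_UNIV smooth_q]) (use bump_deriv in blast)
  from smooth_on_mult[OF open_UNIV smooth_on_const[OF open_UNIV] this] have "smooth_on UNIV F"
    unfolding F_def[abs_def] .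
  then show ?thesis by (rule smooth_on_subset) simp
qed

lemma dF: "dir_deriv F v y = 2 * bump' (q y) * B (y - x0) v"
proof -
  have "((\<lambda>y. \<delta>\<^sup>2 * bump 0 (q y)) has_derivative (\<lambda>h. \<delta>\<^sup>2 * (bump' (q y) * (2 * B (y - x0) h / \<delta>\<^sup>2)))) (at y)"
    by (rule has_derivative_mult_right[OF has_derivative_compose[OF q_deriv bump_0_deriv[unfolded has_field_derivative_def]]])
  from dir_deriv_eq[OF this] show ?thesis using \<delta> by (simp add: F_def[abs_def])
qed

lemma ddF: "dir_deriv (dir_deriv F v) w y
    = 2 * bump' (q y) * B v w + 4 * bump'' (q y) / \<delta>\<^sup>2 * (B (y - x0) v * B (y - x0) w)"
proof -
  have eq: "dir_deriv F v = (\<lambda>y. (2 * bump' (q y)) * (v \<bullet> (G x0 *v (y - x0))))"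
    unfolding dF[abs_def] mi_commute[OF x0, of _ v] by (simp add: metric_inner_def)
  have d: "((\<lambda>y. y - x0) has_derivative (\<lambda>h. h)) (at y)"
    by (auto intro!: derivative_eq_intros)
  have d1: "((\<lambda>y. v \<bullet> (G x0 *v (y - x0))) has_derivative (\<lambda>h. v \<bullet> (G x0 *v h))) (at y)"
    by (rule bounded_linear.has_derivative[OF bounded_linear_compose[OF bounded_linear_inner_right matrix_vector_mul_bounded_linear] d])
  have d2: "((\<lambda>y. 2 * bump' (q y)) has_derivative (\<lambda>h. 2 * (bump'' (q y) * (2 * B (y - x0) h / \<delta>\<^sup>2)))) (at y)"
    by (rule has_derivative_mult_right[OF has_derivative_compose[OF q_deriv bump'_deriv[unfolded has_field_derivative_def]]])
  from dir_deriv_eq[OF has_derivative_mult[OF d2 d1]] show ?thesis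
    unfolding eq using mi_commute[OF x0, of v "y - x0"] by (simp add: metric_inner_def)
qed

lemma hess_F: "hess G F y v w = 2 * bump' (q y) * B v w + 4 * bump'' (q y) / \<delta>\<^sup>2 * (B (y - x0) v * B (y - x0) w)
    - 2 * bump' (q y) * B (y - x0) (chr G y v w)"
  unfolding hess_def ddF dF ..

lemma F_outside: "q y \<ge> 1 \<Longrightarrow> F y = 0" "q y \<ge> 1 \<Longrightarrow> dir_deriv F v y = 0" "q y \<ge> 1 \<Longrightarrow> hess G F y v w = 0"
  by (simp_all add: hess_F dF F_def bump_ge_1)

lemma F_center: "dir_deriv F v x0 = 0" "hess G F x0 v w = - 2 * bump_mass * B v w"
  by (simp_all add: hess_F dF q_def metric_inner_def bump'_0)

text \<open>The Hessian is a multiple of the metric, with trace 2 on each plane, plus a multiple of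
  the square of the radial covector, plus an error \<open>E\<close>. Here \<open>\<sigma>\<close> is
  the squared length of the radial covector restricted to the plane, the only part of the main term
  that depends on the plane.\<close>

lemma trace_decomposition:
  assumes x: "x \<in> S" and e: "0 < e" "e \<le> 1/2"
    and near: "\<And>v. \<bar>mi x v v - B v v\<bar> \<le> e * B v v" "\<And>v. \<bar>B (x - x0) (chr G x v v)\<bar> \<le> e * B v v"
    and ab: "indep2 a b"
  defines "\<sigma> \<equiv> trace_on (mi x) (\<lambda>v w. B (x - x0) v * B (x - x0) w) a b"
  shows "\<bar>trace_on (mi x) (hess G F x) a b - (4 * bump' (q x) + 4 * bump'' (q x) / \<delta>\<^sup>2 * \<sigma>)\<bar>
      \<le> 16 * bump_mass * e"
    "0 \<le> \<sigma>" "\<sigma> \<le> \<delta>\<^sup>2 * q x / (1 - e)"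
proof -
  have g: "gram (mi x) a b > 0" by (rule gram_mi_pos[OF x ab])
  have B: "B v v \<le> mi x v v / (1 - e)" for v
    using near(1)[of v] e by (simp add: field_simps abs_le_iff)
  have B2: "B v v \<le> 2 * mi x v v" for v
  proof -
    have "(1 - e) * B v v \<le> mi x v v" using near(1)[of v] by (simp add: field_simps abs_le_iff)
    moreover have "1/2 * B v v \<le> (1 - e) * B v v" using e mi_nonneg[OF x0] by (intro mult_right_mono) auto
    ultimately show ?thesis by simp
  qed
  define c1 c2 where "c1 = 2 * bump' (q x)" "c2 = 4 * bump'' (q x) / \<delta>\<^sup>2"
  define E where "E v w = hess G F x v w - c1 * mi x v w - c2 * (B (x - x0) v * B (x - x0) w)" for v w
  note bb = metric_inner_linear
  have bh: "bilinear (hess G F x)" by (rule bilinear_hess[OF smooth_F x])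
  have bE: "bilinear E"
    unfolding bilinear_def E_def
    by (intro conjI allI linearI)
      (simp_all only: bb bilinear_ladd[OF bh] bilinear_radd[OF bh] bilinear_lmul[OF bh] bilinear_rmul[OF bh]
        real_scaleR_def, simp_all add: algebra_simps)
  have sE: "E v w = E w v" for v w
    unfolding E_def using hess_commute[OF smooth_F x, of v w] mi_commute[OF x, of v w] by simp
  have aE: "\<bar>E v v\<bar> \<le> 8 * bump_mass * e * mi x v v" for v
  proof -
    have "E v v = c1 * ((B v v - mi x v v) - B (x - x0) (chr G x v v))"
      unfolding E_def hess_F c1_c2_def[symmetric] by (simp add: algebra_simps)
    then have "\<bar>E v v\<bar> = 2 * \<bar>bump' (q x)\<bar> * \<bar>(B v v - mi x v v) - B (x - x0) (chr G x v v)\<bar>"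
      by (simp add: abs_mult c1_c2_def(1))
    also have "\<dots> \<le> 2 * bump_mass * (e * B v v + e * B v v)"
      using bump'_bound[OF q_nonneg, of x] near[of v] by (intro mult_mono) auto
    also have "\<dots> \<le> 2 * bump_mass * (e * (2 * mi x v v) + e * (2 * mi x v v))"
      using B2[of v] e by (intro mult_left_mono add_mono) auto
    finally show ?thesis by simp
  qed
  have hE: "hess G F x v w = c1 * mi x v w + c2 * (B (x - x0) v * B (x - x0) w) + E v w" for v w
    by (simp add: E_def)
  have "mix (mi x) (hess G F x) a b = c1 * mix (mi x) (mi x) a b
      + c2 * mix (mi x) (\<lambda>v w. B (x - x0) v * B (x - x0) w) a b + mix (mi x) E a b"
    unfolding mix_def hE by (simp only: algebra_simps)
  moreover have "mix (mi x) (mi x) a b = 2 * gram (mi x) a b" by (simp add: gram_mix)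
  moreover have "(p * (2 * c) + k * M + N) / c - (2 * p + k * (M / c)) = N / c" if "c > 0" for p c k M N :: real
    using that by (simp add: field_simps)
  ultimately have "trace_on (mi x) (hess G F x) a b - (2 * c1 + c2 * \<sigma>)
      = trace_on (mi x) E a b"
    using g unfolding \<sigma>_def by (simp only:)
  moreover have "\<bar>mix (mi x) E a b\<bar> \<le> 2 * (8 * bump_mass * e) * gram (mi x) a b"
    by (rule mix_abs_le[OF bilinear_metric_inner mi_commute[OF x] mi_pos[OF x] bE sE aE ab])
  ultimately have "\<bar>trace_on (mi x) (hess G F x) a b - (2 * c1 + c2 * \<sigma>)\<bar> \<le> 2 * (8 * bump_mass * e)"
    using g by (simp only: abs_divide abs_of_pos pos_divide_le_eq)
  then show "\<bar>trace_on (mi x) (hess G F x) a b - (4 * bump' (q x) + 4 * bump'' (q x) / \<delta>\<^sup>2 * \<sigma>)\<bar>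
      \<le> 16 * bump_mass * e"
    unfolding c1_c2_def by simp
  have lin: "linear (B (x - x0))" using bilinear_metric_inner unfolding bilinear_def by blast
  have l: "(B (x - x0) v)\<^sup>2 \<le> (\<delta>\<^sup>2 * q x / (1 - e)) * mi x v v" for v
  proof -
    have "(B (x - x0) v)\<^sup>2 \<le> B (x - x0) (x - x0) * B v v" by (rule mi_cauchy_schwarz[OF x0])
    also have "\<dots> \<le> B (x - x0) (x - x0) * (mi x v v / (1 - e))"
      by (intro mult_left_mono B mi_nonneg x0)
    finally show ?thesis using \<delta> by (simp add: q_def)
  qed
  note mm = mix_square_bounds[OF bilinear_metric_inner mi_commute[OF x] mi_pos[OF x] lin l ab]
  show "0 \<le> \<sigma>" "\<sigma> \<le> \<delta>\<^sup>2 * q x / (1 - e)"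
    unfolding \<sigma>_def using mm g by (auto simp: divide_le_eq)
qed

text \<open>Closeness of the metrics is asked only for \<open>q x < 1\<close>; elsewhere the bump,
  its differential and its Hessian vanish.\<close>

lemma estimates:
  assumes x: "x \<in> S" and e: "e = exp (- 30)"
    and near: "q x < 1 \<Longrightarrow> (\<forall>v. \<bar>mi x v v - B v v\<bar> \<le> e * B v v) \<and> (\<forall>v. \<bar>B (x - x0) (chr G x v v)\<bar> \<le> e * B v v)"
  shows "trace_osc_le (mi x) (hess G F x) (5/2 * bump_mass)"
    "bounded_form (mi x) (hess G F x) (\<lambda>v. dir_deriv F v x) (7 * bump_mass + 8 * bump_mass\<^sup>2 * \<delta>\<^sup>2)"
proof -
  have nn: "mi x v v \<ge> 0" for v by (rule mi_nonneg[OF x])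
  \<comment> \<open>A crude bound suffices here: 20/9 * 300/299 + 32/300 stays below 5/2.\<close>
  have e': "0 < e" "e \<le> 1/300"
  proof -
    have "(30::real) + 30\<^sup>2 / 2 \<le> exp 30" using exp_lower_Taylor_quadratic[of 30] by simp
    then show "e \<le> 1/300" by (simp add: e exp_minus field_simps)
  qed (simp add: e)
  have inv: "1 / (1 - e) \<le> 300/299" using e' by (simp add: field_simps)
  have "trace_osc_le (mi x) (hess G F x) (5/2 * bump_mass) \<and>
    bounded_form (mi x) (hess G F x) (\<lambda>v. dir_deriv F v x) (7 * bump_mass + 8 * bump_mass\<^sup>2 * \<delta>\<^sup>2)"
  proof (cases "q x < 1")
    case False
    then have "q x \<ge> 1" by simp
    then show ?thesis
      unfolding trace_osc_le_def bounded_form_def using nn by (simp add: F_outside mix_def)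
  next
    case True
    note near' = near[OF True, THEN conjunct1, rule_format] near[OF True, THEN conjunct2, rule_format]
    have e2: "e \<le> 1/2" using e' by simp
    note td = trace_decomposition[OF x e'(1) e2 near']
    \<comment> \<open>20/9 is four times the 5/9 of \<open>bump''_bound\<close>; 300/299 bounds 1 /
      (1 - e).\<close>
    have key: "\<bar>4 * bump'' (q x) / \<delta>\<^sup>2\<bar> * (\<delta>\<^sup>2 * q x / (1 - e)) \<le> 20/9 * bump_mass * (300/299)"
    proof -
      have "\<bar>4 * bump'' (q x) / \<delta>\<^sup>2\<bar> * (\<delta>\<^sup>2 * q x / (1 - e)) = 4 * \<bar>q x * bump'' (q x)\<bar> * (1 / (1 - e))"
      proof -
        have aux: "\<bar>4 * b / d\<bar> * (d * p / c) = 4 * \<bar>p * b\<bar> * (1 / c)" if "d > 0" "p \<ge> 0" for b c d p :: real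
          using that by (simp add: abs_mult)
        show ?thesis by (rule aux) (use \<delta> q_nonneg in auto)
      qed
      also have "\<dots> \<le> 4 * (5/9 * bump_mass) * (300/299)"
        using bump''_bound[OF q_nonneg, of x] inv e' by (intro mult_mono) auto
      finally show ?thesis by simp
    qed
    have osc: "trace_osc_le (mi x) (hess G F x) (5/2 * bump_mass)"
      unfolding trace_osc_le_def
    proof (intro allI impI)
      fix a b a' b' :: "real^'n" assume ab: "indep2 a b" "indep2 a' b'"
      define s where "s = trace_on (mi x) (\<lambda>v w. B (x - x0) v * B (x - x0) w) a b"
      define s' where "s' = trace_on (mi x) (\<lambda>v w. B (x - x0) v * B (x - x0) w) a' b'"
      have "4 * bump'' (q x) / \<delta>\<^sup>2 * (s - s') \<le> \<bar>4 * bump'' (q x) / \<delta>\<^sup>2\<bar> * \<bar>s - s'\<bar>"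
        by (metis abs_ge_self abs_mult)
      also have "\<dots> \<le> \<bar>4 * bump'' (q x) / \<delta>\<^sup>2\<bar> * (\<delta>\<^sup>2 * q x / (1 - e))"
        using td(2,3)[OF ab(1), folded s_def] td(2,3)[OF ab(2), folded s'_def] by (intro mult_left_mono) auto
      also note key
      finally have k: "4 * bump'' (q x) / \<delta>\<^sup>2 * s - 4 * bump'' (q x) / \<delta>\<^sup>2 * s' \<le> 20/9 * bump_mass * (300/299)"
        by (simp add: right_diff_distrib)
      have e32: "32 * bump_mass * e \<le> 32 * bump_mass * (1/300)" using e' by (intro mult_left_mono) auto
      have aux: "t - t' \<le> 5/2 * m"
        if "\<bar>t - (p + u)\<bar> \<le> 16 * m * e" "\<bar>t' - (p + u')\<bar> \<le> 16 * m * e" "u - u' \<le> 20/9 * m * (300/299)"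
          "32 * m * e \<le> 32 * m * (1/300)" "m > 0" for t t' p u u' m
      proof -
        have "t - t' \<le> (u - u') + 32 * m * e" using that(1,2) by linarith
        also have "\<dots> \<le> 20/9 * m * (300/299) + 32 * m * (1/300)" by (rule add_mono[OF that(3,4)])
        also have "\<dots> = (20/9 * (300/299) + 32 / 300) * m" by (simp add: algebra_simps)
        also have "\<dots> \<le> 5/2 * m" using that(5) by (intro mult_right_mono) auto
        finally show ?thesis .
      qed
      show "trace_on (mi x) (hess G F x) a b - trace_on (mi x) (hess G F x) a' b' \<le> 5/2 * bump_mass"
        by (rule aux[OF td(1)[OF ab(1), folded s_def] td(1)[OF ab(2), folded s'_def] k e32]) simp
    qed
    have B2: "B v v \<le> 300/299 * mi x v v" for v
      using near'(1)[of v] e' mult_right_mono[OF e'(2) mi_nonneg[OF x0, of v]] by (simp add: abs_le_iff)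
    have Br: "B (x - x0) (x - x0) = \<delta>\<^sup>2 * q x" using \<delta> by (simp add: q_def)
    have l: "(B (x - x0) v)\<^sup>2 \<le> \<delta>\<^sup>2 * q x * (300/299) * mi x v v" for v
    proof -
      have "(B (x - x0) v)\<^sup>2 \<le> (\<delta>\<^sup>2 * q x) * B v v" using mi_cauchy_schwarz[OF x0, of "x - x0" v] Br by simp
      also have "\<dots> \<le> (\<delta>\<^sup>2 * q x) * (300/299 * mi x v v)"
        by (intro mult_left_mono B2) (simp add: q_nonneg)
      finally show ?thesis by simp
    qed
    \<comment> \<open>The Hessian contributes 2 * 300/299 twice, from the metric and the Christoffel
      term, and 5/2 from the radial part, below 7 in all. The squared differential contributes 4 *
      300/299 * q, below 8.\<close>
    have "bounded_form (mi x) (hess G F x) (\<lambda>v. dir_deriv F v x) (7 * bump_mass + 8 * bump_mass\<^sup>2 * \<delta>\<^sup>2)"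
      unfolding bounded_form_def
    proof (intro conjI allI)
      fix v
      have m1: "\<bar>bump' (q x)\<bar> \<le> bump_mass" by (rule bump'_bound[OF q_nonneg])
      have "\<bar>hess G F x v v\<bar> \<le> 2 * \<bar>bump' (q x)\<bar> * B v v + \<bar>4 * bump'' (q x) / \<delta>\<^sup>2\<bar> * (B (x - x0) v)\<^sup>2
          + 2 * \<bar>bump' (q x)\<bar> * \<bar>B (x - x0) (chr G x v v)\<bar>"
      proof -
        have "\<bar>a + b - c\<bar> \<le> \<bar>a\<bar> + \<bar>b\<bar> + \<bar>c\<bar>" for a b c :: real by simp
        from this[of "2 * bump' (q x) * B v v" "4 * bump'' (q x) / \<delta>\<^sup>2 * (B (x - x0) v)\<^sup>2" "2 * bump' (q x) * B (x - x0) (chr G x v v)"]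
        show ?thesis unfolding hess_F using mi_nonneg[OF x0, of v] by (simp add: abs_mult power2_eq_square)
      qed
      also have "\<dots> \<le> 2 * bump_mass * (300/299 * mi x v v) + 5/2 * bump_mass * mi x v v
          + 2 * bump_mass * (300/299 * mi x v v)"
      proof (intro add_mono)
        show "2 * \<bar>bump' (q x)\<bar> * B v v \<le> 2 * bump_mass * (300/299 * mi x v v)"
          using m1 mi_nonneg[OF x0] by (intro mult_mono B2) auto
        have "\<bar>B (x - x0) (chr G x v v)\<bar> \<le> e * B v v" by (rule near'(2))
        also have "\<dots> \<le> 1 * B v v" using e' mi_nonneg[OF x0] by (intro mult_right_mono) auto
        finally have "\<bar>B (x - x0) (chr G x v v)\<bar> \<le> 300/299 * mi x v v" using B2[of v] by simp
        then show "2 * \<bar>bump' (q x)\<bar> * \<bar>B (x - x0) (chr G x v v)\<bar> \<le> 2 * bump_mass * (300/299 * mi x v v)"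
          using m1 by (intro mult_mono) auto
        have "\<bar>4 * bump'' (q x) / \<delta>\<^sup>2\<bar> * (B (x - x0) v)\<^sup>2 \<le> \<bar>4 * bump'' (q x) / \<delta>\<^sup>2\<bar> * (\<delta>\<^sup>2 * q x * (300/299) * mi x v v)"
          by (intro mult_left_mono l) auto
        also have "\<dots> = 4 * \<bar>q x * bump'' (q x)\<bar> * (300/299 * mi x v v)"
          using \<delta> q_nonneg[of x] by (simp add: abs_mult field_simps)
        also have "\<dots> \<le> 4 * (5/9 * bump_mass) * (300/299 * mi x v v)"
          using bump''_bound[OF q_nonneg, of x] nn by (intro mult_right_mono mult_left_mono) auto
        also have "\<dots> = 4 * (5/9) * (300/299) * (bump_mass * mi x v v)" by simp
        also have "\<dots> \<le> 5/2 * (bump_mass * mi x v v)" using nn[of v] by (intro mult_right_mono) auto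
        finally show "\<bar>4 * bump'' (q x) / \<delta>\<^sup>2\<bar> * (B (x - x0) v)\<^sup>2 \<le> 5/2 * bump_mass * mi x v v" by (simp only: mult.assoc)
      qed
      also have "\<dots> = (2 * (300/299) + 5/2 + 2 * (300/299)) * (bump_mass * mi x v v)" by (simp add: algebra_simps)
      also have "\<dots> \<le> 7 * (bump_mass * mi x v v)" using nn[of v] by (intro mult_right_mono) auto
      also have "\<dots> \<le> (7 * bump_mass + 8 * bump_mass\<^sup>2 * \<delta>\<^sup>2) * mi x v v"
        using nn[of v] by (simp add: distrib_right)
      finally show "\<bar>hess G F x v v\<bar> \<le> (7 * bump_mass + 8 * bump_mass\<^sup>2 * \<delta>\<^sup>2) * mi x v v" .
      have "(dir_deriv F v x)\<^sup>2 = 4 * \<bar>bump' (q x)\<bar>\<^sup>2 * (B (x - x0) v)\<^sup>2" unfolding dF by (simp add: power_mult_distrib)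
      also have "\<dots> \<le> 4 * bump_mass\<^sup>2 * (\<delta>\<^sup>2 * q x * (300/299) * mi x v v)"
        using power_mono[OF m1, of 2] by (intro mult_mono l) simp_all
      also have "\<dots> = 4 * (300/299) * q x * (bump_mass\<^sup>2 * \<delta>\<^sup>2 * mi x v v)" by simp
      also have "\<dots> \<le> 8 * (bump_mass\<^sup>2 * \<delta>\<^sup>2 * mi x v v)"
        using nn[of v] True by (intro mult_right_mono) auto
      also have "\<dots> \<le> (7 * bump_mass + 8 * bump_mass\<^sup>2 * \<delta>\<^sup>2) * mi x v v"
        using nn[of v] by (simp add: distrib_right)
      finally show "(dir_deriv F v x)\<^sup>2 \<le> (7 * bump_mass + 8 * bump_mass\<^sup>2 * \<delta>\<^sup>2) * mi x v v" .
    qed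
    with osc show ?thesis by blast
  qed
  then show "trace_osc_le (mi x) (hess G F x) (5/2 * bump_mass)"
    "bounded_form (mi x) (hess G F x) (\<lambda>v. dir_deriv F v x) (7 * bump_mass + 8 * bump_mass\<^sup>2 * \<delta>\<^sup>2)" by blast+
qed

text \<open>At \<open>q x = 1/2\<close> the profile has \<open>bump''\<close> positive, so the plane
  containing the radial direction has a larger trace than one orthogonal to it, where
  \<open>\<sigma>\<close> is 0.\<close>

lemma trace_gap:
  assumes x: "x \<in> S" and e: "e = exp (- 30)" and q: "q x = 1/2"
    and near: "\<And>v. \<bar>mi x v v - B v v\<bar> \<le> e * B v v" "\<And>v. \<bar>B (x - x0) (chr G x v v)\<bar> \<le> e * B v v"
    and ab: "indep2 (x - x0) b" "indep2 b c" and B0: "B (x - x0) b = 0" "B (x - x0) c = 0"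
  shows "trace_on (mi x) (hess G F x) b c
    < trace_on (mi x) (hess G F x) (x - x0) b"
proof -
  define r where "r = x - x0"
  have e': "0 < e" "e \<le> 1/2"
  proof -
    have "(2::real) \<le> exp 30" using exp_ge_add_one_self[of 30] by simp
    then show "e \<le> 1/2" by (simp add: e exp_minus field_simps)
  qed (simp add: e)
  note td = trace_decomposition[OF x e' near]
  define s where "s = trace_on (mi x) (\<lambda>v w. B r v * B r w) r b"
  have g: "gram (mi x) r b > 0" using gram_mi_pos[OF x] ab(1) by (simp add: r_def)
  have Br: "B r r = \<delta>\<^sup>2 / 2" using q \<delta> by (simp add: q_def r_def field_simps)
  have rr: "mi x r r > 0"
    using mi_pos[OF x, of r] ab(1)[unfolded indep2_def, rule_format, of 1 0] by (auto simp: r_def)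
  \<comment> \<open>With \<open>B r r\<close> half of the squared radius, this factor 3/2 is the
    source of the lower bound by one third of the squared radius for \<open>s\<close>.\<close>
  have "mi x r r \<le> 3/2 * (\<delta>\<^sup>2 / 2)"
  proof -
    have "mi x r r \<le> B r r + e * B r r" using near(1)[of r] by (simp add: abs_le_iff)
    moreover have "e * B r r \<le> 1/2 * B r r" using e' mi_nonneg[OF x0] by (intro mult_right_mono) auto
    ultimately show ?thesis using Br by simp
  qed
  have "\<delta>\<^sup>2 / 3 \<le> (B r r)\<^sup>2 / mi x r r"
  proof -
    have "(B r r)\<^sup>2 = (\<delta>\<^sup>2 / 3) * (3/2 * (\<delta>\<^sup>2 / 2))" unfolding Br by (simp add: power2_eq_square)
    also have "\<dots> \<ge> (\<delta>\<^sup>2 / 3) * mi x r r" by (intro mult_left_mono) (fact, simp)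
    finally show ?thesis using rr by (simp add: pos_le_divide_eq)
  qed
  also have "\<dots> \<le> s"
  proof -
    have bb: "mi x b b \<ge> 0" by (rule mi_nonneg[OF x])
    have m: "mix (mi x) (\<lambda>v w. B r v * B r w) r b = mi x b b * (B r r)\<^sup>2"
      unfolding mix_def using B0 by (simp add: r_def power2_eq_square)
    have "gram (mi x) r b * (B r r)\<^sup>2 \<le> (mi x r r * mi x b b) * (B r r)\<^sup>2"
      by (intro mult_right_mono) (auto simp: gram_def)
    then show ?thesis unfolding s_def m using rr g by (simp add: divide_simps mult_ac)
  qed
  finally have s: "\<delta>\<^sup>2 / 3 \<le> s" .
  have "4 * bump'' (q x) / \<delta>\<^sup>2 * s \<ge> 4 * bump'' (q x) / \<delta>\<^sup>2 * (\<delta>\<^sup>2 / 3)"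
    by (intro mult_left_mono s) (simp add: q bump''_half)
  then have s2: "4 * bump'' (q x) / \<delta>\<^sup>2 * s \<ge> 18560 * exp (- 60)"
    using \<delta> by (simp add: q bump''_half)
  have z: "mix (mi x) (\<lambda>v w. B (x - x0) v * B (x - x0) w) b c = 0"
    using B0 by (simp add: mix_def)
  have "exp (- 30) * exp (- 30) = exp (- 60 :: real)" by (simp add: mult_exp_exp)
  then have "2 * (16 * bump_mass * e) = 960 * exp (- 60)" unfolding e by simp
  \<comment> \<open>The errors of the two traces together are 960 exp(-60), against a main term of
    4/3 * 13920 exp(-60) = 18560 exp(-60).\<close>
  then have small: "2 * (16 * bump_mass * e) < 18560 * exp (- 60)" by simp
  have aux: "t' < t" if "\<bar>t - (p + u)\<bar> \<le> w" "\<bar>t' - (p + k * (0 / c))\<bar> \<le> w" "y \<le> u" "2 * w < y"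
    for t t' p u w k c y :: real
    using that by (simp add: abs_le_iff)
  show ?thesis
    by (rule aux[OF td(1)[OF ab(1)] td(1)[OF ab(2), unfolded z] s2[unfolded s_def r_def] small])
qed

end

text \<open>Collects what the global argument uses: uniform bounds on the whole chart, the exact
  Hessian at the center \<open>x0\<close>, two planes of different trace at \<open>x1\<close>, and a
  point \<open>x2\<close> where the bump vanishes with its derivatives up to second order.\<close>

lemma (in local_metric) local_bump:
  assumes x0: "x0 \<in> S" and card: "CARD('n) \<ge> 3"
  shows "\<exists>F K C M x1 a b a' b' x2. smooth_on UNIV F \<and> compact K \<and> K \<subseteq> S \<and> (\<forall>y. y \<notin> K \<longrightarrow> F y = 0) \<and>
    (\<forall>y. 0 \<le> F y) \<and> (\<forall>y. F y \<le> M) \<and> C > 0 \<and>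
    (\<forall>x\<in>S. trace_osc_le (mi x) (hess G F x) (5/2 * bump_mass)) \<and>
    (\<forall>x\<in>S. bounded_form (mi x) (hess G F x) (\<lambda>v. dir_deriv F v x) C) \<and>
    (\<forall>v. dir_deriv F v x0 = 0) \<and> (\<forall>v w. hess G F x0 v w = - 2 * bump_mass * mi x0 v w) \<and>
    x1 \<in> S \<and> indep2 a b \<and> indep2 a' b' \<and>
    trace_on (mi x1) (hess G F x1) a' b' < trace_on (mi x1) (hess G F x1) a b \<and>
    x2 \<in> S \<and> F x2 = 0 \<and> (\<forall>v. dir_deriv F v x2 = 0) \<and> (\<forall>v w. hess G F x2 v w = 0)"
proof -
  \<comment> \<open>Errors are of order \<open>bump_mass * e\<close>; this choice makes them
    multiples of exp(-60), like \<open>bump'' (1/2)\<close>, so that \<open>trace_gap\<close>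
    compares plain numbers.\<close>
  define e where "e = exp (- 30 :: real)"
  have e: "e > 0" by (simp add: e_def)
  obtain l where l: "l > 0" "\<And>v. l * (norm v)\<^sup>2 \<le> mi x0 v v" using mi_coercive[OF x0] by blast
  have "\<forall>\<^sub>F x in nhds x0. (x \<in> S \<and> (\<forall>v. \<bar>mi x v v - mi x0 v v\<bar> \<le> e * mi x0 v v)) \<and>
      (\<forall>v. \<bar>mi x0 (x - x0) (chr G x v v)\<bar> \<le> e * mi x0 v v)"
    by (rule eventually_conj[OF mi_near[OF x0 e] chr_near[OF x0 e]])
  then obtain h where h: "h > 0" and near: "\<And>x. dist x x0 < h \<Longrightarrow> (x \<in> S \<and> (\<forall>v. \<bar>mi x v v - mi x0 v v\<bar> \<le> e * mi x0 v v)) \<and>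
      (\<forall>v. \<bar>mi x0 (x - x0) (chr G x v v)\<bar> \<le> e * mi x0 v v)"
    unfolding eventually_nhds_metric by blast
  \<comment> \<open>Chosen so that \<open>q x \<le> 4\<close> forces \<open>x\<close> into the ball
    of radius \<open>h / 2\<close>. The bound 4 instead of 1 leaves room in the chart for a point
    outside the support.\<close>
  define d where "d = sqrt l * h / 4"
  have d: "d > 0" using l h by (simp add: d_def)
  have d2: "4 * d\<^sup>2 = l * (h / 2)\<^sup>2" using l by (simp add: d_def power_mult_distrib power_divide)
  interpret bump_function S G x0 d by unfold_locales (fact x0, fact d)
  have close: "norm (x - x0) \<le> h / 2" if "q x \<le> 4" for x
  proof -
    have "l * (norm (x - x0))\<^sup>2 \<le> 4 * d\<^sup>2" using l(2)[of "x - x0"] that d by (simp add: q_def field_simps)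
    then have "(norm (x - x0))\<^sup>2 \<le> (h / 2)\<^sup>2" using l(1) unfolding d2 by simp
    then show ?thesis by (rule power2_le_imp_le) (use h in simp)
  qed
  have closeS: "dist x x0 < h" if "q x \<le> 4" for x using close[OF that] h by (simp add: dist_norm)
  define z :: "real^'n" where "z = axis undefined 1"
  have z: "B z z > 0" by (rule mi_pos[OF x0]) (simp add: z_def axis_eq_0_iff)
  \<comment> \<open>A ray from \<open>x0\<close> parametrized by the value of
    \<open>q\<close>.\<close>
  define pt where "pt t = x0 + (sqrt t * d / sqrt (B z z)) *\<^sub>R z" for t
  have qpt: "q (pt t) = t" if "t \<ge> 0" for t
  proof -
    have "B (c *\<^sub>R z) (c *\<^sub>R z) = c\<^sup>2 * B z z" for c
      by (simp only: bilinear_lmul[OF bilinear_metric_inner] bilinear_rmul[OF bilinear_metric_inner]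
          real_scaleR_def power2_eq_square mult.assoc)
    then have "q (pt t) = (sqrt t * d / sqrt (B z z))\<^sup>2 * B z z / d\<^sup>2" by (simp add: q_def pt_def)
    then show ?thesis using that z d by (simp add: power_mult_distrib power_divide)
  qed
  define x1 where "x1 = pt (1/2)"
  define x2 where "x2 = pt 4"
  have q1: "q x1 = 1/2" and q2: "q x2 = 4" using qpt[of "1/2"] qpt[of 4] by (simp_all add: x1_def x2_def)
  have x1: "x1 \<in> S" and x2: "x2 \<in> S" using near[OF closeS[of x1]] near[OF closeS[of x2]] q1 q2 by auto
  define r where "r = x1 - x0"
  have Brr: "B r r > 0" using q1 zero_less_power[OF d, of 2] by (simp add: q_def r_def field_simps)
  define u where "u = G x0 *v r"
  have Bu: "B r v = u \<bullet> v" for v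
    unfolding mi_commute[OF x0, of r] by (simp add: u_def metric_inner_def inner_commute)
  have u: "u \<noteq> 0" using Brr Bu[of r] by auto
  have "2 \<le> dim {v. u \<bullet> v = 0}" using dim_hyperplane[OF u] card by simp
  then obtain T where T: "subspace T" "T \<subseteq> span {v. u \<bullet> v = 0}" "dim T = 2"
    using choose_subspace_of_subspace by blast
  then obtain b c where bc: "indep2 b c" "T = span {b, c}"
    using two_planes_span[of T] by (auto simp: two_planes_def)
  have "span {v. u \<bullet> v = 0} = {v. u \<bullet> v = 0}" by (simp add: span_eq_iff subspace_hyperplane)
  then have "b \<in> {v. u \<bullet> v = 0}" "c \<in> {v. u \<bullet> v = 0}" using T(2) bc(2) by (metis in_mono insertCI span_base)+
  then have B0: "B r b = 0" "B r c = 0" by (simp_all add: Bu)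
  have ind: "indep2 r b"
    unfolding indep2_def
  proof (intro allI impI)
    fix s t assume st: "s *\<^sub>R r + t *\<^sub>R b = 0"
    have "B r (s *\<^sub>R r + t *\<^sub>R b) = s * B r r"
      by (simp add: bilinear_radd[OF bilinear_metric_inner] bilinear_rmul[OF bilinear_metric_inner] B0)
    then have "s = 0" using st Brr by (simp add: bilinear_rzero[OF bilinear_metric_inner])
    moreover have "b \<noteq> 0" using bc(1)[unfolded indep2_def, rule_format, of 1 0] by auto
    ultimately show "s = 0 \<and> t = 0" using st by simp
  qed
  have near1: "\<bar>mi x1 v v - B v v\<bar> \<le> e * B v v" "\<bar>B (x1 - x0) (chr G x1 v v)\<bar> \<le> e * B v v" for v
    using near[OF closeS[of x1]] q1 by auto
  show ?thesis
  proof (rule exI[of _ F], rule exI[of _ "cball x0 (h / 2)"], rule exI[of _ "7 * bump_mass + 8 * bump_mass\<^sup>2 * d\<^sup>2"],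
      rule exI[of _ "d\<^sup>2"], rule exI[of _ x1], rule exI[of _ r], rule exI[of _ b], rule exI[of _ b],
      rule exI[of _ c], rule exI[of _ x2], intro conjI allI impI ballI)
    show "smooth_on UNIV F" by (rule smooth_F)
    show "compact (cball x0 (h / 2))" by simp
    show "cball x0 (h / 2) \<subseteq> S" using near h by (force simp: dist_commute)
    show "F y = 0" if "y \<notin> cball x0 (h / 2)" for y
    proof (rule F_outside(1))
      show "q y \<ge> 1" using close[of y] that by (force simp: dist_norm norm_minus_commute)
    qed
    show "0 \<le> F y" for y using bump_0_bounds(1) by (simp add: F_def)
    show "F y \<le> d\<^sup>2" for y using bump_0_bounds(2)[of "q y"] by (simp add: F_def mult_left_le)
    show "7 * bump_mass + 8 * bump_mass\<^sup>2 * d\<^sup>2 > 0" by (intro add_pos_nonneg) auto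
    fix x assume x: "x \<in> S"
    have nx: "(\<forall>v. \<bar>mi x v v - B v v\<bar> \<le> e * B v v) \<and> (\<forall>v. \<bar>B (x - x0) (chr G x v v)\<bar> \<le> e * B v v)" if "q x < 1"
      using near[OF closeS[of x]] that by simp
    show "trace_osc_le (mi x) (hess G F x) (5/2 * bump_mass)"
      "bounded_form (mi x) (hess G F x) (\<lambda>v. dir_deriv F v x) (7 * bump_mass + 8 * bump_mass\<^sup>2 * d\<^sup>2)"
      using estimates[OF x e_def nx] by blast+
  next
    show "dir_deriv F v x0 = 0" "hess G F x0 v w = - 2 * bump_mass * B v w" for v w by (rule F_center)+
    show "trace_on (mi x1) (hess G F x1) b c < trace_on (mi x1) (hess G F x1) r b"
      using trace_gap[OF x1 e_def q1 near1 _ bc(1)] ind B0 by (simp add: r_def)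
    show "F x2 = 0" "dir_deriv F v x2 = 0" "hess G F x2 v w = 0" for v w
      by (simp_all add: F_outside q2)
  qed (fact x1, fact ind, fact bc(1), fact x2)
qed

section \<open>Curvature of the deformed metric in a chart\<close>

text \<open>\<open>conformal_sec\<close> with the factor expanded in \<open>\<epsilon>\<close>.
  \<open>N\<close> is the squared gradient length of \<open>f\<close>; quantifying it before the
  planes records that it cancels when two planes at \<open>x\<close> are compared.\<close>

lemma (in local_metric) curvature_deformed:
  assumes f: "smooth_on S f" "\<And>x. x \<in> S \<Longrightarrow> f x \<ge> 0" and eps: "\<epsilon> > 0"
    and hyp: "\<And>a b. indep2 a b \<Longrightarrow> sec G x a b = - 1" and x: "x \<in> S"
    and bf: "bounded_form (mi x) (hess G f x) (\<lambda>v. dir_deriv f v x) C"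
  defines "\<rho> \<equiv> 1 + \<epsilon> * f x" and "\<tau> \<equiv> \<lambda>a b. trace_on (mi x) (hess G f x) a b"
    and "\<theta> \<equiv> \<lambda>a b. trace_on (mi x) (\<lambda>v w. dir_deriv f v x * dir_deriv f w x) a b"
  shows "\<exists>N. (\<forall>a b. indep2 a b \<longrightarrow> sec (\<lambda>y. (1 + \<epsilon> * f y) *\<^sub>R G y) x a b
      = - (1 + \<epsilon> * \<tau> a b / (2 * \<rho>) - 3 * \<epsilon>\<^sup>2 * \<theta> a b / (4 * \<rho>\<^sup>2) + \<epsilon>\<^sup>2 * N / (4 * \<rho>\<^sup>2)) / \<rho>) \<and>
    0 \<le> N \<and> N \<le> C \<and> ((\<forall>v. dir_deriv f v x = 0) \<longrightarrow> N = 0) \<and>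
    (\<forall>a b. indep2 a b \<longrightarrow> 0 \<le> \<theta> a b \<and> \<theta> a b \<le> C \<and> \<bar>\<tau> a b\<bar> \<le> 2 * C)"
proof -
  let ?r = "\<lambda>y. 1 + \<epsilon> * f y"
  have fd: "f differentiable (at y)" if "y \<in> S" for y by (rule smooth_on_differentiable[OF f(1) that])
  have sm: "smooth_on S ?r"
    by (rule smooth_on_add[OF open_S smooth_on_const[OF open_S] smooth_on_mult[OF open_S smooth_on_const[OF open_S] f(1)]])
  interpret c: conformal_change S G ?r
    by unfold_locales (use sm f(2) eps in \<open>auto intro: add_pos_nonneg\<close>)
  have dr: "dir_deriv ?r v y = \<epsilon> * dir_deriv f v y" if "y \<in> S" for v y
    using fd[OF that] by (simp add: dir_deriv_add dir_deriv_mult differentiable_mult)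
  have ddr: "dir_deriv (dir_deriv ?r v) w x = \<epsilon> * dir_deriv (dir_deriv f v) w x" for v w
  proof -
    have "dir_deriv (dir_deriv ?r v) w x = dir_deriv (\<lambda>y. \<epsilon> * dir_deriv f v y) w x"
      by (rule dir_deriv_cong_open[OF open_S x dr])
    then show ?thesis
      by (simp add: dir_deriv_mult smooth_on_differentiable[OF smooth_on_dir_deriv[OF open_S f(1)] x])
  qed
  have hr: "hess G ?r x = (\<lambda>v w. \<epsilon> * hess G f x v w)"
    by (intro ext) (simp add: hess_def ddr dr[OF x] right_diff_distrib)
  obtain X where X: "\<And>v. mi x X v = dir_deriv f v x" using gradient_exists[OF fd[OF x] x] by blast
  define N where "N = mi x X X"
  have X': "mi x (\<epsilon> *\<^sub>R X) v = dir_deriv ?r v x" for v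
    by (simp add: bilinear_lmul[OF bilinear_metric_inner] X dr[OF x])
  have mm: "mix (mi x) (\<lambda>v w. \<epsilon> * dir_deriv f v x * (\<epsilon> * dir_deriv f w x)) a b
      = \<epsilon>\<^sup>2 * mix (mi x) (\<lambda>v w. dir_deriv f v x * dir_deriv f w x) a b"
    "mix (mi x) (\<lambda>v w. \<epsilon> * hess G f x v w) a b = \<epsilon> * mix (mi x) (hess G f x) a b" for a b
    by (simp_all add: mix_def algebra_simps power2_eq_square)
  have mX: "mi x (\<epsilon> *\<^sub>R X) (\<epsilon> *\<^sub>R X) = \<epsilon>\<^sup>2 * N"
    by (simp add: metric_inner_linear N_def power2_eq_square)
  have G': "c.G' = (\<lambda>y. ?r y *\<^sub>R G y)" by (rule ext) (simp add: c.G'_def)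
  have lin: "linear (\<lambda>v. dir_deriv f v x)" by (rule dir_deriv_linear[OF fd[OF x]])
  have H: "\<bar>hess G f x v v\<bar> \<le> C * mi x v v" and W: "(dir_deriv f v x)\<^sup>2 \<le> C * mi x v v" for v
    using bf by (auto simp: bounded_form_def)
  show ?thesis
  proof (rule exI[of _ N], intro conjI allI impI)
    show "N \<ge> 0" unfolding N_def by (rule mi_nonneg[OF x])
    \<comment> \<open>Apply the bound on the differential to the gradient itself: the square of
      \<open>N\<close> is at most \<open>C * N\<close>.\<close>
    show "N \<le> C"
    proof (cases "X = 0")
      case False
      then have "N > 0" unfolding N_def by (rule mi_pos[OF x])
      moreover have "N\<^sup>2 \<le> C * N" using W[of X] X[of X] by (simp add: N_def)
      ultimately show ?thesis by (simp add: power2_eq_square)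
    next
      case True
      have "0 \<le> C * mi x z z" for z by (rule order_trans[OF zero_le_power2 W])
      from this[of "axis undefined 1"] have "C \<ge> 0"
        using mi_pos[OF x, of "axis undefined 1"] by (simp add: axis_eq_0_iff zero_le_mult_iff)
      then show ?thesis using True by (simp add: N_def metric_inner_def)
    qed
    show "N = 0" if "\<forall>v. dir_deriv f v x = 0" using X[of X] that by (simp add: N_def)
    fix a b :: "real^'n" assume ab: "indep2 a b"
    have g: "gram (mi x) a b > 0" by (rule gram_mi_pos[OF x ab])
    note ms = mix_square_bounds[OF bilinear_metric_inner mi_commute[OF x] mi_pos[OF x] lin W ab]
    show "0 \<le> \<theta> a b" "\<theta> a b \<le> C" unfolding \<theta>_def using ms g by (auto simp: divide_le_eq)
    have "\<bar>mix (mi x) (hess G f x) a b\<bar> \<le> 2 * C * gram (mi x) a b"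
      by (rule mix_abs_le[OF bilinear_metric_inner mi_commute[OF x] mi_pos[OF x] bilinear_hess[OF f(1) x] hess_commute[OF f(1) x] H ab])
    then show "\<bar>\<tau> a b\<bar> \<le> 2 * C" unfolding \<tau>_def using g by (simp add: abs_divide divide_le_eq)
    have aux: "(1 / r) * (- 1 - e * t / d / (2 * r) + 3 / (4 * r\<^sup>2) * (e\<^sup>2 * w / d) - e\<^sup>2 * N / (4 * r\<^sup>2))
      = - (1 + e * (t / d) / (2 * r) - 3 * e\<^sup>2 * (w / d) / (4 * r\<^sup>2) + e\<^sup>2 * N / (4 * r\<^sup>2)) / r" for r e t d w N :: real
      by (simp add: algebra_simps diff_divide_distrib add_divide_distrib)
    show "sec (\<lambda>y. (1 + \<epsilon> * f y) *\<^sub>R G y) x a b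
      = - (1 + \<epsilon> * \<tau> a b / (2 * \<rho>) - 3 * \<epsilon>\<^sup>2 * \<theta> a b / (4 * \<rho>\<^sup>2) + \<epsilon>\<^sup>2 * N / (4 * \<rho>\<^sup>2)) / \<rho>"
      using c.conformal_sec[OF x X' ab]
      unfolding G' hr dr[OF x] mm mX hyp[OF ab] \<tau>_def \<theta>_def \<rho>_def aux .
  qed
qed

section \<open>Greatest pinching constants\<close>

text \<open>The greatest constant is the square root of the infimum of the curvature ratios. A
  positive lower bound makes it positive; the ratio 1, of a plane with itself, keeps it at most
  1.\<close>

lemma greatest_pinching:
  assumes R: "(1::real) \<in> R" and r0: "r0 > 0" "\<And>r. r \<in> R \<Longrightarrow> r0 \<le> r"
  shows "\<exists>a. is_greatest {b \<in> {0<..1}. \<forall>r\<in>R. r \<ge> b\<^sup>2} a \<and> 0 < a \<and> a \<le> 1 \<and>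
    (\<forall>t. (\<forall>r\<in>R. t \<le> r) \<longrightarrow> t \<le> a\<^sup>2) \<and> (\<forall>r\<in>R. a\<^sup>2 \<le> r)"
proof -
  have bdd: "bdd_below R" using r0(2) by (auto simp: bdd_below_def)
  have ne: "R \<noteq> {}" using R by auto
  define a where "a = sqrt (Inf R)"
  have I: "r0 \<le> Inf R" using r0(2) ne by (intro cInf_greatest) auto
  have a2: "a\<^sup>2 = Inf R" using I r0(1) by (simp add: a_def)
  have le: "a\<^sup>2 \<le> r" if "r \<in> R" for r unfolding a2 by (rule cInf_lower[OF that bdd])
  have ge: "t \<le> a\<^sup>2" if "\<And>r. r \<in> R \<Longrightarrow> t \<le> r" for t unfolding a2 by (rule cInf_greatest[OF ne that])
  have pos: "a > 0" using I r0(1) by (simp add: a_def)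
  have le1: "a \<le> 1" using le[OF R] pos by (simp add: power_le_one_iff)
  have "is_greatest {b \<in> {0<..1}. \<forall>r\<in>R. r \<ge> b\<^sup>2} a"
    unfolding is_greatest_def
  proof (intro conjI ballI)
    show "a \<in> {b \<in> {0<..1}. \<forall>r\<in>R. r \<ge> b\<^sup>2}" using pos le1 le by auto
    fix b assume b: "b \<in> {b \<in> {0<..1}. \<forall>r\<in>R. r \<ge> b\<^sup>2}"
    then have "b\<^sup>2 \<le> a\<^sup>2" by (intro ge) auto
    then show "b \<le> a" by (rule power2_le_imp_le) (use pos in simp)
  qed
  then show ?thesis using pos le1 ge le by blast
qed

section \<open>Conformal deformations on a manifold\<close>

lemma hess_cong_open:
  assumes S: "open S" "x \<in> S" and eq: "\<And>y. y \<in> S \<Longrightarrow> f y = h y"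
  shows "hess G f x = hess G h x"
proof (intro ext)
  fix v w
  have "dir_deriv f v y = dir_deriv h v y" if "y \<in> S" for v y
    by (rule dir_deriv_cong_open[OF S(1) that eq])
  then show "hess G f x v w = hess G h x v w"
    unfolding hess_def using dir_deriv_cong_open[OF S, of "dir_deriv f v" "dir_deriv h v"] S(2) by simp
qed

locale manifold_metric =
  fixes A :: "('m::{t2_space, second_countable_topology}, 'n::finite) chart set" and g :: "('m, 'n) tensor2"
  assumes atlas: "smooth_atlas A" and metric: "riemannian_metric A g"
begin

lemma chart:
  assumes "c \<in> A"
  shows "open (fst c)" "open (chart_image c)" "homeomorphism (fst c) (chart_image c) (snd c) (chart_inv c)"
  using assms atlas by (auto simp: smooth_atlas_def is_chart_def)

lemma chart_inv_in: "c \<in> A \<Longrightarrow> x \<in> chart_image c \<Longrightarrow> chart_inv c x \<in> fst c"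
  using homeomorphism_image2[OF chart(3)] by blast

lemma chart_chart_inv: "c \<in> A \<Longrightarrow> x \<in> chart_image c \<Longrightarrow> snd c (chart_inv c x) = x"
  using homeomorphism_apply2[OF chart(3)] by blast

lemma chart_inv_chart: "c \<in> A \<Longrightarrow> p \<in> fst c \<Longrightarrow> chart_inv c (snd c p) = p"
  using homeomorphism_apply1[OF chart(3)] by blast

lemma chart_in: "p \<in> fst c \<Longrightarrow> snd c p \<in> chart_image c"
  by (simp add: chart_image_def)

lemma cont_chart_inv: "c \<in> A \<Longrightarrow> continuous_on (chart_image c) (chart_inv c)"
  using homeomorphism_cont2[OF chart(3)] .

text \<open>The preimage form reduces openness of overlaps to continuity of the inverse
  chart.\<close>

lemma overlap_eq: "c \<in> A \<Longrightarrow> overlap c d = chart_image c \<inter> chart_inv c -` fst d"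
proof (intro set_eqI iffI)
  fix x assume c: "c \<in> A"
  { assume "x \<in> overlap c d"
    then obtain p where p: "p \<in> fst c" "p \<in> fst d" "x = snd c p" by (auto simp: overlap_def)
    then show "x \<in> chart_image c \<inter> chart_inv c -` fst d"
      using chart_in[OF p(1)] chart_inv_chart[OF c p(1)] by simp }
  { assume "x \<in> chart_image c \<inter> chart_inv c -` fst d"
    then have x: "x \<in> chart_image c" "chart_inv c x \<in> fst d" by auto
    then show "x \<in> overlap c d" unfolding overlap_def
      using chart_inv_in[OF c x(1)] chart_chart_inv[OF c x(1)] by (intro image_eqI[of _ _ "chart_inv c x"]) auto }
qed

lemma open_overlap: "c \<in> A \<Longrightarrow> d \<in> A \<Longrightarrow> open (overlap c d)"
  unfolding overlap_eq by (rule continuous_open_preimage[OF cont_chart_inv chart(2) chart(1)])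

lemma transition_in: "c \<in> A \<Longrightarrow> x \<in> overlap c d \<Longrightarrow> transition c d x \<in> chart_image d"
  unfolding overlap_eq transition_def by (auto intro: chart_in)

lemma inv_transition: "c \<in> A \<Longrightarrow> d \<in> A \<Longrightarrow> x \<in> overlap c d \<Longrightarrow> chart_inv d (transition c d x) = chart_inv c x"
  unfolding overlap_eq transition_def by (auto intro: chart_inv_chart)

lemma smooth_transition: "c \<in> A \<Longrightarrow> d \<in> A \<Longrightarrow> smooth_on (overlap c d) (transition c d)"
  using atlas by (auto simp: smooth_atlas_def)

lemma metric_transition: "c \<in> A \<Longrightarrow> d \<in> A \<Longrightarrow> x \<in> overlap c d \<Longrightarrow>
  g c x = transpose (matrix (frechet_derivative (transition c d) (at x))) ** g d (transition c d x)
    ** matrix (frechet_derivative (transition c d) (at x))"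
  using metric unfolding riemannian_metric_def Let_def by blast

lemma local_metric_chart: "c \<in> A \<Longrightarrow> local_metric (chart_image c) (g c)"
  using metric chart(2) by unfold_locales (auto simp: riemannian_metric_def)

definition smooth_function :: "('m \<Rightarrow> real) \<Rightarrow> bool" where
  "smooth_function f \<longleftrightarrow> (\<forall>c\<in>A. smooth_on (chart_image c) (\<lambda>x. f (chart_inv c x)))"

text \<open>The factor is a function on the manifold, not on a chart: its value at a point agrees in
  all charts, so the transformation law is inherited from \<open>g\<close>.\<close>

definition conf :: "('m \<Rightarrow> real) \<Rightarrow> ('m, 'n) tensor2" where
  "conf r = (\<lambda>c x. r (chart_inv c x) *\<^sub>R g c x)"

lemma riemannian_conf:
  assumes r: "smooth_function r" "\<And>p. r p > 0"
  shows "riemannian_metric A (conf r)"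
  unfolding riemannian_metric_def
proof (intro conjI allI impI ballI)
  fix c x assume "c \<notin> A \<or> x \<notin> chart_image c"
  then have "g c x = 0" using metric unfolding riemannian_metric_def by blast
  then show "conf r c x = 0" by (simp add: conf_def)
next
  fix c assume c: "c \<in> A"
  interpret local_metric "chart_image c" "g c" by (rule local_metric_chart[OF c])
  show "smooth_on (chart_image c) (conf r c)"
    unfolding conf_def using r(1) c by (intro smooth_on_scaleR open_S smooth_G) (simp add: smooth_function_def)
  fix x assume x: "x \<in> chart_image c"
  show "transpose (conf r c x) = conf r c x" using sym_G[OF x] by (simp add: conf_def transpose_scalar)
  show "v \<bullet> (conf r c x *v v) > 0" if "v \<noteq> 0" for v
    using pos_G[OF x that] r(2) by (simp add: conf_def scaleR_matrix_vector_assoc[symmetric])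
next
  fix c d x assume c: "c \<in> A" "d \<in> A" "x \<in> overlap c d"
  show "let J = matrix (frechet_derivative (transition c d) (at x))
        in conf r c x = transpose J ** conf r d (transition c d x) ** J"
    unfolding Let_def conf_def inv_transition[OF c] metric_transition[OF c]
    by (simp add: scalar_matrix_assoc matrix_scalar_ac)
qed

lemma smooth_function_affine: "smooth_function f \<Longrightarrow> smooth_function (\<lambda>p. 1 + \<epsilon> * f p)"
  unfolding smooth_function_def
proof (intro ballI)
  fix c assume f: "\<forall>c\<in>A. smooth_on (chart_image c) (\<lambda>x. f (chart_inv c x))" and c: "c \<in> A"
  note o = chart(2)[OF c]
  show "smooth_on (chart_image c) (\<lambda>x. 1 + \<epsilon> * f (chart_inv c x))"
    by (rule smooth_on_add[OF o smooth_on_const[OF o] smooth_on_mult[OF o smooth_on_const[OF o] f[rule_format, OF c]]])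
qed

end

section \<open>Extension by zero of a function supported in one chart\<close>

locale chart_bump = manifold_metric A g
  for A :: "('m::{t2_space, second_countable_topology}, 'n::finite) chart set" and g +
  fixes c0 :: "('m, 'n) chart" and F :: "real^'n \<Rightarrow> real" and K :: "(real^'n) set"
  assumes c0: "c0 \<in> A" and F: "smooth_on UNIV F" and K: "compact K" "K \<subseteq> chart_image c0"
    and F0: "y \<notin> K \<Longrightarrow> F y = 0"
begin

definition zero_ext :: "'m \<Rightarrow> real" where
  "zero_ext p = (if p \<in> fst c0 then F (snd c0 p) else 0)"

lemma zero_ext_overlap: "d \<in> A \<Longrightarrow> y \<in> overlap d c0 \<Longrightarrow> zero_ext (chart_inv d y) = F (transition d c0 y)"
  by (auto simp: overlap_eq zero_ext_def transition_def)

lemma zero_ext_chart: "x \<in> chart_image c0 \<Longrightarrow> zero_ext (chart_inv c0 x) = F x"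
  using chart_inv_in[OF c0] chart_chart_inv[OF c0] by (simp add: zero_ext_def)

text \<open>The compact support is closed because the manifold is Hausdorff; its complement provides
  the neighborhood.\<close>

lemma zero_ext_vanishes:
  assumes d: "d \<in> A" and x: "x \<in> chart_image d" "x \<notin> overlap d c0"
  shows "\<exists>N. open N \<and> x \<in> N \<and> (\<forall>y\<in>N. zero_ext (chart_inv d y) = 0)"
proof -
  have "compact (chart_inv c0 ` K)"
    by (rule compact_continuous_image[OF continuous_on_subset[OF cont_chart_inv[OF c0] K(2)] K(1)])
  then have cl: "closed (chart_inv c0 ` K)" by (rule compact_imp_closed)
  define N where "N = chart_image d \<inter> chart_inv d -` (- (chart_inv c0 ` K))"
  have "open N"
    unfolding N_def by (rule continuous_open_preimage[OF cont_chart_inv[OF d] chart(2)[OF d]]) (use cl in auto)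
  moreover have "x \<in> N"
    using x K(2) chart_inv_in[OF c0] unfolding N_def overlap_eq[OF d] by auto
  moreover have "zero_ext (chart_inv d y) = 0" if "y \<in> N" for y
  proof (cases "chart_inv d y \<in> fst c0")
    case True
    have "snd c0 (chart_inv d y) \<notin> K"
    proof
      assume "snd c0 (chart_inv d y) \<in> K"
      then have "chart_inv c0 (snd c0 (chart_inv d y)) \<in> chart_inv c0 ` K" by (rule imageI)
      then show False using that chart_inv_chart[OF c0 True] by (simp add: N_def)
    qed
    then show ?thesis by (simp add: zero_ext_def F0)
  qed (simp add: zero_ext_def)
  ultimately show ?thesis by blast
qed

lemma smooth_zero_ext: "smooth_function zero_ext"
  unfolding smooth_function_def
proof (intro ballI)
  fix d assume d: "d \<in> A"
  show "smooth_on (chart_image d) (\<lambda>x. zero_ext (chart_inv d x))"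
  proof (rule smooth_on_local)
    fix x assume x: "x \<in> chart_image d"
    show "\<exists>T. x \<in> T \<and> smooth_on T (\<lambda>x. zero_ext (chart_inv d x))"
    proof (cases "x \<in> overlap d c0")
      case True
      have "smooth_on (overlap d c0) (\<lambda>y. F (transition d c0 y))"
        by (rule smooth_on_compose_real[OF open_overlap[OF d c0] smooth_transition[OF d c0] F]) simp
      then have "smooth_on (overlap d c0) (\<lambda>x. zero_ext (chart_inv d x))"
        by (rule smooth_on_cong[OF open_overlap[OF d c0], rotated]) (simp add: zero_ext_overlap[OF d])
      then show ?thesis using True by blast
    next
      case False
      obtain N where N: "open N" "x \<in> N" "\<And>y. y \<in> N \<Longrightarrow> zero_ext (chart_inv d y) = 0"
        using zero_ext_vanishes[OF d x False] by blast
      have "smooth_on N (\<lambda>x. zero_ext (chart_inv d x))"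
        by (rule smooth_on_cong[OF N(1) _ smooth_on_const[OF N(1), of 0]]) (simp add: N(3))
      then show ?thesis using N(2) by blast
    qed
  qed
qed

text \<open>On an overlap the bounds are transported by \<open>hess_pullback\<close>, which respects
  inner products, Hessians and traces on planes. Off the overlap the extension vanishes near
  \<open>x\<close>, and the bounds hold since \<open>C\<close> and \<open>L\<close> are
  nonnegative.\<close>

lemma forms_all_charts:
  assumes C: "C \<ge> 0" "L \<ge> 0"
    and bf: "\<And>x. x \<in> chart_image c0 \<Longrightarrow> bounded_form (metric_inner (g c0) x) (hess (g c0) F x) (\<lambda>v. dir_deriv F v x) C"
    and osc: "\<And>x. x \<in> chart_image c0 \<Longrightarrow> trace_osc_le (metric_inner (g c0) x) (hess (g c0) F x) L"
    and d: "d \<in> A" and x: "x \<in> chart_image d"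
  defines "f \<equiv> \<lambda>x. zero_ext (chart_inv d x)"
  shows "bounded_form (metric_inner (g d) x) (hess (g d) f x) (\<lambda>v. dir_deriv f v x) C"
    "trace_osc_le (metric_inner (g d) x) (hess (g d) f x) L"
proof -
  interpret D: local_metric "chart_image d" "g d" by (rule local_metric_chart[OF d])
  have "bounded_form (metric_inner (g d) x) (hess (g d) f x) (\<lambda>v. dir_deriv f v x) C \<and>
    trace_osc_le (metric_inner (g d) x) (hess (g d) f x) L"
  proof (cases "x \<in> overlap d c0")
    case True
    let ?U = "overlap d c0" and ?\<phi> = "transition d c0"
    have sub: "?U \<subseteq> chart_image d" by (auto simp: overlap_eq[OF d])
    have M: "local_metric ?U (g d)"
      by unfold_locales (use open_overlap[OF d c0] smooth_on_subset[OF D.smooth_G sub] D.sym_G D.pos_G sub in auto)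
    have img: "?\<phi> ` ?U \<subseteq> chart_image c0" using transition_in[OF d] by blast
    note p = hess_pullback[OF M local_metric_chart[OF c0] smooth_transition[OF d c0] img
        metric_transition[OF d c0] smooth_on_subset[OF F subset_UNIV] True]
    define J where "J = (\<lambda>v. dir_deriv ?\<phi> v x)"
    have J1: "linear J" using p(1) by (simp add: J_def)
    have J2: "v = 0" if "J v = 0" for v using p(2)[of v] that by (simp add: J_def)
    have J3: "metric_inner (g d) x v w = metric_inner (g c0) (?\<phi> x) (J v) (J w)" for v w
      using p(3)[of v w] by (simp add: J_def)
    have J4: "dir_deriv (\<lambda>y. F (?\<phi> y)) v x = dir_deriv F (J v) (?\<phi> x)" for v
      using p(4)[of v] by (simp add: J_def)
    have J5: "hess (g d) (\<lambda>y. F (?\<phi> y)) x v w = hess (g c0) F (?\<phi> x) (J v) (J w)" for v w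
      using p(5)[of v w] by (simp add: J_def)
    have h: "hess (g d) f x = hess (g d) (\<lambda>y. F (?\<phi> y)) x"
      by (rule hess_cong_open[OF open_overlap[OF d c0] True]) (simp add: f_def zero_ext_overlap[OF d])
    have df: "dir_deriv f v x = dir_deriv (\<lambda>y. F (?\<phi> y)) v x" for v
      by (rule dir_deriv_cong_open[OF open_overlap[OF d c0] True]) (simp add: f_def zero_ext_overlap[OF d])
    have xc: "?\<phi> x \<in> chart_image c0" using True img by blast
    \<comment> \<open>Injectivity of the differential carries planes to planes.\<close>
    have J: "indep2 (J a) (J b)" if "indep2 a b" for a b
      unfolding indep2_def
    proof (intro allI impI)
      fix s t assume "s *\<^sub>R J a + t *\<^sub>R J b = 0"
      then have "J (s *\<^sub>R a + t *\<^sub>R b) = 0" by (simp add: linear_add[OF J1] linear_scale[OF J1])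
      then have "s *\<^sub>R a + t *\<^sub>R b = 0" by (rule J2)
      then show "s = 0 \<and> t = 0" using that by (simp add: indep2_def)
    qed
    have mg: "mix (metric_inner (g d) x) (hess (g d) f x) a b
        = mix (metric_inner (g c0) (?\<phi> x)) (hess (g c0) F (?\<phi> x)) (J a) (J b)"
      "gram (metric_inner (g d) x) a b = gram (metric_inner (g c0) (?\<phi> x)) (J a) (J b)" for a b
      unfolding mix_def gram_def h J3 J5 by (rule refl)+
    show ?thesis
    proof
      show "bounded_form (metric_inner (g d) x) (hess (g d) f x) (\<lambda>v. dir_deriv f v x) C"
        using bf[OF xc] unfolding bounded_form_def h df J3 J4 J5 by blast
      show "trace_osc_le (metric_inner (g d) x) (hess (g d) f x) L"
        using osc[OF xc] J unfolding trace_osc_le_def mg by blast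
    qed
  next
    case False
    obtain N where N: "open N" "x \<in> N" "\<And>y. y \<in> N \<Longrightarrow> zero_ext (chart_inv d y) = 0"
      using zero_ext_vanishes[OF d x False] by blast
    have df: "dir_deriv f v x = 0" for v
      using dir_deriv_cong_open[OF N(1,2), of f "\<lambda>_. 0" v] N(3) by (simp add: f_def)
    have h: "hess (g d) f x = (\<lambda>v w. 0)"
    proof -
      have "hess (g d) f x = hess (g d) (\<lambda>_. 0) x"
        by (rule hess_cong_open[OF N(1,2)]) (simp add: f_def N(3))
      moreover have "dir_deriv (\<lambda>_::real^'n. 0::real) v = (\<lambda>_. 0)" for v by (rule ext) simp
      ultimately show ?thesis by (simp add: hess_def fun_eq_iff)
    qed
    show ?thesis unfolding bounded_form_def trace_osc_le_def df h
      using C D.mi_nonneg[OF x] by (simp add: mix_def)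
  qed
  then show "bounded_form (metric_inner (g d) x) (hess (g d) f x) (\<lambda>v. dir_deriv f v x) C"
    "trace_osc_le (metric_inner (g d) x) (hess (g d) f x) L" by blast+
qed

end

section \<open>Small deformations in the \<open>C\<^sup>r\<close> topology\<close>

context manifold_metric
begin

text \<open>Each iterated partial of the deformed metric is affine in \<open>\<epsilon>\<close>,
  with slope bounded on the compact \<open>K\<close>, and only finitely many index lists have length
  at most \<open>r\<close>. The center \<open>g'\<close> may differ from \<open>g\<close>, as
  generators of the topology have arbitrary centers.\<close>

lemma conf_in_basic_nbhd:
  assumes f: "smooth_function f" "\<And>p. f p \<ge> 0"
    and g': "riemannian_metric A g'" and K: "c \<in> A" "compact K" "K \<subseteq> chart_image c" and g: "g \<in> C_basic_nbhd r A g' c K e"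
  shows "\<forall>\<^sub>F \<epsilon> in at_right 0. conf (\<lambda>p. 1 + \<epsilon> * f p) \<in> C_basic_nbhd r A g' c K e"
proof -
  interpret local_metric "chart_image c" "g c" by (rule local_metric_chart[OF K(1)])
  let ?f = "\<lambda>x. f (chart_inv c x)"
  define h where "h x = ?f x *\<^sub>R g c x" for x
  have sf: "smooth_on (chart_image c) ?f" using f(1) K(1) by (simp add: smooth_function_def)
  have sh: "smooth_on (chart_image c) h"
    unfolding h_def[abs_def] by (rule smooth_on_scaleR[OF open_S sf smooth_G])
  have eq: "conf (\<lambda>p. 1 + \<epsilon> * f p) c = (\<lambda>x. g c x + \<epsilon> *\<^sub>R h x)" for \<epsilon>
    by (rule ext) (simp add: conf_def h_def scaleR_add_left)
  have P: "partials is (conf (\<lambda>p. 1 + \<epsilon> * f p) c) x = partials is (g c) x + \<epsilon> *\<^sub>R partials is h x"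
    if "x \<in> chart_image c" for \<epsilon> "is" x
    unfolding eq partials_add[OF open_S smooth_G smooth_on_bounded_linear[OF open_S sh bounded_linear_scaleR_right] that]
      partials_bounded_linear[OF open_S sh bounded_linear_scaleR_right that] ..
  have fin: "finite {is :: 'n list. length is \<le> r}"
    using finite_lists_length_le[of "UNIV :: 'n set" r] by simp
  have one: "\<forall>\<^sub>F \<epsilon> in at_right 0. \<forall>x\<in>K. dist (partials is (conf (\<lambda>p. 1 + \<epsilon> * f p) c) x) (partials is (g' c) x) < e"
    if len: "length is \<le> r" for "is"
  proof (cases "K = {}")
    case False
    have close: "(\<forall>x\<in>K. dist (partials is (g c) x) (partials is (g' c) x) < e)"
      using g len by (simp add: C_basic_nbhd_def)
    have ch: "continuous_on K (partials is h)"
      by (rule continuous_on_subset[OF smooth_on_continuous[OF smooth_on_partials[OF sh]] K(3)])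
    obtain B where B: "\<And>x. x \<in> K \<Longrightarrow> norm (partials is h x) \<le> B"
      using compact_imp_bounded[OF compact_continuous_image[OF ch K(2)]] by (auto simp: bounded_iff)
    have sg': "smooth_on (chart_image c) (g' c)" using g' K(1) by (simp add: riemannian_metric_def)
    have "continuous_on K (\<lambda>x. dist (partials is (g c) x) (partials is (g' c) x))"
      by (intro continuous_on_dist continuous_on_subset[OF smooth_on_continuous[OF smooth_on_partials] K(3)] smooth_G sg')
    \<comment> \<open>The distance attains its maximum on \<open>K\<close>, so the strict bound
      \<open>e\<close> improves to some \<open>s\<close> below \<open>e\<close>; the difference is
      the room for the deformation.\<close>
    from continuous_attains_sup[OF K(2) False this] obtain s where s: "s < e" "\<And>x. x \<in> K \<Longrightarrow> dist (partials is (g c) x) (partials is (g' c) x) \<le> s"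
      using close by blast
    have "((\<lambda>\<epsilon>. \<epsilon> * B) \<longlongrightarrow> 0 * B) (at_right 0)" by (intro tendsto_intros)
    then have "\<forall>\<^sub>F \<epsilon> in at_right 0. \<epsilon> * B < e - s"
      by (rule order_tendstoD(2)) (use s in simp)
    moreover have "\<forall>\<^sub>F \<epsilon> in at_right (0::real). \<epsilon> > 0" by (rule eventually_at_right_less)
    ultimately show ?thesis
    proof eventually_elim
      case (elim \<epsilon>)
      show ?case
      proof
        fix x assume x: "x \<in> K"
        then have xc: "x \<in> chart_image c" using K(3) by blast
        have "dist (partials is (conf (\<lambda>p. 1 + \<epsilon> * f p) c) x) (partials is (g' c) x)
            \<le> dist (partials is (conf (\<lambda>p. 1 + \<epsilon> * f p) c) x) (partials is (g c) x) + dist (partials is (g c) x) (partials is (g' c) x)"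
          by (rule dist_triangle)
        also have "\<dots> \<le> \<epsilon> * B + s"
          unfolding P[OF xc] using B[OF x] elim s(2)[OF x] by (intro add_mono) (simp_all add: dist_norm)
        finally show "dist (partials is (conf (\<lambda>p. 1 + \<epsilon> * f p) c) x) (partials is (g' c) x) < e" using elim by simp
      qed
    qed
  qed simp
  then have "\<forall>\<^sub>F \<epsilon> in at_right 0. \<forall>is\<in>{is. length is \<le> r}. \<forall>x\<in>K. dist (partials is (conf (\<lambda>p. 1 + \<epsilon> * f p) c) x) (partials is (g' c) x) < e"
    by (intro eventually_ball_finite[OF fin]) auto
  moreover have "\<forall>\<^sub>F \<epsilon> in at_right (0::real). \<epsilon> > 0" by (rule eventually_at_right_less)
  ultimately show ?thesis
  proof eventually_elim
    case (elim \<epsilon>)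
    have "riemannian_metric A (conf (\<lambda>p. 1 + \<epsilon> * f p))"
      by (rule riemannian_conf[OF smooth_function_affine[OF f(1)]]) (use f(2) elim in \<open>auto intro: add_pos_nonneg\<close>)
    then show ?case using elim by (simp add: C_basic_nbhd_def)
  qed
qed

end

context manifold_metric
begin

text \<open>Induction over the generated topology. Speaking of all small positive
  \<open>\<epsilon>\<close> instead of a single one is what makes intersections go through.\<close>

lemma conf_in_open:
  assumes f: "smooth_function f" "\<And>p. f p \<ge> 0"
    and W: "openin (C_topology r A) W" "g \<in> W"
  shows "\<forall>\<^sub>F \<epsilon> in at_right 0. conf (\<lambda>p. 1 + \<epsilon> * f p) \<in> W"
proof -
  have "generate_topology_on {C_basic_nbhd r A g c K e | g c K e.
        riemannian_metric A g \<and> c \<in> A \<and> compact K \<and> K \<subseteq> chart_image c \<and> e > 0} W"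
    using W(1) unfolding C_topology_def openin_topology_generated_by_iff .
  then show ?thesis using W(2)
  proof induction
    case (Int a b)
    then show ?case by (auto intro: eventually_conj)
  next
    case (UN \<K>)
    then obtain k where k: "k \<in> \<K>" "g \<in> k" by blast
    then have "\<forall>\<^sub>F \<epsilon> in at_right 0. conf (\<lambda>p. 1 + \<epsilon> * f p) \<in> k" using UN by blast
    then show ?case by eventually_elim (use k in blast)
  next
    case (Basis s)
    then obtain g' c K e where "s = C_basic_nbhd r A g' c K e" "riemannian_metric A g'" "c \<in> A" "compact K" "K \<subseteq> chart_image c"
      by blast
    then show ?case using conf_in_basic_nbhd[OF f] Basis(2) by blast
  qed simp
qed

lemma sectional_curvature_span:
  assumes "c \<in> A" "x \<in> chart_image c" "indep2 a b"
  shows "sectional_curvature g c x (span {a, b}) = sec (g c) x a b"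
  unfolding sectional_curvature_def
  by (rule local_metric.local_sectional_curvature_eq_sec[OF local_metric_chart[OF assms(1)] assms(2,3)])

lemma sectional_curvature_scale:
  assumes c: "c \<in> A" and x: "x \<in> chart_image c" and P: "P \<in> two_planes" and s: "s > 0"
  shows "sectional_curvature (scale_metric s g) c x P = sectional_curvature g c x P / s"
proof -
  obtain a b where ab: "indep2 a b" "P = span {a, b}" using two_planes_span[OF P] .
  note sc = local_metric.sec_scale[OF local_metric_chart[OF c] x s ab(1)]
  show ?thesis
    unfolding ab(2) sectional_curvature_span[OF c x ab(1)] sc(2)[symmetric]
    unfolding sectional_curvature_def scale_metric_def
    by (rule local_metric.local_sectional_curvature_eq_sec[OF sc(1) x ab(1)])
qed

text \<open>\<open>D\<close> bounds \<open>1 - a1\<close> squared-wise from above, 1 - a1^2 at most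
  D, while the two distant planes force 1 - a2^2 to be at least 3/2 D. The bounds \<open>l\<close>
  and \<open>u\<close> keep all curvature ratios away from 0.\<close>

lemma pinching_of_bounds:
  fixes k l u D
  defines "k \<equiv> \<lambda>c x P. - sectional_curvature g c x P"
  assumes l: "l > 0" and bounds: "\<And>c x P. c \<in> A \<Longrightarrow> x \<in> chart_image c \<Longrightarrow> P \<in> two_planes \<Longrightarrow> l \<le> k c x P \<and> k c x P \<le> u"
    and loc: "\<And>c x P Q. c \<in> A \<Longrightarrow> x \<in> chart_image c \<Longrightarrow> P \<in> two_planes \<Longrightarrow> Q \<in> two_planes \<Longrightarrow> (1 - D) * k c x Q \<le> k c x P"
    and strict: "c1 \<in> A" "x1 \<in> chart_image c1" "P1 \<in> two_planes" "Q1 \<in> two_planes" "k c1 x1 P1 < k c1 x1 Q1"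
    and glob: "c2 \<in> A" "x2 \<in> chart_image c2" "P2 \<in> two_planes" "c3 \<in> A" "x3 \<in> chart_image c3" "Q3 \<in> two_planes"
      "k c2 x2 P2 \<le> (1 - 3/2 * D) * k c3 x3 Q3"
  shows "\<exists>a1 a2. best_local_pinching A g a1 \<and> best_global_pinching A g a2 \<and>
       0 < a1 \<and> a1 < 1 \<and> (1 - a2) / (1 - a1) \<ge> 3/2 \<and> a2 < a1"
proof -
  have kpos: "k c x P > 0" "k c x P \<le> u" "l \<le> k c x P" if "c \<in> A" "x \<in> chart_image c" "P \<in> two_planes" for c x P
    using bounds[OF that] l by auto
  define I where "I = {(c, x, P). c \<in> A \<and> x \<in> chart_image c \<and> P \<in> (two_planes :: (real^'n) set set)}"
  define kk where "kk = (\<lambda>(c, x, P). k c x P)"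
  define Rg where "Rg = {kk i / kk j | i j. i \<in> I \<and> j \<in> I}"
  define Rl where "Rl = {k c x P / k c x Q | c x P Q. c \<in> A \<and> x \<in> chart_image c \<and> P \<in> two_planes \<and> Q \<in> two_planes}"
  have kk: "kk i > 0" "kk i \<le> u" "l \<le> kk i" if "i \<in> I" for i
    using that kpos by (auto simp: I_def kk_def)
  have i1: "(c1, x1, P1) \<in> I" using strict by (simp add: I_def)
  have u: "u > 0" using kk[OF i1] by simp
  have g_loc: "locally_pinched A g b \<longleftrightarrow> (\<forall>r\<in>Rl. r \<ge> b\<^sup>2)" for b
    unfolding locally_pinched_def Rl_def k_def by fastforce
  have g_glob: "globally_pinched A g b \<longleftrightarrow> (\<forall>r\<in>Rg. r \<ge> b\<^sup>2)" if b: "b > 0" for b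
  proof
    assume "globally_pinched A g b"
    then obtain s where s: "s > 0" "\<And>c x P. c \<in> A \<Longrightarrow> x \<in> chart_image c \<Longrightarrow> P \<in> two_planes \<Longrightarrow>
       -1 \<le> sectional_curvature (scale_metric s g) c x P \<and> sectional_curvature (scale_metric s g) c x P \<le> -(b\<^sup>2)"
      unfolding globally_pinched_def by blast
    \<comment> \<open>Scaling the metric by \<open>s\<close> divides curvature by \<open>s\<close>,
      so the normalization says that \<open>k\<close> lies between \<open>b\<close> squared times
      \<open>s\<close> and \<open>s\<close>.\<close>
    have s': "k c x P \<le> s" "b\<^sup>2 * s \<le> k c x P" if "c \<in> A" "x \<in> chart_image c" "P \<in> two_planes" for c x P
      using s(2)[OF that] s(1) unfolding sectional_curvature_scale[OF that s(1)] k_def by (simp_all add: field_simps)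
    show "\<forall>r\<in>Rg. r \<ge> b\<^sup>2"
    proof
      fix r assume "r \<in> Rg"
      then obtain i j where ij: "i \<in> I" "j \<in> I" "r = kk i / kk j" by (auto simp: Rg_def)
      have "kk j \<le> s" "b\<^sup>2 * s \<le> kk i" using ij s' by (auto simp: I_def kk_def)
      then have "b\<^sup>2 * kk j \<le> kk i" using mult_left_mono[of "kk j" s "b\<^sup>2"] by simp
      then show "b\<^sup>2 \<le> r" using kk(1)[OF ij(2)] by (simp add: ij(3) pos_le_divide_eq)
    qed
  next
    assume R: "\<forall>r\<in>Rg. r \<ge> b\<^sup>2"
    \<comment> \<open>The supremum of \<open>k\<close> is the smallest scaling that brings all
      curvatures to at least -1.\<close>
    define s where "s = Sup (kk ` I)"
    have bdd: "bdd_above (kk ` I)" by (rule bdd_aboveI2[of _ _ u]) (rule kk(2))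
    have le: "kk i \<le> s" if "i \<in> I" for i unfolding s_def using that by (intro cSup_upper bdd) auto
    have s: "s > 0" using le[OF i1] kk(1)[OF i1] by simp
    have ge: "b\<^sup>2 * s \<le> kk i" if i: "i \<in> I" for i
    proof -
      have "s \<le> kk i / b\<^sup>2"
        unfolding s_def
      proof (rule cSup_least)
        show "kk ` I \<noteq> {}" using i1 by auto
        fix y assume "y \<in> kk ` I"
        then obtain j where j: "j \<in> I" "y = kk j" by auto
        have "kk i / kk j \<in> Rg" using i j(1) unfolding Rg_def by blast
        then have "b\<^sup>2 \<le> kk i / kk j" using R by blast
        then have "b\<^sup>2 * kk j \<le> kk i" using kk(1)[OF j(1)] by (simp add: pos_le_divide_eq)
        then show "y \<le> kk i / b\<^sup>2" using b by (simp add: j(2) pos_le_divide_eq mult.commute)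
      qed
      then show ?thesis using b by (simp add: pos_le_divide_eq mult.commute)
    qed
    show "globally_pinched A g b"
      unfolding globally_pinched_def
    proof (intro exI[of _ s] conjI ballI)
      fix c x and P :: "(real^'n) set" assume cx: "c \<in> A" "x \<in> chart_image c" "P \<in> two_planes"
      then have i: "(c, x, P) \<in> I" by (simp add: I_def)
      show "-1 \<le> sectional_curvature (scale_metric s g) c x P"
        "sectional_curvature (scale_metric s g) c x P \<le> - (b\<^sup>2)"
        unfolding sectional_curvature_scale[OF cx s]
        using le[OF i] ge[OF i] s by (simp_all add: kk_def k_def field_simps)
    qed (rule s)
  qed
  have "k c1 x1 P1 / k c1 x1 P1 \<in> Rl" "kk (c1, x1, P1) / kk (c1, x1, P1) \<in> Rg"
    unfolding Rl_def Rg_def using strict i1 by blast+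
  then have one: "1 \<in> Rl" "1 \<in> Rg" using kpos(1)[OF strict(1-3)] kk(1)[OF i1] by simp_all
  have low: "l / u \<le> kk i / kk j" if "i \<in> I" "j \<in> I" for i j
    using kk[OF that(1)] kk[OF that(2)] l by (intro frac_le) auto
  have lowg: "l / u \<le> r" if "r \<in> Rg" for r using that low by (auto simp: Rg_def)
  have "Rl \<subseteq> Rg"
  proof
    fix r assume "r \<in> Rl"
    then obtain c x P Q where r: "r = k c x P / k c x Q" "c \<in> A" "x \<in> chart_image c" "P \<in> two_planes" "Q \<in> two_planes"
      unfolding Rl_def by blast
    then have "(c, x, P) \<in> I" "(c, x, Q) \<in> I" "r = kk (c, x, P) / kk (c, x, Q)" by (auto simp: I_def kk_def)
    then show "r \<in> Rg" unfolding Rg_def by blast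
  qed
  then have lowl: "l / u \<le> r" if "r \<in> Rl" for r using that lowg by blast
  have lu: "l / u > 0" using l u by simp
  obtain a1 where a1: "is_greatest {b \<in> {0<..1}. \<forall>r\<in>Rl. r \<ge> b\<^sup>2} a1" "0 < a1" "a1 \<le> 1"
    "\<And>t. (\<And>r. r \<in> Rl \<Longrightarrow> t \<le> r) \<Longrightarrow> t \<le> a1\<^sup>2" "\<And>r. r \<in> Rl \<Longrightarrow> a1\<^sup>2 \<le> r"
    using greatest_pinching[OF one(1) lu lowl] by blast
  obtain a2 where a2: "is_greatest {b \<in> {0<..1}. \<forall>r\<in>Rg. r \<ge> b\<^sup>2} a2" "0 < a2" "a2 \<le> 1"
    "\<And>t. (\<And>r. r \<in> Rg \<Longrightarrow> t \<le> r) \<Longrightarrow> t \<le> a2\<^sup>2" "\<And>r. r \<in> Rg \<Longrightarrow> a2\<^sup>2 \<le> r"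
    using greatest_pinching[OF one(2) lu lowg] by blast
  have "{b \<in> {0<..1}. locally_pinched A g b} = {b \<in> {0<..1}. \<forall>r\<in>Rl. r \<ge> b\<^sup>2}" using g_loc by simp
  then have b1: "best_local_pinching A g a1" using a1(1) by (simp add: best_local_pinching_def)
  have "{b \<in> {0<..1}. globally_pinched A g b} = {b \<in> {0<..1}. \<forall>r\<in>Rg. r \<ge> b\<^sup>2}" using g_glob by auto
  then have b2: "best_global_pinching A g a2" using a2(1) by (simp add: best_global_pinching_def)
  have D1: "1 - a1\<^sup>2 \<le> D"
  proof -
    have "1 - D \<le> r" if rl: "r \<in> Rl" for r
    proof -
      obtain c x P Q where r: "r = k c x P / k c x Q" "c \<in> A" "x \<in> chart_image c" "P \<in> two_planes" "Q \<in> two_planes"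
        using rl unfolding Rl_def by blast
      show ?thesis using loc[OF r(2-5)] kpos(1)[OF r(2,3,5)] by (simp add: r(1) pos_le_divide_eq)
    qed
    from a1(4)[OF this] show ?thesis by simp
  qed
  have D2: "3/2 * D \<le> 1 - a2\<^sup>2"
  proof -
    have "(c2, x2, P2) \<in> I" "(c3, x3, Q3) \<in> I" using glob by (simp_all add: I_def)
    then have "kk (c2, x2, P2) / kk (c3, x3, Q3) \<in> Rg" unfolding Rg_def by blast
    then have "a2\<^sup>2 \<le> k c2 x2 P2 / k c3 x3 Q3" using a2(5) by (force simp: kk_def)
    also have "\<dots> \<le> 1 - 3/2 * D" using glob(7) kpos(1)[OF glob(4-6)] by (simp add: pos_divide_le_eq)
    finally show ?thesis by simp
  qed
  have a1lt: "a1 < 1"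
  proof -
    have "k c1 x1 P1 / k c1 x1 Q1 \<in> Rl" using strict unfolding Rl_def by blast
    then have "a1\<^sup>2 \<le> k c1 x1 P1 / k c1 x1 Q1" by (rule a1(5))
    also have "\<dots> < 1" using strict(5) kpos(1)[OF strict(1,2,4)] by simp
    finally show ?thesis using a1(2,3) by (cases "a1 = 1") auto
  qed
  have pos: "1 - a1\<^sup>2 > 0" using a1(2) a1lt by (simp add: power_less_one_iff)
  have "a2\<^sup>2 < a1\<^sup>2" using D1 D2 pos by linarith
  then have a21: "a2 < a1" using a1(2) by (simp add: power_less_imp_less_base)
  \<comment> \<open>From squares to the constants themselves: 1 - a^2 = (1 - a)(1 + a), and
    replacing 1 + a1 by the smaller 1 + a2 goes in the favorable direction.\<close>
  have "3/2 * ((1 - a1) * (1 + a2)) \<le> 3/2 * ((1 - a1) * (1 + a1))"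
    using a21 a1lt by (intro mult_left_mono) auto
  also have "\<dots> = 3/2 * (1 - a1\<^sup>2)" by (simp add: power2_eq_square algebra_simps)
  also have "\<dots> \<le> 1 - a2\<^sup>2" using D1 D2 by simp
  also have "\<dots> = (1 - a2) * (1 + a2)" by (simp add: power2_eq_square algebra_simps)
  finally have "(3/2 * (1 - a1)) * (1 + a2) \<le> (1 - a2) * (1 + a2)" by (simp only: mult.assoc)
  then have "3/2 * (1 - a1) \<le> 1 - a2" using a2(2) by (simp add: mult_le_cancel_right)
  then have "(1 - a2) / (1 - a1) \<ge> 3/2" using a1lt by (simp add: pos_le_divide_eq)
  then show ?thesis using b1 b2 a1(2) a1lt a21 by blast
qed

end

section \<open>Choice of the deformation parameter\<close>

lemma eventually_small:
  fixes a :: real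
  assumes "b > 0"
  shows "\<forall>\<^sub>F \<epsilon> in at_right 0. \<epsilon> * a < b"
proof -
  have "((\<lambda>\<epsilon>. \<epsilon> * a) \<longlongrightarrow> 0 * a) (at_right 0)" by (intro tendsto_intros)
  then show ?thesis by (rule order_tendstoD(2)) (use assms in simp)
qed

text \<open>\<open>\<kappa>\<close> is minus the deformed curvature multiplied by
  \<open>\<rho>\<close>. In the difference of two planes the term with \<open>N\<close> cancels, and
  only half the trace oscillation survives to first order; since \<open>\<rho>\<close> is at least
  1, all its powers in denominators may be dropped.\<close>

lemma kappa_bounds:
  fixes \<epsilon> \<rho> C N \<tau> \<theta> \<tau>' \<theta>' L :: real
  assumes eps: "0 < \<epsilon>" "\<epsilon> \<le> 1" and rho: "\<rho> \<ge> 1" and C: "C \<ge> 0" "L \<ge> 0"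
    and t: "\<bar>\<tau>\<bar> \<le> 2 * C" "0 \<le> \<theta>" "\<theta> \<le> C" "0 \<le> \<theta>'" "\<theta>' \<le> C" "0 \<le> N" "N \<le> C"
    and L: "\<tau> - \<tau>' \<le> L"
  defines "\<kappa> \<equiv> \<lambda>\<tau> \<theta>. 1 + \<epsilon> * \<tau> / (2 * \<rho>) - 3 * \<epsilon>\<^sup>2 * \<theta> / (4 * \<rho>\<^sup>2) + \<epsilon>\<^sup>2 * N / (4 * \<rho>\<^sup>2)"
  shows "\<bar>\<kappa> \<tau> \<theta> - 1\<bar> \<le> \<epsilon> * (2 * C)" "\<kappa> \<tau> \<theta> - \<kappa> \<tau>' \<theta>' \<le> \<epsilon> * (L / 2 + \<epsilon> * C)"
proof -
  have e2: "0 \<le> \<epsilon>\<^sup>2" "\<epsilon>\<^sup>2 \<le> \<epsilon>" using eps by (auto simp: power2_eq_square mult_left_le)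
  have q: "x / (4 * \<rho>\<^sup>2) \<le> x / 4" if "x \<ge> 0" for x
  proof -
    have "(4::real) \<le> 4 * \<rho>\<^sup>2" using rho one_le_power[of \<rho> 2] by simp
    then show ?thesis using that by (intro divide_left_mono) auto
  qed
  have h: "x / (2 * \<rho>) \<le> x / 2" if "x \<ge> 0" for x
    using that rho by (intro divide_left_mono) auto
  have tq: "0 \<le> 3 * \<epsilon>\<^sup>2 * t / (4 * \<rho>\<^sup>2)" "3 * \<epsilon>\<^sup>2 * t / (4 * \<rho>\<^sup>2) \<le> 3/4 * (\<epsilon>\<^sup>2 * C)" if "0 \<le> t" "t \<le> C" for t
  proof -
    show "0 \<le> 3 * \<epsilon>\<^sup>2 * t / (4 * \<rho>\<^sup>2)" using that by simp
    have "3 * \<epsilon>\<^sup>2 * t / (4 * \<rho>\<^sup>2) \<le> 3 * \<epsilon>\<^sup>2 * t / 4" by (rule q) (use that in simp)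
    also have "\<dots> \<le> 3 * \<epsilon>\<^sup>2 * C / 4" using that by (intro divide_right_mono mult_left_mono) auto
    finally show "3 * \<epsilon>\<^sup>2 * t / (4 * \<rho>\<^sup>2) \<le> 3/4 * (\<epsilon>\<^sup>2 * C)" by simp
  qed
  have nq: "0 \<le> \<epsilon>\<^sup>2 * N / (4 * \<rho>\<^sup>2)" "\<epsilon>\<^sup>2 * N / (4 * \<rho>\<^sup>2) \<le> 1/4 * (\<epsilon>\<^sup>2 * C)"
  proof -
    show "0 \<le> \<epsilon>\<^sup>2 * N / (4 * \<rho>\<^sup>2)" using t by simp
    have "\<epsilon>\<^sup>2 * N / (4 * \<rho>\<^sup>2) \<le> \<epsilon>\<^sup>2 * N / 4" by (rule q) (use t in simp)
    also have "\<dots> \<le> \<epsilon>\<^sup>2 * C / 4" using t by (intro divide_right_mono mult_left_mono) auto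
    finally show "\<epsilon>\<^sup>2 * N / (4 * \<rho>\<^sup>2) \<le> 1/4 * (\<epsilon>\<^sup>2 * C)" by simp
  qed
  have eC: "\<epsilon>\<^sup>2 * C \<le> \<epsilon> * C" using e2(2) C(1) by (rule mult_right_mono)
  have "\<bar>\<epsilon> * \<tau> / (2 * \<rho>)\<bar> = \<epsilon> * \<bar>\<tau>\<bar> / (2 * \<rho>)" using eps rho by (simp add: abs_mult)
  also have "\<dots> \<le> \<epsilon> * \<bar>\<tau>\<bar> / 2" by (rule h) (use eps in simp)
  also have "\<dots> \<le> \<epsilon> * (2 * C) / 2" using t eps by (intro divide_right_mono mult_left_mono) auto
  finally have "\<bar>\<epsilon> * \<tau> / (2 * \<rho>)\<bar> \<le> \<epsilon> * C" by simp
  then show "\<bar>\<kappa> \<tau> \<theta> - 1\<bar> \<le> \<epsilon> * (2 * C)"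
    using tq[OF t(2,3)] nq eC unfolding \<kappa>_def abs_le_iff by linarith
  have "\<epsilon> * (\<tau> - \<tau>') / (2 * \<rho>) \<le> \<epsilon> * L / (2 * \<rho>)"
    using L eps rho by (intro divide_right_mono mult_left_mono) auto
  also have "\<dots> \<le> \<epsilon> * L / 2" by (rule h) (use eps C in simp)
  finally have "\<epsilon> * \<tau> / (2 * \<rho>) - \<epsilon> * \<tau>' / (2 * \<rho>) \<le> \<epsilon> * L / 2"
    by (simp add: right_diff_distrib diff_divide_distrib)
  moreover have "3/4 * (\<epsilon>\<^sup>2 * C) \<le> \<epsilon>\<^sup>2 * C" using C e2 by simp
  ultimately have "\<kappa> \<tau> \<theta> - \<kappa> \<tau>' \<theta>' \<le> \<epsilon> * L / 2 + \<epsilon>\<^sup>2 * C"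
    using tq[OF t(2,3)] tq[OF t(4,5)] unfolding \<kappa>_def by linarith
  then show "\<kappa> \<tau> \<theta> - \<kappa> \<tau>' \<theta>' \<le> \<epsilon> * (L / 2 + \<epsilon> * C)" by (simp add: algebra_simps power2_eq_square)
qed

text \<open>The first-order gap in the trace beats the quadratic term in \<open>\<theta>\<close>
  once \<open>\<epsilon>\<close> is small relative to the gap.\<close>

lemma kappa_strict:
  fixes \<epsilon> \<rho> C N \<tau> \<theta> \<tau>' \<theta>' :: real
  assumes eps: "0 < \<epsilon>" and rho: "\<rho> \<ge> 1" and t: "\<theta> \<le> C" "0 \<le> \<theta>'" "0 \<le> C" and gap: "\<epsilon> * (3 * C) < \<tau> - \<tau>'"
  defines "\<kappa> \<equiv> \<lambda>\<tau> \<theta>. 1 + \<epsilon> * \<tau> / (2 * \<rho>) - 3 * \<epsilon>\<^sup>2 * \<theta> / (4 * \<rho>\<^sup>2) + \<epsilon>\<^sup>2 * N / (4 * \<rho>\<^sup>2)"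
  shows "\<kappa> \<tau>' \<theta>' < \<kappa> \<tau> \<theta>"
proof -
  have "3 * \<epsilon>\<^sup>2 * (\<theta> - \<theta>') / (4 * \<rho>\<^sup>2) \<le> 3 * \<epsilon>\<^sup>2 * C / (4 * \<rho>\<^sup>2)"
    using t by (intro divide_right_mono mult_left_mono) auto
  also have "\<dots> \<le> 3 * \<epsilon>\<^sup>2 * C / (4 * \<rho>)"
    using rho t by (intro divide_left_mono) (auto simp: power2_eq_square)
  also have "\<dots> = \<epsilon> / (4 * \<rho>) * (\<epsilon> * (3 * C))" by (simp add: power2_eq_square)
  also have "\<dots> < \<epsilon> / (4 * \<rho>) * (\<tau> - \<tau>')"
    using eps rho gap by (intro mult_strict_left_mono) auto
  also have "\<dots> \<le> \<epsilon> / (2 * \<rho>) * (\<tau> - \<tau>')"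
  proof (intro mult_right_mono divide_left_mono)
    have "0 \<le> \<epsilon> * (3 * C)" using eps t by simp
    then show "0 \<le> \<tau> - \<tau>'" using gap by linarith
  qed (use eps rho in auto)
  finally have "3 * \<epsilon>\<^sup>2 * \<theta> / (4 * \<rho>\<^sup>2) - 3 * \<epsilon>\<^sup>2 * \<theta>' / (4 * \<rho>\<^sup>2) < \<epsilon> * \<tau> / (2 * \<rho>) - \<epsilon> * \<tau>' / (2 * \<rho>)"
    by (simp add: right_diff_distrib diff_divide_distrib)
  then show ?thesis unfolding \<kappa>_def by simp
qed

section \<open>Choice of epsilon and comparison of curvatures on the deformed manifold\<close>

theorem proposition4:
  fixes A :: "('m::{t2_space, second_countable_topology}, 'n::finite) chart set"
    and g :: "('m, 'n) tensor2"
    and V :: "('m, 'n) tensor2 set"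
  assumes "CARD('n) \<ge> 3"
    and "compact (UNIV :: 'm set)"
    and "smooth_atlas A"
    and "hyperbolic_metric A g"
    and "is_neighborhood (C_topology 3 A) g V"
  shows "\<exists>g'\<in>V. riemannian_metric A g' \<and> negatively_curved A g' \<and>
    (\<exists>a1 a2. best_local_pinching A g' a1 \<and> best_global_pinching A g' a2 \<and>
       0 < a1 \<and> a1 < 1 \<and> (1 - a2) / (1 - a1) \<ge> 3/2 \<and> a2 < a1)"
proof -
  have rm: "riemannian_metric A g" and hyp: "\<And>c x P. c \<in> A \<Longrightarrow> x \<in> chart_image c \<Longrightarrow> P \<in> two_planes \<Longrightarrow> sectional_curvature g c x P = - 1"
    using assms(4) by (auto simp: hyperbolic_metric_def)
  interpret manifold_metric A g by unfold_locales (fact assms(3), fact rm)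
  obtain W where W: "openin (C_topology 3 A) W" "g \<in> W" "W \<subseteq> V"
    using assms(5) by (auto simp: is_neighborhood_def)
  obtain c0 p0 where c0: "c0 \<in> A" and p0: "p0 \<in> fst c0"
    using assms(3) unfolding smooth_atlas_def by blast
  define x0 where "x0 = snd c0 p0"
  have x0: "x0 \<in> chart_image c0" using chart_in[OF p0] by (simp add: x0_def)
  interpret lm: local_metric "chart_image c0" "g c0" by (rule local_metric_chart[OF c0])
  let ?m = "bump_mass" and ?T = "\<lambda>F x a b. trace_on (metric_inner (g c0) x) (hess (g c0) F x) a b"
  have "\<exists>F K C M x1 a b a' b' x2.
    (smooth_on UNIV F \<and> compact K \<and> K \<subseteq> chart_image c0 \<and> (\<forall>y. y \<notin> K \<longrightarrow> F y = 0) \<and> (\<forall>y. 0 \<le> F y) \<and> (\<forall>y. F y \<le> M)) \<and>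
    C > 0 \<and> (\<forall>x\<in>chart_image c0. trace_osc_le (metric_inner (g c0) x) (hess (g c0) F x) (5/2 * ?m)) \<and>
    (\<forall>x\<in>chart_image c0. bounded_form (metric_inner (g c0) x) (hess (g c0) F x) (\<lambda>v. dir_deriv F v x) C) \<and>
    ((\<forall>v. dir_deriv F v x0 = 0) \<and> (\<forall>v w. hess (g c0) F x0 v w = - 2 * ?m * metric_inner (g c0) x0 v w)) \<and>
    (x1 \<in> chart_image c0 \<and> indep2 a b \<and> indep2 a' b' \<and> ?T F x1 a' b' < ?T F x1 a b) \<and>
    (x2 \<in> chart_image c0 \<and> F x2 = 0 \<and> (\<forall>v. dir_deriv F v x2 = 0) \<and> (\<forall>v w. hess (g c0) F x2 v w = 0))"
    (is "\<exists>F K C M x1 a b a' b' x2. ?Q F K C M x1 a b a' b' x2")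
    using lm.local_bump[OF x0 assms(1)] by (simp only: conj_assoc)
  then obtain F K C M x1 a b a' b' x2 where Q: "?Q F K C M x1 a b a' b' x2" by (elim exE)
  note F = Q[THEN conjunct1] and Q = Q[THEN conjunct2]
  note C = Q[THEN conjunct1] and Q = Q[THEN conjunct2]
  note osc = Q[THEN conjunct1] and Q = Q[THEN conjunct2]
  note bf = Q[THEN conjunct1] and Q = Q[THEN conjunct2]
  note at0 = Q[THEN conjunct1] and Q = Q[THEN conjunct2]
  note at1 = Q[THEN conjunct1] and at2 = Q[THEN conjunct2]
  note F = F[THEN conjunct1] F[THEN conjunct2, THEN conjunct1] F[THEN conjunct2, THEN conjunct2, THEN conjunct1]
    F[THEN conjunct2, THEN conjunct2, THEN conjunct2, THEN conjunct1, rule_format]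
    F[THEN conjunct2, THEN conjunct2, THEN conjunct2, THEN conjunct2, THEN conjunct1, rule_format]
    F[THEN conjunct2, THEN conjunct2, THEN conjunct2, THEN conjunct2, THEN conjunct2, rule_format]
  note at0 = at0[THEN conjunct1, rule_format] at0[THEN conjunct2, rule_format]
  note at1 = at1[THEN conjunct1] at1[THEN conjunct2, THEN conjunct1] at1[THEN conjunct2, THEN conjunct2, THEN conjunct1]
    at1[THEN conjunct2, THEN conjunct2, THEN conjunct2]
  note at2 = at2[THEN conjunct1] at2[THEN conjunct2, THEN conjunct1] at2[THEN conjunct2, THEN conjunct2, THEN conjunct1, rule_format]
    at2[THEN conjunct2, THEN conjunct2, THEN conjunct2, rule_format]
  interpret cb: chart_bump A g c0 F K by unfold_locales (fact c0, fact F(1), fact F(2), fact F(3), fact F(4))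
  define f where "f d x = cb.zero_ext (chart_inv d x)" for d and x :: "real^'n"
  have ext0: "cb.zero_ext p \<ge> 0" for p using F(5) by (simp add: cb.zero_ext_def)
  have M0: "M \<ge> 0" using F(5,6) order_trans by blast
  have extM: "cb.zero_ext p \<le> M" for p using F(6) M0 by (simp add: cb.zero_ext_def)
  have sf: "smooth_on (chart_image d) (f d)" if "d \<in> A" for d
    using cb.smooth_zero_ext that unfolding smooth_function_def f_def[abs_def] by blast
  have m: "?m > 0" by simp
  have forms: "bounded_form (metric_inner (g d) x) (hess (g d) (f d) x) (\<lambda>v. dir_deriv (f d) v x) C"
    "trace_osc_le (metric_inner (g d) x) (hess (g d) (f d) x) (5/2 * ?m)" if d: "d \<in> A" and x: "x \<in> chart_image d" for d x
  proof -
    have fd: "f d = (\<lambda>x. cb.zero_ext (chart_inv d x))" by (rule ext) (simp add: f_def)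
    have L: "0 \<le> 5/2 * ?m" by simp
    note fa = cb.forms_all_charts[OF less_imp_le[OF C] L bf[rule_format] osc[rule_format] d x]
    show "bounded_form (metric_inner (g d) x) (hess (g d) (f d) x) (\<lambda>v. dir_deriv (f d) v x) C"
      "trace_osc_le (metric_inner (g d) x) (hess (g d) (f d) x) (5/2 * ?m)" unfolding fd using fa by simp_all
  qed
  define gap where "gap = ?T F x1 a b - ?T F x1 a' b'"
  have gap: "gap > 0" using at1(4) by (simp add: gap_def)
  have "\<forall>\<^sub>F \<epsilon> in at_right (0::real). \<epsilon> > 0 \<and> \<epsilon> * 1 < 1 \<and> \<epsilon> * (4 * C) < 1 \<and> \<epsilon> * (40 * M) < 1
      \<and> \<epsilon> * (C + 3 * ?m * C) < ?m / 20 \<and> \<epsilon> * (4 * ?m) < 1 \<and> \<epsilon> * (3 * C) < gap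
      \<and> conf (\<lambda>p. 1 + \<epsilon> * cb.zero_ext p) \<in> W"
    by (intro eventually_conj eventually_at_right_less eventually_small conf_in_open[OF cb.smooth_zero_ext ext0 W(1,2)])
      (use m gap in simp_all)
  \<comment> \<open>In order, beyond positivity and \<open>\<epsilon>\<close> below 1:
    \<open>\<kappa>\<close> within 1/2 of 1; \<open>\<rho>\<close> at most 41/40; quadratic terms at
    most 1/20 of \<open>bump_mass\<close>; the curvature drop at \<open>x0\<close> at most 1/2;
    strictness at \<open>x1\<close>; membership in the neighborhood.\<close>
  then obtain \<epsilon> where eps: "\<epsilon> > 0" "\<epsilon> * 1 < 1" "\<epsilon> * (4 * C) < 1" "\<epsilon> * (40 * M) < 1"
      "\<epsilon> * (C + 3 * ?m * C) < ?m / 20" "\<epsilon> * (4 * ?m) < 1" "\<epsilon> * (3 * C) < gap"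
      and inW: "conf (\<lambda>p. 1 + \<epsilon> * cb.zero_ext p) \<in> W"
    by (auto dest!: eventually_happens'[OF trivial_limit_at_right_real])
  define g' where "g' = conf (\<lambda>p. 1 + \<epsilon> * cb.zero_ext p)"
  have rm': "riemannian_metric A g'"
    unfolding g'_def by (rule riemannian_conf[OF smooth_function_affine[OF cb.smooth_zero_ext]])
      (use eps(1) ext0 in \<open>auto intro: add_pos_nonneg\<close>)
  interpret g': manifold_metric A g' by unfold_locales (fact assms(3), fact rm')
  define \<rho> where "\<rho> d x = 1 + \<epsilon> * f d x" for d x
  have rho: "1 \<le> \<rho> d x" "\<rho> d x \<le> 41/40" for d x
  proof -
    show "1 \<le> \<rho> d x" using eps(1) ext0 by (simp add: \<rho>_def f_def)
    have "\<epsilon> * f d x \<le> \<epsilon> * M" using eps(1) extM by (intro mult_left_mono) (auto simp: f_def)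
    then show "\<rho> d x \<le> 41/40" using eps(4) by (simp add: \<rho>_def)
  qed
  define \<tau> where "\<tau> d x a b = trace_on (metric_inner (g d) x) (hess (g d) (f d) x) a b" for d x a b
  define \<theta> where "\<theta> d x a b = trace_on (metric_inner (g d) x) (\<lambda>v w. dir_deriv (f d) v x * dir_deriv (f d) w x) a b" for d x a b
  define \<kappa> where "\<kappa> r N t th = 1 + \<epsilon> * t / (2 * r) - 3 * \<epsilon>\<^sup>2 * th / (4 * r\<^sup>2) + \<epsilon>\<^sup>2 * N / (4 * r\<^sup>2)" for r N t th :: real
  have curv: "\<exists>N. (\<forall>a b. indep2 a b \<longrightarrow> sectional_curvature g' d x (span {a, b}) = - \<kappa> (\<rho> d x) N (\<tau> d x a b) (\<theta> d x a b) / \<rho> d x)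
      \<and> 0 \<le> N \<and> N \<le> C \<and> ((\<forall>v. dir_deriv (f d) v x = 0) \<longrightarrow> N = 0)
      \<and> (\<forall>a b. indep2 a b \<longrightarrow> 0 \<le> \<theta> d x a b \<and> \<theta> d x a b \<le> C \<and> \<bar>\<tau> d x a b\<bar> \<le> 2 * C)"
    if d: "d \<in> A" and x: "x \<in> chart_image d" for d x
  proof -
    interpret D: local_metric "chart_image d" "g d" by (rule local_metric_chart[OF d])
    have sec1: "sec (g d) x a b = - 1" if "indep2 a b" for a b
      using sectional_curvature_span[OF d x that] hyp[OF d x indep2_two_planes[OF that]] by simp
    have f0: "f d y \<ge> 0" for y using ext0 by (simp add: f_def)
    obtain N where N: "\<forall>a b. indep2 a b \<longrightarrow> sec (\<lambda>y. (1 + \<epsilon> * f d y) *\<^sub>R g d y) x a b = - \<kappa> (\<rho> d x) N (\<tau> d x a b) (\<theta> d x a b) / \<rho> d x"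
      "0 \<le> N" "N \<le> C" "(\<forall>v. dir_deriv (f d) v x = 0) \<longrightarrow> N = 0"
      "\<forall>a b. indep2 a b \<longrightarrow> 0 \<le> \<theta> d x a b \<and> \<theta> d x a b \<le> C \<and> \<bar>\<tau> d x a b\<bar> \<le> 2 * C"
      using D.curvature_deformed[OF sf[OF d] f0 eps(1) sec1 x forms(1)[OF d x]]
      unfolding \<kappa>_def \<rho>_def \<tau>_def \<theta>_def by blast
    have g'd: "g' d = (\<lambda>y. (1 + \<epsilon> * f d y) *\<^sub>R g d y)" by (rule ext) (simp add: g'_def conf_def f_def)
    have "sectional_curvature g' d x (span {a, b}) = - \<kappa> (\<rho> d x) N (\<tau> d x a b) (\<theta> d x a b) / \<rho> d x" if "indep2 a b" for a b
      using g'.sectional_curvature_span[OF d x that] N(1) that by (simp add: g'd)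
    then show ?thesis using N(2-) by blast
  qed
  define k where "k d x P = - sectional_curvature g' d x P" for d x P
  \<comment> \<open>13/10 exceeds 5/4, half of the trace oscillation 5/2, by the 1/20 reserved for
    quadratic terms.\<close>
  define D where "D = 13/10 * ?m * \<epsilon>"
  have pair: "(1 - D) * k d x Q \<le> k d x P \<and> 1/4 \<le> k d x P \<and> k d x P \<le> 2"
    if d: "d \<in> A" and x: "x \<in> chart_image d" and P: "P \<in> two_planes" and Q: "Q \<in> two_planes" for d x P Q
  proof -
    obtain p p' where p: "indep2 p p'" "P = span {p, p'}" using two_planes_span[OF P] .
    obtain r r' where q: "indep2 r r'" "Q = span {r, r'}" using two_planes_span[OF Q] .
    obtain N where N: "\<And>a b. indep2 a b \<Longrightarrow> sectional_curvature g' d x (span {a, b}) = - \<kappa> (\<rho> d x) N (\<tau> d x a b) (\<theta> d x a b) / \<rho> d x"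
      "0 \<le> N" "N \<le> C" "\<And>a b. indep2 a b \<Longrightarrow> 0 \<le> \<theta> d x a b \<and> \<theta> d x a b \<le> C \<and> \<bar>\<tau> d x a b\<bar> \<le> 2 * C"
      using curv[OF d x] by blast
    define kP kQ where "kP = \<kappa> (\<rho> d x) N (\<tau> d x p p') (\<theta> d x p p')" "kQ = \<kappa> (\<rho> d x) N (\<tau> d x r r') (\<theta> d x r r')"
    have kk: "k d x P = kP / \<rho> d x" "k d x Q = kQ / \<rho> d x"
      unfolding k_def p(2) q(2) N(1)[OF p(1)] N(1)[OF q(1)] kP_kQ_def by simp_all
    have osc: "\<tau> d x r r' - \<tau> d x p p' \<le> 5/2 * ?m"
      using forms(2)[OF d x] p(1) q(1) unfolding trace_osc_le_def \<tau>_def by blast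
    have e1: "\<epsilon> \<le> 1" "5/2 * ?m \<ge> 0" "C \<ge> 0" using eps C by auto
    have tr: "0 \<le> \<theta> d x r r'" "\<theta> d x r r' \<le> C" "\<bar>\<tau> d x r r'\<bar> \<le> 2 * C"
      and tp: "0 \<le> \<theta> d x p p'" "\<theta> d x p p' \<le> C" "\<bar>\<tau> d x p p'\<bar> \<le> 2 * C"
      using N(4)[OF q(1)] N(4)[OF p(1)] by blast+
    have osc': "\<tau> d x p p' - \<tau> d x p p' \<le> 5/2 * ?m" by simp
    have bP: "\<bar>kP - 1\<bar> \<le> \<epsilon> * (2 * C)"
      unfolding kP_kQ_def \<kappa>_def
      by (rule kappa_bounds(1)[OF eps(1) e1(1) rho(1) e1(3,2) tp(3,1,2) tp(1,2) N(2,3) osc'])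
    have bQ: "\<bar>kQ - 1\<bar> \<le> \<epsilon> * (2 * C)" "kQ - kP \<le> \<epsilon> * (5/2 * ?m / 2 + \<epsilon> * C)"
      unfolding kP_kQ_def \<kappa>_def
      by (rule kappa_bounds[OF eps(1) e1(1) rho(1) e1(3,2) tr(3,1,2) tp(1,2) N(2,3) osc])+
    have kP: "1/2 \<le> kP" "kP \<le> 3/2" using bP eps(3) by (auto simp: abs_le_iff)
    have kQ: "1 - \<epsilon> * (2 * C) \<le> kQ" using bQ(1) by (simp add: abs_le_iff)
    \<comment> \<open>The claim is relative, \<open>kQ - kP \<le> D * kQ\<close>, so the bound must
      also absorb the deviation of \<open>kQ\<close> from 1.\<close>
    have "\<epsilon> * (5/2 * ?m / 2 + \<epsilon> * C) \<le> \<epsilon> * (13/10 * ?m * (1 - \<epsilon> * (2 * C)))"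
    proof (rule mult_left_mono)
      have "0 \<le> ?m * (\<epsilon> * C)" using eps C by simp
      moreover have "\<epsilon> * C + 3 * (?m * (\<epsilon> * C)) < ?m / 20" using eps(5) by (simp add: algebra_simps)
      ultimately have "5/4 * ?m + \<epsilon> * C \<le> 13/10 * ?m - 26/10 * (?m * (\<epsilon> * C))" by linarith
      then show "5/2 * ?m / 2 + \<epsilon> * C \<le> 13/10 * ?m * (1 - \<epsilon> * (2 * C))" by (simp add: algebra_simps)
    qed (use eps in simp)
    also have "\<dots> = D * (1 - \<epsilon> * (2 * C))" by (simp add: D_def)
    also have "\<dots> \<le> D * kQ" using kQ eps(1) by (intro mult_left_mono) (simp_all add: D_def)
    finally have "(1 - D) * kQ \<le> kP" using bQ(2) by (simp add: left_diff_distrib)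
    then have "(1 - D) * k d x Q \<le> k d x P"
      unfolding kk using rho(1)[of d x] by (simp add: divide_right_mono)
    moreover have "kP / \<rho> d x \<le> 2" "1/4 \<le> kP / \<rho> d x"
      using rho[of d x] kP by (auto simp: divide_simps)
    ultimately show ?thesis by (simp add: kk)
  qed
  have f_F: "hess (g c0) (f c0) y = hess (g c0) F y" "dir_deriv (f c0) v y = dir_deriv F v y" "f c0 y = F y"
    if "y \<in> chart_image c0" for y v
    using hess_cong_open[OF lm.open_S that, of "f c0" F] dir_deriv_cong_open[OF lm.open_S that, of "f c0" F]
      cb.zero_ext_chart that by (auto simp: f_def)
  have plane: "span {a, b} \<in> two_planes" "span {a', b'} \<in> two_planes"
    using indep2_two_planes at1(2,3) by blast+
  have strict: "k c0 x1 (span {a', b'}) < k c0 x1 (span {a, b})"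
  proof -
    obtain N where N: "\<And>a b. indep2 a b \<Longrightarrow> sectional_curvature g' c0 x1 (span {a, b}) = - \<kappa> (\<rho> c0 x1) N (\<tau> c0 x1 a b) (\<theta> c0 x1 a b) / \<rho> c0 x1"
      "\<And>a b. indep2 a b \<Longrightarrow> 0 \<le> \<theta> c0 x1 a b \<and> \<theta> c0 x1 a b \<le> C"
      using curv[OF c0 at1(1)] by blast
    have "\<epsilon> * (3 * C) < \<tau> c0 x1 a b - \<tau> c0 x1 a' b'"
      using eps(7) unfolding gap_def \<tau>_def f_F[OF at1(1)] .
    then have "\<kappa> (\<rho> c0 x1) N (\<tau> c0 x1 a' b') (\<theta> c0 x1 a' b') < \<kappa> (\<rho> c0 x1) N (\<tau> c0 x1 a b) (\<theta> c0 x1 a b)"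
      unfolding \<kappa>_def using N(2)[OF at1(2)] N(2)[OF at1(3)] C by (intro kappa_strict[OF eps(1) rho(1)]) auto
    then show ?thesis
      unfolding k_def N(1)[OF at1(2)] N(1)[OF at1(3)] using rho(1)[of c0 x1] by (simp add: divide_strict_right_mono)
  qed
  \<comment> \<open>At the center the gradient vanishes and the Hessian is a multiple of the metric,
    so every plane has trace -4 \<open>bump_mass\<close>. The outer division by
    \<open>\<rho>\<close>, at least 1, only lowers the value further.\<close>
  have kx0: "k c0 x0 (span {a, b}) \<le> 1 - 3/2 * D"
  proof -
    have g0: "gram (metric_inner (g c0) x0) a b > 0" by (rule lm.gram_mi_pos[OF x0 at1(2)])
    have "mix (metric_inner (g c0) x0) (hess (g c0) F x0) a b = - 4 * ?m * gram (metric_inner (g c0) x0) a b"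
      unfolding mix_def gram_def at0(2) by (simp add: algebra_simps power2_eq_square)
    then have t: "\<tau> c0 x0 a b = - 4 * ?m" using g0 unfolding \<tau>_def f_F[OF x0] by simp
    have th: "\<theta> c0 x0 a b = 0" unfolding \<theta>_def f_F[OF x0] at0(1) by (simp add: mix_def)
    have "sectional_curvature g' c0 x0 (span {a, b}) = - \<kappa> (\<rho> c0 x0) 0 (\<tau> c0 x0 a b) (\<theta> c0 x0 a b) / \<rho> c0 x0"
      using curv[OF c0 x0] at1(2) f_F(2)[OF x0] at0(1) by auto
    then have "k c0 x0 (span {a, b}) = \<kappa> (\<rho> c0 x0) 0 (\<tau> c0 x0 a b) (\<theta> c0 x0 a b) / \<rho> c0 x0"
      unfolding k_def by simp
    then have k: "k c0 x0 (span {a, b}) = (1 - \<epsilon> * (2 * ?m) / \<rho> c0 x0) / \<rho> c0 x0"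
      unfolding t th \<kappa>_def by simp
    define z where "z = \<epsilon> * (2 * ?m)"
    have z: "0 \<le> z" "z \<le> 1/2" using eps(1,6) by (simp_all add: z_def)
    note r = rho[of c0 x0]
    have "z / \<rho> c0 x0 \<le> z / 1" using z(1) r(1) by (intro divide_left_mono) auto
    then have "(1 - z / \<rho> c0 x0) / \<rho> c0 x0 \<le> (1 - z / \<rho> c0 x0) / 1"
      using z r by (intro divide_left_mono) auto
    \<comment> \<open>The slack is tight: \<open>3/2 * D\<close> is 39/40 of \<open>z\<close>, and
      40/41 exceeds 39/40.\<close>
    also have "\<dots> \<le> 1 - z / (41/40)"
    proof -
      have "z / (41/40) \<le> z / \<rho> c0 x0" using z r by (intro divide_left_mono) auto
      then show ?thesis by simp
    qed
    also have "\<dots> \<le> 1 - 3/2 * D"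
    proof -
      have "D = 13/20 * z" by (simp add: D_def z_def)
      then show ?thesis using z(1) by simp
    qed
    finally show ?thesis unfolding k z_def .
  qed
  \<comment> \<open>Outside the support the curvature is still that of the hyperbolic metric, which
    is the reference value for the global ratio.\<close>
  have kx2: "k c0 x2 (span {a, b}) = 1"
  proof -
    have t: "\<tau> c0 x2 a b = 0" unfolding \<tau>_def f_F[OF at2(1)] mix_def at2(4) by simp
    have th: "\<theta> c0 x2 a b = 0" unfolding \<theta>_def f_F[OF at2(1)] at2(3) by (simp add: mix_def)
    have r: "\<rho> c0 x2 = 1" unfolding \<rho>_def f_F[OF at2(1)] at2(2) by simp
    have "sectional_curvature g' c0 x2 (span {a, b}) = - \<kappa> (\<rho> c0 x2) 0 (\<tau> c0 x2 a b) (\<theta> c0 x2 a b) / \<rho> c0 x2"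
      using curv[OF c0 at2(1)] at1(2) f_F(2)[OF at2(1)] at2(3) by auto
    then show ?thesis unfolding k_def t th r \<kappa>_def by simp
  qed
  show ?thesis
  proof (intro bexI conjI)
    show "g' \<in> V" using inW W(3) by (auto simp: g'_def)
    show "riemannian_metric A g'" by (rule rm')
    show "negatively_curved A g'"
      unfolding negatively_curved_def
    proof (intro ballI)
      fix c x and P :: "(real^'n) set" assume "c \<in> A" "x \<in> chart_image c" "P \<in> two_planes"
      then show "sectional_curvature g' c x P < 0" using pair[of c x P P] by (simp add: k_def)
    qed
    show "\<exists>a1 a2. best_local_pinching A g' a1 \<and> best_global_pinching A g' a2 \<and>
       0 < a1 \<and> a1 < 1 \<and> (1 - a2) / (1 - a1) \<ge> 3/2 \<and> a2 < a1"
    proof (rule g'.pinching_of_bounds[of "1/4" 2 D c0 x1 "span {a', b'}" "span {a, b}" c0 x0 "span {a, b}" c0 x2 "span {a, b}"])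
      show "- sectional_curvature g' c0 x0 (span {a, b}) \<le> (1 - 3/2 * D) * - sectional_curvature g' c0 x2 (span {a, b})"
        using kx0 kx2 unfolding k_def by simp
      show "- sectional_curvature g' c0 x1 (span {a', b'}) < - sectional_curvature g' c0 x1 (span {a, b})"
        using strict unfolding k_def .
    next
      fix c x and P Q :: "(real^'n) set" assume *: "c \<in> A" "x \<in> chart_image c" "P \<in> two_planes"
      show "1/4 \<le> - sectional_curvature g' c x P \<and> - sectional_curvature g' c x P \<le> 2"
        using pair[OF * *(3)] unfolding k_def by blast
      assume "Q \<in> two_planes"
      then show "(1 - D) * - sectional_curvature g' c x Q \<le> - sectional_curvature g' c x P"
        using pair[OF *] unfolding k_def by blast
    qed (simp, (fact c0 at1(1) x0 at2(1) plane)+)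
  qed
qed

end
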